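(* Let $p\in[2,\infty)$. Assume that $\nu$ satisfies (A1) and (A2), that $D\subset\mathbb{R}^d$ is a nonempty bounded open set, that $D^c$ satisfies (VDC), and that $|\partial D|=0$ (Lebesgue measure). Then the normalized Dirichlet-to-Neumann map $\widetilde{DN}$ is bounded on $L^p(D^c,m)$.
   Context: All functions and sets are Borel. $d\ge 1$. The function $\nu\colon[0,\infty)\to(0,\infty]$ is nonincreasing; write $\nu(z)=\nu(|z|)$ for $z\in\mathbb{R}^d$ and $\nu(x,y)=\nu(y-x)$. It is assumed that $\int_{\mathbb{R}^d}\nu(z)\,dz=\infty$ and $\int_{\mathbb{R}^d}(|z|^2\wedge 1)\nu(z)\,dz<\infty$. (A1): $\nu$ is twice continuously differentiable on $(0,\infty)$ and there is a constant $C_1$ such that $|\nu'(r)|,|\nu''(r)|\le C_1\nu(r)$ for $r>1$. (A2): there are constants $\beta\in(0,2)$, $C_2>0$ such that $\nu(\lambda r)\le C_2\lambda^{-d-\beta}\nu(r)$ for $0<\lambda,r\le 1$ and $\nu(r)\le C_2\nu(r+1)$ for $r\ge 1$. (VDC) for $D^c$: there is $c>0$ such that $|D^c\cap B(x,r)|\ge c r^d$ for every $r>0$ and $x\in\partial D$. Process: $(X_t)_{t\ge0}$ is the c\`adl\`ag symmetric pure-jump L\'evy process in $\mathbb{R}^d$ with L\'evy triplet $(0,\nu,0)$, i.e. with transition density $p_t(x,y)=p_t(y-x)$, $\int e^{i\xi\cdot x}p_t(x)\,dx=e^{-t\psi(\xi)}$, $\psi(\xi)=\int_{\mathbb{R}^d}(1-\cos\xi\cdot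 x)\nu(x)\,dx$; $p_t$ is continuous on $\mathbb{R}^d\setminus\{0\}$. $\mathbb{P}^x,\mathbb{E}^x$ refer to the process started at $x$, and $\tau_D=\inf\{t>0: X_t\notin D\}$. The Dirichlet heat kernel is $p_t^D(x,y)=p_t(x,y)-\mathbb{E}^x[p_{t-\tau_D}(X_{\tau_D},y);\tau_D<t]$, the Green function is $G_D(x,y)=\int_0^\infty p_t^D(x,y)\,dt$, the Poisson kernel is $P_D(x,z)=\int_D G_D(x,y)\nu(y,z)\,dy$ for $x\in D$, $z\in D^c$, and the interaction kernel is $\gamma_D(w,z)=\int_D\int_D\nu(w,x)G_D(x,y)\nu(y,z)\,dx\,dy$ for $w,z\in D^c$. For $g\colon D^c\to\mathbb{R}$, $P_D[g](x)=g(x)$ for $x\in D^c$ and $P_D[g](x)=\int_{D^c}g(z)P_D(x,z)\,dz$ for $x\in D$. For $\kappa\in\mathbb{R}$, $x^{\langle\kappa\rangle}=|x|^\kappa\,\mathrm{sgn}(x)$ with $0^{\langle\kappa\rangle}=0$; $F_p(a,b)=|b|^p-|a|^p-p\,a^{\langle p-1\rangle}(b-a)$; $\mathcal{H}_D^{(p)}[g]=\tfrac1p\iint_{D^c\times D^c}F_p(g(w),g(z))\gamma_D(w,z)\,dw\,dz$; $\mathcal{X}_D^p=\{g\colon D^c\to\mathbb{R}:\mathcal{H}_D^{(p)}[g]<\infty\}$. (Under the present assumptions $L^p(D^c,m)\subset\mathcal{X}_D^p$.) Nonlocal normal derivative: $\mathcal{N}f(z)=\int_D(f(z)-f(x))\nu(x,z)\,dx$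 for $z\in D^c$, when convergent. Dirichlet-to-Neumann operator: $DN\,g=\mathcal{N}(P_D[g])$ for $g\in\mathcal{X}_D^p$, defined for a.e. $z\in D^c$. Weight: $m(z)=\int_D\nu(x,z)\,dx$ for $z\in\mathbb{R}^d\setminus\overline{D}$ (finite; equal to $\int_{D^c}\gamma_D(w,z)\,dw$). Normalized Dirichlet-to-Neumann operator: $\widetilde{DN}g(z)=DN\,g(z)/m(z)$ for a.e. $z\in D^c$. $L^p(D^c,m)$ is the $L^p$ space on $D^c$ with respect to the measure $m(z)\,dz$. *)

theory Defs
  imports "HOL-Probability.Probability"
begin

section \<open>The Levy density\<close>

text \<open>The density is given by its radial profile on \<open>[0,\<infinity>)\<close> with values in \<open>(0,\<infinity>]\<close>; its values at
  negative arguments are never used. The dimension is \<open>DIM('a)\<close>.\<close>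

definition jump :: "(real \<Rightarrow> ennreal) \<Rightarrow> 'a::euclidean_space \<Rightarrow> 'a \<Rightarrow> ennreal" where
  "jump \<nu> x y = \<nu> (norm (y - x))"

definition levy_density :: "'a::euclidean_space itself \<Rightarrow> (real \<Rightarrow> ennreal) \<Rightarrow> bool" where
  "levy_density _ \<nu> \<longleftrightarrow>
     (\<forall>r\<ge>0. 0 < \<nu> r) \<and> antimono_on {0..} \<nu> \<and>
     (\<integral>\<^sup>+z. \<nu> (norm z) \<partial>(lborel :: 'a measure)) = \<infinity> \<and>
     (\<integral>\<^sup>+z. ennreal (min ((norm z)\<^sup>2) 1) * \<nu> (norm z) \<partial>(lborel :: 'a measure)) < \<infinity>"

text \<open>Finiteness of the profile on \<open>(0,\<infinity>)\<close> follows from \<^const>\<open>levy_density\<close>; it is spelled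
  out because derivatives are taken of the real-valued profile.\<close>

definition cond_A1 :: "(real \<Rightarrow> ennreal) \<Rightarrow> bool" where
  "cond_A1 \<nu> \<longleftrightarrow> (\<forall>r>0. \<nu> r < \<infinity>) \<and>
     (\<exists>\<nu>' \<nu>''. (\<forall>r>0. ((\<lambda>s. enn2real (\<nu> s)) has_real_derivative \<nu>' r) (at r)) \<and>
              (\<forall>r>0. (\<nu>' has_real_derivative \<nu>'' r) (at r)) \<and>
              continuous_on {0<..} \<nu>'' \<and>
              (\<exists>C. \<forall>r>1. \<bar>\<nu>' r\<bar> \<le> C * enn2real (\<nu> r) \<and> \<bar>\<nu>'' r\<bar> \<le> C * enn2real (\<nu> r)))"

definition cond_A2 :: "'a::euclidean_space itself \<Rightarrow> (real \<Rightarrow> ennreal) \<Rightarrow> bool" where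
  "cond_A2 _ \<nu> \<longleftrightarrow>
     (\<exists>\<beta> C. 0 < \<beta> \<and> \<beta> < 2 \<and> 0 < C \<and>
        (\<forall>l r. 0 < l \<and> l \<le> 1 \<and> 0 < r \<and> r \<le> 1 \<longrightarrow>
           \<nu> (l * r) \<le> ennreal (C * l powr (- real DIM('a) - \<beta>)) * \<nu> r) \<and>
        (\<forall>r\<ge>1. \<nu> r \<le> ennreal C * \<nu> (r + 1)))"

definition complement_VDC :: "'a::euclidean_space set \<Rightarrow> bool" where
  "complement_VDC D \<longleftrightarrow>
     (\<exists>c>0. \<forall>x\<in>frontier D. \<forall>r>0. ennreal (c * r ^ DIM('a)) \<le> emeasure lborel (- D \<inter> ball x r))"

section \<open>The process and its transition density\<close>

definition levy_exponent :: "(real \<Rightarrow> ennreal) \<Rightarrow> 'a::euclidean_space \<Rightarrow> real" where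
  "levy_exponent \<nu> \<xi> = (LINT x|lborel. (1 - cos (\<xi> \<bullet> x)) * enn2real (\<nu> (norm x)))"

text \<open>At \<open>\<xi> = 0\<close> the last clause makes \<open>p t\<close> a probability density. The value \<open>p t 0\<close> is left
  unconstrained (it may be \<open>\<infinity>\<close>): it affects the Dirichlet heat kernel of an open set only on the
  diagonal, which is a null set.\<close>

definition transition_density ::
    "(real \<Rightarrow> ennreal) \<Rightarrow> (real \<Rightarrow> 'a::euclidean_space \<Rightarrow> ennreal) \<Rightarrow> bool" where
  "transition_density \<nu> p \<longleftrightarrow>
     (\<forall>t>0. p t \<in> borel_measurable borel \<and> continuous_on (- {0}) (p t) \<and> (\<forall>x. x \<noteq> 0 \<longrightarrow> p t x < \<infinity>) \<and>
        (\<forall>\<xi>. (LINT x|density lborel (p t). cis (\<xi> \<bullet> x)) = complex_of_real (exp (- t * levy_exponent \<nu> \<xi>))))"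

definition levy_process :: "'w measure \<Rightarrow> (real \<Rightarrow> 'w \<Rightarrow> 'a::euclidean_space) \<Rightarrow> bool" where
  "levy_process M X \<longleftrightarrow>
     prob_space M \<and>
     (\<forall>t\<ge>0. X t \<in> borel_measurable M) \<and>
     (AE \<omega> in M. X 0 \<omega> = 0) \<and>
     (\<forall>(n::nat) t. 0 \<le> t 0 \<and> (\<forall>i<n. t i \<le> t (Suc i)) \<longrightarrow>
        prob_space.indep_vars M (\<lambda>_. borel) (\<lambda>i \<omega>. X (t (Suc i)) \<omega> - X (t i) \<omega>) {..<n}) \<and>
     (\<forall>s t. 0 \<le> s \<and> s \<le> t \<longrightarrow>
        distr M borel (\<lambda>\<omega>. X t \<omega> - X s \<omega>) = distr M borel (X (t - s))) \<and>
     (\<forall>\<omega>\<in>space M. (\<forall>t\<ge>0. continuous (at_right t) (\<lambda>s. X s \<omega>)) \<and>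
                  (\<forall>t>0. \<exists>l. ((\<lambda>s. X s \<omega>) \<longlongrightarrow> l) (at_left t)))"

text \<open>The cadlag Levy process with triplet \<open>(0,\<nu>,0)\<close> and transition density \<open>p\<close>, started at \<open>0\<close>.
  The law \<open>\<bbbP>\<^sup>x\<close> of the process started at \<open>x\<close> is the law of \<open>x + X\<close>.\<close>

definition jump_process ::
    "(real \<Rightarrow> ennreal) \<Rightarrow> 'w measure \<Rightarrow> (real \<Rightarrow> 'w \<Rightarrow> 'a::euclidean_space) \<Rightarrow> (real \<Rightarrow> 'a \<Rightarrow> ennreal) \<Rightarrow> bool" where
  "jump_process \<nu> M X p \<longleftrightarrow>
     levy_process M X \<and> transition_density \<nu> p \<and>
     (\<forall>t>0. distr M borel (X t) = density lborel (p t))"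

definition exit_time :: "'a::euclidean_space set \<Rightarrow> (real \<Rightarrow> 'w \<Rightarrow> 'a) \<Rightarrow> 'a \<Rightarrow> 'w \<Rightarrow> ennreal" where
  "exit_time D X x \<omega> = Inf (ennreal ` {t. 0 < t \<and> x + X t \<omega> \<notin> D})"

section \<open>Potential-theoretic kernels\<close>

text \<open>The difference is taken in \<^typ>\<open>ennreal\<close>, where it is truncated at \<open>0\<close>; off the diagonal of
  \<open>D \<times> D\<close> the subtracted expectation is finite and at most \<open>p t (y - x)\<close>, so nothing is truncated there.
  The expectation is a nonnegative integral so that no completeness of \<open>M\<close> is needed:
  the exit time need only agree almost surely with a measurable function.\<close>

definition dirichlet_heat_kernel ::
    "'w measure \<Rightarrow> (real \<Rightarrow> 'w \<Rightarrow> 'a::euclidean_space) \<Rightarrow> (real \<Rightarrow> 'a \<Rightarrow> ennreal) \<Rightarrow> 'a set \<Rightarrow>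
     real \<Rightarrow> 'a \<Rightarrow> 'a \<Rightarrow> ennreal" where
  "dirichlet_heat_kernel M X p D t x y =
     p t (y - x) -
     (\<integral>\<^sup>+\<omega>. (if exit_time D X x \<omega> < ennreal t
            then let \<tau> = enn2real (exit_time D X x \<omega>) in p (t - \<tau>) (y - (x + X \<tau> \<omega>))
            else 0) \<partial>M)"

definition green ::
    "'w measure \<Rightarrow> (real \<Rightarrow> 'w \<Rightarrow> 'a::euclidean_space) \<Rightarrow> (real \<Rightarrow> 'a \<Rightarrow> ennreal) \<Rightarrow> 'a set \<Rightarrow>
     'a \<Rightarrow> 'a \<Rightarrow> ennreal" where
  "green M X p D x y = (\<integral>\<^sup>+t\<in>{0<..}. dirichlet_heat_kernel M X p D t x y \<partial>lborel)"

definition poisson_kernel ::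
    "(real \<Rightarrow> ennreal) \<Rightarrow> 'w measure \<Rightarrow> (real \<Rightarrow> 'w \<Rightarrow> 'a::euclidean_space) \<Rightarrow> (real \<Rightarrow> 'a \<Rightarrow> ennreal) \<Rightarrow>
     'a set \<Rightarrow> 'a \<Rightarrow> 'a \<Rightarrow> ennreal" where
  "poisson_kernel \<nu> M X p D x z = (\<integral>\<^sup>+y\<in>D. green M X p D x y * jump \<nu> y z \<partial>lborel)"

definition interaction_kernel ::
    "(real \<Rightarrow> ennreal) \<Rightarrow> 'w measure \<Rightarrow> (real \<Rightarrow> 'w \<Rightarrow> 'a::euclidean_space) \<Rightarrow> (real \<Rightarrow> 'a \<Rightarrow> ennreal) \<Rightarrow>
     'a set \<Rightarrow> 'a \<Rightarrow> 'a \<Rightarrow> ennreal" where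
  "interaction_kernel \<nu> M X p D w z =
     (\<integral>\<^sup>+x\<in>D. (\<integral>\<^sup>+y\<in>D. jump \<nu> w x * green M X p D x y * jump \<nu> y z \<partial>lborel) \<partial>lborel)"

section \<open>Poisson extension and Dirichlet-to-Neumann operator\<close>

text \<open>Functions on \<open>D\<^sup>c\<close> are functions on the whole space whose values on \<open>D\<close> are disregarded.\<close>

definition poisson_ext ::
    "(real \<Rightarrow> ennreal) \<Rightarrow> 'w measure \<Rightarrow> (real \<Rightarrow> 'w \<Rightarrow> 'a::euclidean_space) \<Rightarrow> (real \<Rightarrow> 'a \<Rightarrow> ennreal) \<Rightarrow>
     'a set \<Rightarrow> ('a \<Rightarrow> real) \<Rightarrow> 'a \<Rightarrow> real" where
  "poisson_ext \<nu> M X p D g x =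
     (if x \<in> D then (LINT z:- D|lborel. g z * enn2real (poisson_kernel \<nu> M X p D x z)) else g x)"

definition normal_derivative ::
    "(real \<Rightarrow> ennreal) \<Rightarrow> 'a::euclidean_space set \<Rightarrow> ('a \<Rightarrow> real) \<Rightarrow> 'a \<Rightarrow> real" where
  "normal_derivative \<nu> D f z = (LINT x:D|lborel. (f z - f x) * enn2real (jump \<nu> x z))"

definition DN ::
    "(real \<Rightarrow> ennreal) \<Rightarrow> 'w measure \<Rightarrow> (real \<Rightarrow> 'w \<Rightarrow> 'a::euclidean_space) \<Rightarrow> (real \<Rightarrow> 'a \<Rightarrow> ennreal) \<Rightarrow>
     'a set \<Rightarrow> ('a \<Rightarrow> real) \<Rightarrow> 'a \<Rightarrow> real" where
  "DN \<nu> M X p D g = normal_derivative \<nu> D (poisson_ext \<nu> M X p D g)"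

definition dn_weight :: "(real \<Rightarrow> ennreal) \<Rightarrow> 'a::euclidean_space set \<Rightarrow> 'a \<Rightarrow> ennreal" where
  "dn_weight \<nu> D z = (\<integral>\<^sup>+x\<in>D. jump \<nu> x z \<partial>lborel)"

definition normalized_DN ::
    "(real \<Rightarrow> ennreal) \<Rightarrow> 'w measure \<Rightarrow> (real \<Rightarrow> 'w \<Rightarrow> 'a::euclidean_space) \<Rightarrow> (real \<Rightarrow> 'a \<Rightarrow> ennreal) \<Rightarrow>
     'a set \<Rightarrow> ('a \<Rightarrow> real) \<Rightarrow> 'a \<Rightarrow> real" where
  "normalized_DN \<nu> M X p D g z = DN \<nu> M X p D g z / enn2real (dn_weight \<nu> D z)"

section \<open>Function spaces\<close>

definition signed_powr :: "real \<Rightarrow> real \<Rightarrow> real" where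
  "signed_powr x \<kappa> = \<bar>x\<bar> powr \<kappa> * sgn x"

definition bregman :: "real \<Rightarrow> real \<Rightarrow> real \<Rightarrow> real" where
  "bregman q a b = \<bar>b\<bar> powr q - \<bar>a\<bar> powr q - q * signed_powr a (q - 1) * (b - a)"

text \<open>For \<open>q > 1\<close>, \<^term>\<open>bregman q a b\<close> is nonnegative by convexity of \<open>\<bar>\<cdot>\<bar>\<^sup>q\<close>.\<close>

definition exterior_form ::
    "(real \<Rightarrow> ennreal) \<Rightarrow> 'w measure \<Rightarrow> (real \<Rightarrow> 'w \<Rightarrow> 'a::euclidean_space) \<Rightarrow> (real \<Rightarrow> 'a \<Rightarrow> ennreal) \<Rightarrow>
     'a set \<Rightarrow> real \<Rightarrow> ('a \<Rightarrow> real) \<Rightarrow> ennreal" where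
  "exterior_form \<nu> M X p D q g =
     ennreal (1 / q) *
     (\<integral>\<^sup>+z\<in>- D. (\<integral>\<^sup>+w\<in>- D. ennreal (bregman q (g w) (g z)) * interaction_kernel \<nu> M X p D w z
        \<partial>lborel) \<partial>lborel)"

definition exterior_space ::
    "(real \<Rightarrow> ennreal) \<Rightarrow> 'w measure \<Rightarrow> (real \<Rightarrow> 'w \<Rightarrow> 'a::euclidean_space) \<Rightarrow> (real \<Rightarrow> 'a \<Rightarrow> ennreal) \<Rightarrow>
     'a set \<Rightarrow> real \<Rightarrow> ('a \<Rightarrow> real) set" where
  "exterior_space \<nu> M X p D q =
     {g \<in> borel_measurable (restrict_space borel (- D)). exterior_form \<nu> M X p D q g < \<infinity>}"

text \<open>The measure \<open>m(z) dz\<close> on \<open>D\<^sup>c\<close>. The weight may be infinite on \<open>\<partial>D\<close>, which is required to be a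
  null set where this measure is used.\<close>

definition weighted_exterior :: "(real \<Rightarrow> ennreal) \<Rightarrow> 'a::euclidean_space set \<Rightarrow> 'a measure" where
  "weighted_exterior \<nu> D = density (restrict_space lborel (- D)) (dn_weight \<nu> D)"

definition Lp_space :: "real \<Rightarrow> 'b measure \<Rightarrow> ('b \<Rightarrow> real) set" where
  "Lp_space q N = {g \<in> borel_measurable N. integrable N (\<lambda>x. \<bar>g x\<bar> powr q)}"

definition Lp_norm :: "real \<Rightarrow> 'b measure \<Rightarrow> ('b \<Rightarrow> real) \<Rightarrow> real" where
  "Lp_norm q N g = (LINT x|N. \<bar>g x\<bar> powr q) powr (1 / q)"

text \<open>The set of \<open>g\<close> on which \<open>DN g\<close> is defined almost everywhere. The two convergence clauses are
  needed because a divergent Bochner integral is \<open>0\<close> by convention; changing the Poisson integral on a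
  null subset of \<open>D\<close> does not change \<open>DN g\<close>.\<close>

definition DN_domain ::
    "(real \<Rightarrow> ennreal) \<Rightarrow> 'w measure \<Rightarrow> (real \<Rightarrow> 'w \<Rightarrow> 'a::euclidean_space) \<Rightarrow> (real \<Rightarrow> 'a \<Rightarrow> ennreal) \<Rightarrow>
     'a set \<Rightarrow> real \<Rightarrow> ('a \<Rightarrow> real) set" where
  "DN_domain \<nu> M X p D q =
     {g \<in> exterior_space \<nu> M X p D q.
        (AE x in lborel. x \<in> D \<longrightarrow>
           set_integrable lborel (- D) (\<lambda>z. g z * enn2real (poisson_kernel \<nu> M X p D x z))) \<and>
        (AE z in lborel. z \<notin> D \<longrightarrow>
           set_integrable lborel D
             (\<lambda>x. (poisson_ext \<nu> M X p D g z - poisson_ext \<nu> M X p D g x) * enn2real (jump \<nu> x z)))}"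

end

theory Submission
  imports Defs
begin

text \<open>Write \<open>m\<close> for the weight, \<open>G\<close> for the Green function of \<open>D\<close>, \<open>\<gamma>\<close> for the interaction
  kernel and \<open>\<kappa>(y) = \<integral>\<^bsub>D\<^sup>c\<^esub> \<nu>(y,z) dz\<close> for the rate at which the process jumps out of \<open>D\<close> from \<open>y\<close>.
  For \<open>z\<close> outside \<open>D\<close>, \<open>|DN g(z)|\<close> is at most \<open>m(z) |g(z)| + \<integral> |g(w)| \<gamma>(z,w) dw\<close>. If the rows and the
  columns of \<open>\<gamma>\<close> have mass at most \<open>m\<close>, then \<open>\<gamma>(z,w) dw / m(z)\<close> is a subprobability measure,
  Jensen's inequality bounds the \<open>p\<close>-th power of the averaged second term by
  \<open>\<integral> |g(w)|\<^sup>p \<gamma>(z,w) dw / m(z)\<close>, and integration against \<open>m(z) dz\<close> gives at most \<open>\<integral> |g|\<^sup>p m\<close>.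
  This is Schur's test; it is carried out in the locale \<open>exterior_kernel\<close>, with \<open>interaction_row\<close>,
  \<open>interaction_col\<close> and \<open>normalized_flux_bound\<close> as the essential steps.

  The two mass bounds follow from two properties of \<open>G\<close> (theorem \<open>green_function_inputs\<close>):
  \<open>\<integral>\<^bsub>D\<^esub> G(x,y) \<kappa>(y) dy \<le> 1\<close> for every \<open>x \<in> D\<close>, and the dual statement
  \<open>\<integral>\<^bsub>D\<^esub> \<kappa>(x) \<integral>\<^bsub>D\<^esub> G(x,y) f(y) dy dx \<le> \<integral>\<^bsub>D\<^esub> f\<close> for \<open>f \<ge> 0\<close>. The first integral is the expected
  number of jumps from \<open>D\<close> to its complement up to the exit time, which is at most one. Instead of a Levy
  system, the following count is used. A path that is in \<open>D\<close> up to time \<open>t\<close> and outside the closure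
  of \<open>D\<close> at time \<open>t + h\<close> leaves the closure for the first time in \<open>[t, t + h]\<close>, so along one path this
  happens for a set of times \<open>t\<close> of length at most \<open>h\<close> (\<open>last_step_times\<close>). By the Markov property
  the expected length of that set dominates \<open>\<integral>\<^bsub>D\<^esub> G(x,y) \<bbbP>(y + X\<^sub>h \<notin> closure D) dy\<close>; dividing by \<open>h\<close>
  and letting \<open>h\<close> tend to \<open>0\<close> gives the claim by Fatou's lemma, since \<open>\<bbbP>(y + X\<^sub>h \<notin> closure D) / h\<close>
  is asymptotically at least \<open>\<kappa>(y)\<close>. The dual statement is the same count for the reversed process:
  the chain obtained by observing \<open>X\<close> along dyadic fractions of \<open>t\<close> and killing it outside \<open>D\<close> is in duality,
  with respect to Lebesgue measure, with the chain of \<open>-X\<close> (\<open>killed_steps_dual\<close>).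

  Two points need work. The process is given by its characteristic exponent, so the
  small-time asymptotics (\<open>small_time_jump_bound\<close>) are obtained from a continuity theorem for
  characteristic functions in arbitrary dimension (\<open>vague_convergence\<close>), proved by Gaussian smoothing. And
  the exit time of an open set is not obviously measurable for a sigma-algebra that is not complete; it is
  almost surely the limit of the hitting times of shrinking neighbourhoods of the complement
  (\<open>exit_time_eq_exit_limit\<close>), because the process cannot jump at the limit of an increasing
  sequence of such times. With this version of the exit time the strong Markov property identifies the Dirichlet heat
  kernel with the transition density of the killed process, and the Green function has a jointly
  measurable version.\<close>

section \<open>Gaussian smoothing and the continuity theorem\<close>

text \<open>The standard Gaussian measure, as the image of a product of one-dimensional ones, so that its
  characteristic function is a product of known factors.\<close>

definition gauss :: "'a::euclidean_space measure" where
  "gauss = distr (PiM Basis (\<lambda>_. std_normal_distribution)) borel (\<lambda>f. \<Sum>b\<in>Basis. f b *\<^sub>R b)"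

lemma sets_gauss [simp, measurable_cong]: "sets gauss = sets borel"
  and space_gauss [simp]: "space gauss = UNIV"
  by (simp_all add: gauss_def)

lemma measurable_cis [measurable]: "cis \<in> borel_measurable borel"
  unfolding cis_conv_exp by (intro borel_measurable_continuous_onI continuous_intros)

lemma prob_space_gauss: "prob_space (gauss :: 'a::euclidean_space measure)"
proof -
  interpret S: prob_space std_normal_distribution
    by (rule prob_space_normal_density) simp
  interpret P: product_prob_space "\<lambda>_::'a. std_normal_distribution" "Basis :: 'a set"
    by standard
  show ?thesis unfolding gauss_def
    by (rule P.prob_space_distr) measurable
qed

lemma char_gauss:
  fixes z :: "'a::euclidean_space"
  shows "(LINT \<xi>|gauss. cis (\<xi> \<bullet> z)) = complex_of_real (exp (- (norm z)\<^sup>2 / 2))"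
proof -
  interpret S: prob_space std_normal_distribution
    by (rule prob_space_normal_density) simp
  interpret P: product_prob_space "\<lambda>_::'a. std_normal_distribution" "Basis :: 'a set"
    by standard
  have [simp]: "(\<Sum>b\<in>Basis. f b *\<^sub>R b) \<bullet> z = (\<Sum>b\<in>Basis. f b * (z \<bullet> b))" for f :: "'a \<Rightarrow> real"
    by (simp add: inner_sum_left inner_commute[of z])
  have cis_sum: "cis (\<Sum>b\<in>Basis. h b) = (\<Prod>b\<in>Basis. cis (h b))" for h :: "'a \<Rightarrow> real"
    unfolding cis_conv_exp of_real_sum sum_distrib_left by (rule exp_sum) simp
  have "(LINT \<xi>|gauss. cis (\<xi> \<bullet> z)) =
      (LINT f|PiM Basis (\<lambda>_. std_normal_distribution). cis ((\<Sum>b\<in>Basis. f b *\<^sub>R b) \<bullet> z))"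
    unfolding gauss_def by (rule integral_distr) measurable
  also have "\<dots> = (LINT f|PiM Basis (\<lambda>_. std_normal_distribution). (\<Prod>b\<in>Basis. cis (f b * (z \<bullet> b))))"
    by (simp add: cis_sum)
  also have "\<dots> = (\<Prod>b\<in>Basis. LINT x|std_normal_distribution. cis (x * (z \<bullet> b)))"
    by (rule P.product_integral_prod) (auto intro!: S.integrable_const_bound[where B=1])
  also have "\<dots> = (\<Prod>b\<in>Basis. complex_of_real (exp (- (z \<bullet> b)\<^sup>2 / 2)))"
    using char_std_normal_distribution
    by (intro prod.cong refl) (auto simp: char_def cis_conv_exp fun_eq_iff mult_ac)
  also have "\<dots> = complex_of_real (exp (\<Sum>b\<in>Basis. - (z \<bullet> b)\<^sup>2 / 2))"
    by (simp add: exp_sum)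
  also have "(\<Sum>b\<in>Basis. - (z \<bullet> b)\<^sup>2 / 2) = - (norm z)\<^sup>2 / 2"
    unfolding power2_norm_eq_inner euclidean_inner[of z z]
    by (simp add: sum_negf sum_divide_distrib power2_eq_square)
  finally show ?thesis .
qed

lemma char_gauss_re:
  fixes z :: "'a::euclidean_space"
  shows "(LINT \<xi>|gauss. cos (\<xi> \<bullet> z)) = exp (- (norm z)\<^sup>2 / 2)"
proof -
  interpret G: prob_space "gauss :: 'a measure" by (rule prob_space_gauss)
  have "integrable gauss (\<lambda>\<xi>::'a. cis (\<xi> \<bullet> z))"
    by (rule G.integrable_const_bound[where B=1]) auto
  from integral_Re[OF this] show ?thesis by (simp add: char_gauss)
qed

lemma exp_norm_integrable:
  "integrable lborel (\<lambda>v::'a::euclidean_space. exp (- (norm v)\<^sup>2 / 2))"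
  and exp_norm_integral_pos: "0 < (LINT v|lborel. exp (- (norm (v::'a))\<^sup>2 / 2))"
proof -
  let ?g = "\<lambda>x::real. ennreal (exp (- x\<^sup>2 / 2))"
  have *: "exp (- (norm v)\<^sup>2 / 2) = (\<Prod>b\<in>Basis. exp (- (v \<bullet> b)\<^sup>2 / 2))" for v :: 'a
    unfolding power2_norm_eq_inner euclidean_inner[of v v]
    by (simp add: exp_sum[symmetric] sum_negf sum_divide_distrib power2_eq_square)
  have 1: "(\<integral>\<^sup>+x. ?g x \<partial>lborel) < \<infinity>"
  proof -
    interpret S: prob_space std_normal_distribution
      by (rule prob_space_normal_density) simp
    have "integrable lborel (std_normal_density)" by (rule integrable_normal_density) simp
    then have "integrable lborel (\<lambda>x. sqrt (2 * pi) * std_normal_density x)" by (rule integrable_mult_right)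
    also have "(\<lambda>x. sqrt (2 * pi) * std_normal_density x) = (\<lambda>x. exp (- x\<^sup>2 / 2))"
      by (auto simp: std_normal_density_def fun_eq_iff)
    finally show ?thesis by (simp add: integrable_iff_bounded)
  qed
  have "(\<integral>\<^sup>+v. ennreal (exp (- (norm (v::'a))\<^sup>2 / 2)) \<partial>lborel) = (\<integral>\<^sup>+v. (\<Prod>b\<in>Basis. ?g (v \<bullet> b)) \<partial>(lborel::'a measure))"
    by (simp only: * prod_ennreal[symmetric] exp_ge_zero)
  also have "\<dots> = (\<Prod>b\<in>(Basis::'a set). (\<integral>\<^sup>+x. ?g x \<partial>lborel))"
    by (rule nn_integral_lborel_prod) auto
  also have "\<dots> < \<infinity>" using 1 by (simp add: power_less_top_ennreal)
  finally have "(\<integral>\<^sup>+v. ennreal (exp (- (norm (v::'a))\<^sup>2 / 2)) \<partial>lborel) < \<infinity>" .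
  then show i: "integrable lborel (\<lambda>v::'a. exp (- (norm v)\<^sup>2 / 2))"
    by (simp add: integrable_iff_bounded)
  show "0 < (LINT v|lborel. exp (- (norm (v::'a))\<^sup>2 / 2))"
  proof (rule ccontr)
    assume "\<not> ?thesis"
    then have "(LINT v|lborel. exp (- (norm (v::'a))\<^sup>2 / 2)) = 0"
      using Bochner_Integration.integral_nonneg[of lborel "\<lambda>v::'a. exp (- (norm v)\<^sup>2 / 2)"]
      by (smt (verit) exp_ge_zero)
    then have "AE v in (lborel :: 'a measure). False"
      using integral_nonneg_eq_0_iff_AE[OF i] by simp
    then have "UNIV \<in> null_sets (lborel :: 'a measure)"
      by (subst (asm) AE_iff_null) auto
    then show False by (simp add: null_sets_def)
  qed
qed

text \<open>Since the Gaussian kernel is itself a characteristic function, its integral against \<open>\<mu>\<close> is by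
  Fubini a Gaussian average of the characteristic function of \<open>\<mu>\<close>.\<close>

lemma gauss_kernel_fourier:
  fixes \<mu> :: "'a::euclidean_space measure"
  assumes "finite_measure \<mu>" and [measurable_cong]: "sets \<mu> = sets borel"
  shows "(LINT z|\<mu>. exp (- (norm (c *\<^sub>R (z - a)))\<^sup>2 / 2))
    = (LINT \<xi>|gauss. Re (cis (- ((c *\<^sub>R \<xi>) \<bullet> a)) * (LINT z|\<mu>. cis ((c *\<^sub>R \<xi>) \<bullet> z))))"
proof -
  interpret \<mu>: finite_measure \<mu> by fact
  interpret G: prob_space "gauss :: 'a measure" by (rule prob_space_gauss)
  interpret P: pair_sigma_finite "gauss :: 'a measure" \<mu> ..
  interpret F: finite_measure "(gauss :: 'a measure) \<Otimes>\<^sub>M \<mu>"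
    by (rule finite_measure_pair_measure[OF \<mu>.finite_measure_axioms G.finite_measure_axioms])
  have i1: "integrable \<mu> (\<lambda>z. cis ((c *\<^sub>R \<xi>) \<bullet> z))" for \<xi>
    by (rule \<mu>.integrable_const_bound[where B=1]) auto
  have i2: "integrable \<mu> (\<lambda>z. cis (- ((c *\<^sub>R \<xi>) \<bullet> a)) * cis ((c *\<^sub>R \<xi>) \<bullet> z))" for \<xi>
    using i1 by simp
  have "(LINT z|\<mu>. exp (- (norm (c *\<^sub>R (z - a)))\<^sup>2 / 2)) = (LINT z|\<mu>. (LINT \<xi>|gauss. cos (\<xi> \<bullet> (c *\<^sub>R (z - a)))))"
    by (simp only: char_gauss_re)
  also have "\<dots> = (LINT \<xi>|gauss. (LINT z|\<mu>. cos (\<xi> \<bullet> (c *\<^sub>R (z - a)))))"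
    by (rule P.Fubini_integral) (auto intro!: F.integrable_const_bound[where B=1])
  also have "\<dots> = (LINT \<xi>|gauss. Re (cis (- ((c *\<^sub>R \<xi>) \<bullet> a)) * (LINT z|\<mu>. cis ((c *\<^sub>R \<xi>) \<bullet> z))))"
  proof (rule Bochner_Integration.integral_cong[OF refl])
    fix \<xi> :: 'a
    have "cis (- ((c *\<^sub>R \<xi>) \<bullet> a)) * (LINT z|\<mu>. cis ((c *\<^sub>R \<xi>) \<bullet> z))
      = (LINT z|\<mu>. cis (- ((c *\<^sub>R \<xi>) \<bullet> a)) * cis ((c *\<^sub>R \<xi>) \<bullet> z))"
      by simp
    also have "Re \<dots> = (LINT z|\<mu>. Re (cis (- ((c *\<^sub>R \<xi>) \<bullet> a)) * cis ((c *\<^sub>R \<xi>) \<bullet> z)))"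
      by (rule integral_Re[symmetric]) (rule i2)
    also have "\<dots> = (LINT z|\<mu>. cos (\<xi> \<bullet> (c *\<^sub>R (z - a))))"
      by (simp add: cis_mult inner_diff_right algebra_simps)
    finally show "(LINT z|\<mu>. cos (\<xi> \<bullet> (c *\<^sub>R (z - a))))
      = Re (cis (- ((c *\<^sub>R \<xi>) \<bullet> a)) * (LINT z|\<mu>. cis ((c *\<^sub>R \<xi>) \<bullet> z)))" by simp
  qed
  finally show ?thesis .
qed

text \<open>The characteristic functions are bounded by \<open>C\<close> uniformly, so that dominated convergence applies to
  their Gaussian averages; no tightness is involved.\<close>

lemma gauss_kernel_tendsto:
  fixes \<mu> :: "nat \<Rightarrow> 'a::euclidean_space measure"
  assumes fin: "\<And>n. finite_measure (\<mu> n)" and sets[measurable_cong]: "\<And>n. sets (\<mu> n) = sets borel"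
    and bd: "\<And>n. measure (\<mu> n) UNIV \<le> C"
    and fin0: "finite_measure \<mu>0" and sets0[measurable_cong]: "sets \<mu>0 = sets borel"
    and char: "\<And>\<xi>. (\<lambda>n. LINT z|\<mu> n. cis (\<xi> \<bullet> z)) \<longlonglongrightarrow> (LINT z|\<mu>0. cis (\<xi> \<bullet> z))"
  shows "(\<lambda>n. LINT z|\<mu> n. exp (- (norm (c *\<^sub>R (z - a)))\<^sup>2 / 2)) \<longlonglongrightarrow>
      (LINT z|\<mu>0. exp (- (norm (c *\<^sub>R (z - a)))\<^sup>2 / 2))"
proof -
  interpret G: prob_space "gauss :: 'a measure" by (rule prob_space_gauss)
  interpret F: finite_measure "\<mu> n" for n by (rule fin)
  interpret F0: finite_measure \<mu>0 by fact
  have sp: "space (\<mu> n) = UNIV" for n using sets_eq_imp_space_eq[OF sets] by simp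
  show ?thesis
    unfolding gauss_kernel_fourier[OF fin sets] gauss_kernel_fourier[OF fin0 sets0]
  proof (rule integral_dominated_convergence[where w="\<lambda>_. C"])
    show "AE \<xi> in gauss. norm (Re (cis (- ((c *\<^sub>R \<xi>) \<bullet> a)) * (LINT z|\<mu> n. cis ((c *\<^sub>R \<xi>) \<bullet> z)))) \<le> C" for n
    proof (rule AE_I2)
      fix \<xi> :: 'a
      have "norm (Re (cis (- ((c *\<^sub>R \<xi>) \<bullet> a)) * (LINT z|\<mu> n. cis ((c *\<^sub>R \<xi>) \<bullet> z))))
        \<le> norm (LINT z|\<mu> n. cis ((c *\<^sub>R \<xi>) \<bullet> z))"
        by (rule order_trans[OF abs_Re_le_cmod[folded real_norm_def]]) (simp add: norm_mult)
      also have "\<dots> \<le> (LINT z|\<mu> n. norm (cis ((c *\<^sub>R \<xi>) \<bullet> z)))" by (rule integral_norm_bound)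
      also have "\<dots> \<le> C" using bd[of n] sp[of n] by simp
      finally show "norm (Re (cis (- ((c *\<^sub>R \<xi>) \<bullet> a)) * (LINT z|\<mu> n. cis ((c *\<^sub>R \<xi>) \<bullet> z)))) \<le> C" .
    qed
    show "AE \<xi> in gauss. (\<lambda>n. Re (cis (- ((c *\<^sub>R \<xi>) \<bullet> a)) * (LINT z|\<mu> n. cis ((c *\<^sub>R \<xi>) \<bullet> z))))
      \<longlonglongrightarrow> Re (cis (- ((c *\<^sub>R \<xi>) \<bullet> a)) * (LINT z|\<mu>0. cis ((c *\<^sub>R \<xi>) \<bullet> z)))"
      by (intro AE_I2 tendsto_intros char)
  qed auto
qed

text \<open>The smoothing of \<open>f\<close> at scale \<open>1/c\<close> has two descriptions: averaging the translates of \<open>f\<close>, which is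
  close to \<open>f\<close> uniformly, and superposing Gaussian kernels with density \<open>f\<close>, which is accessible to
  characteristic functions.\<close>

lemma gauss_smooth_fubini:
  fixes f :: "'a::euclidean_space \<Rightarrow> real"
  assumes "finite_measure \<mu>" and [measurable_cong]: "sets \<mu> = sets borel"
    and f: "integrable lborel f" and c: "c > 0"
  shows "(LINT z|\<mu>. (LINT v|lborel. f (z + v /\<^sub>R c) * exp (- (norm v)\<^sup>2 / 2)))
    = c ^ DIM('a) * (LINT a|lborel. f a * (LINT z|\<mu>. exp (- (norm (c *\<^sub>R (z - a)))\<^sup>2 / 2)))"
proof -
  interpret \<mu>: finite_measure \<mu> by fact
  interpret P: pair_sigma_finite "lborel :: 'a measure" \<mu> ..
  have [measurable]: "f \<in> borel_measurable borel" using f by auto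
  have "(LINT v|lborel. f (z + v /\<^sub>R c) * exp (- (norm v)\<^sup>2 / 2))
    = c ^ DIM('a) * (LINT a|lborel. f a * exp (- (norm (c *\<^sub>R (z - a)))\<^sup>2 / 2))" for z
  proof -
    have "(LINT a|lborel. f a * exp (- (norm (c *\<^sub>R (z - a)))\<^sup>2 / 2))
      = (LINT a|density (distr lborel borel (\<lambda>x. z + inverse c *\<^sub>R x)) (\<lambda>_. ennreal (inverse c^DIM('a))). f a * exp (- (norm (c *\<^sub>R (z - a)))\<^sup>2 / 2))"
      using c by (subst lborel_affine[of "inverse c" z]) (auto simp: ennreal_power)
    also have "\<dots> = inverse c ^ DIM('a) * (LINT v|lborel. f (z + v /\<^sub>R c) * exp (- (norm v)\<^sup>2 / 2))"
      using c by (subst integral_density) (simp_all add: integral_distr mult.assoc[symmetric], simp add: mult.assoc)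
    finally show ?thesis using c by (simp add: power_inverse)
  qed
  then have "(LINT z|\<mu>. (LINT v|lborel. f (z + v /\<^sub>R c) * exp (- (norm v)\<^sup>2 / 2)))
    = c ^ DIM('a) * (LINT z|\<mu>. (LINT a|lborel. f a * exp (- (norm (c *\<^sub>R (z - a)))\<^sup>2 / 2)))"
    by simp
  also have "(LINT z|\<mu>. (LINT a|lborel. f a * exp (- (norm (c *\<^sub>R (z - a)))\<^sup>2 / 2)))
    = (LINT a|lborel. (LINT z|\<mu>. f a * exp (- (norm (c *\<^sub>R (z - a)))\<^sup>2 / 2)))"
  proof (rule P.Fubini_integral)
    have "integrable (lborel \<Otimes>\<^sub>M \<mu>) (\<lambda>x. f (fst x))"
      by (rule P.Fubini_integrable) (use f in \<open>auto simp: integrable_norm\<close>)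
    then show "integrable (lborel \<Otimes>\<^sub>M \<mu>) (\<lambda>(a, z). f a * exp (- (norm (c *\<^sub>R (z - a)))\<^sup>2 / 2))"
      by (rule Bochner_Integration.integrable_bound) (auto simp: abs_mult mult_left_le)
  qed
  finally show ?thesis by simp
qed

text \<open>Uniform continuity controls the translates by less than \<open>d\<close>; the larger ones carry the tail of the
  Gaussian integral, which is small once \<open>c\<close> is large.\<close>

lemma gauss_smooth_uniform:
  fixes f :: "'a::euclidean_space \<Rightarrow> real"
  assumes f: "continuous_on UNIV f" "compact K" "\<And>x. x \<notin> K \<Longrightarrow> f x = 0" and \<eta>: "\<eta> > 0"
  defines "I \<equiv> (LINT v|lborel. exp (- (norm (v::'a))\<^sup>2 / 2))"
  shows "\<exists>c>0. \<forall>z. \<bar>(LINT v|lborel. f (z + v /\<^sub>R c) * exp (- (norm v)\<^sup>2 / 2)) / I - f z\<bar> \<le> \<eta>"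
proof -
  let ?e = "\<lambda>v::'a. exp (- (norm v)\<^sup>2 / 2)"
  have I: "I > 0" unfolding I_def by (rule exp_norm_integral_pos)
  have [measurable]: "f \<in> borel_measurable borel" using f(1) by (rule borel_measurable_continuous_onI)
  obtain R where R: "K \<subseteq> cball 0 R" using bounded_subset_ballD[OF compact_imp_bounded[OF f(2)], of 0] ball_subset_cball by blast
  have "bounded (f ` K)"
    by (intro compact_imp_bounded compact_continuous_image f continuous_on_subset[OF f(1)]) auto
  then obtain B0 where B0: "\<And>x. x \<in> K \<Longrightarrow> \<bar>f x\<bar> \<le> B0" by (auto simp: bounded_iff)
  define B where "B = max B0 1"
  have B: "\<bar>f x\<bar> \<le> B" for x using B0[of x] f(3)[of x] by (cases "x \<in> K") (auto simp: B_def)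
  have B1: "B \<ge> 1" by (simp add: B_def)
  have "uniformly_continuous_on (cball 0 (R+1)) f"
    by (rule compact_uniformly_continuous) (auto intro: continuous_on_subset[OF f(1)])
  then obtain d0 where d0: "d0 > 0" "\<And>x y. x \<in> cball 0 (R+1) \<Longrightarrow> y \<in> cball 0 (R+1) \<Longrightarrow> dist y x < d0 \<Longrightarrow> dist (f y) (f x) < \<eta>/2"
    unfolding uniformly_continuous_on_def using \<eta> by (metis half_gt_zero)
  define d where "d = min d0 1"
  have d: "d > 0" using d0 by (simp add: d_def)
  have out: "f x = 0" if "norm x > R" for x
  proof (rule f(3))
    show "x \<notin> K" using that R by (auto simp: subset_iff)
  qed
  have uc: "\<bar>f y - f x\<bar> \<le> \<eta>/2" if "norm (y - x) < d" for x y
  proof (cases "norm x \<le> R + 1 \<and> norm y \<le> R + 1")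
    case True
    then show ?thesis using d0(2)[of x y] that by (simp add: dist_norm d_def)
  next
    case False
    have "norm x \<le> norm y + norm (y - x)" "norm y \<le> norm x + norm (y - x)"
      by norm+
    then have "norm x > R \<and> norm y > R" using False that by (auto simp: d_def)
    then show ?thesis using out \<eta> by simp
  qed
  have i: "integrable lborel ?e" by (rule exp_norm_integrable)
  let ?t = "\<lambda>n v. indicator {v::'a. norm v \<ge> d * real n} v * ?e v"
  have "(\<lambda>n. LINT v|lborel. ?t n v) \<longlonglongrightarrow> (LINT v|(lborel::'a measure). 0)"
  proof (rule integral_dominated_convergence[where w="?e"])
    show "AE x in lborel. (\<lambda>n. ?t n x) \<longlonglongrightarrow> 0"
    proof (rule AE_I2)
      fix x :: 'a
      obtain N :: nat where N: "norm x / d < real N" using reals_Archimedean2 by blast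
      have "eventually (\<lambda>n. ?t n x = 0) sequentially"
        using eventually_ge_at_top[of N]
      proof eventually_elim
        case (elim n)
        then have "norm x / d < real n" using N by linarith
        then have "norm x < d * n" using d by (simp add: field_simps)
        then show ?case by simp
      qed
      then show "(\<lambda>n. ?t n x) \<longlonglongrightarrow> 0" by (rule tendsto_eventually)
    qed
  qed (use i in \<open>auto simp: indicator_def\<close>)
  then have "(\<lambda>n. LINT v|lborel. ?t n v) \<longlonglongrightarrow> 0" by simp
  then have "eventually (\<lambda>n. (LINT v|lborel. ?t n v) < \<eta> * I / (4 * B)) sequentially"
    by (rule order_tendstoD) (use \<eta> I B1 in simp)
  moreover have "eventually (\<lambda>n. n \<ge> 1) sequentially" by (rule eventually_ge_at_top)
  ultimately obtain n where n: "(LINT v|lborel. ?t n v) < \<eta> * I / (4 * B)" "n \<ge> (1::nat)"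
    using eventually_happens[OF eventually_conj] by fastforce
  define c where "c = real n"
  have c: "c > 0" using n by (simp add: c_def)
  have ti: "integrable lborel (?t n)"
    by (rule Bochner_Integration.integrable_bound[OF i]) (auto simp: indicator_def)
  have "\<bar>(LINT v|lborel. f (z + v /\<^sub>R c) * ?e v) / I - f z\<bar> \<le> \<eta>" for z
  proof -
    have i1: "integrable lborel (\<lambda>v. f (z + v /\<^sub>R c) * ?e v)"
      by (rule Bochner_Integration.integrable_bound[OF integrable_mult_right[OF i, of B]])
        (auto simp: abs_mult intro!: AE_I2 mult_right_mono order_trans[OF B])
    have i2: "integrable lborel (\<lambda>v. f z * ?e v)" using i by simp
    have "\<bar>(LINT v|lborel. f (z + v /\<^sub>R c) * ?e v) - f z * I\<bar> = \<bar>LINT v|lborel. f (z + v /\<^sub>R c) * ?e v - f z * ?e v\<bar>"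
      using i1 i2 by (simp add: I_def)
    also have "\<dots> \<le> (LINT v|lborel. \<eta>/2 * ?e v + 2 * B * ?t n v)"
    proof (rule order_trans[OF integral_abs_bound], rule integral_mono)
      show "integrable lborel (\<lambda>v. \<bar>f (z + v /\<^sub>R c) * ?e v - f z * ?e v\<bar>)" using i1 i2 by simp
      show "integrable lborel (\<lambda>v. \<eta>/2 * ?e v + 2 * B * ?t n v)" using i ti by simp
      fix v :: 'a
      have "\<bar>f (z + v /\<^sub>R c) - f z\<bar> \<le> \<eta>/2 + 2 * B * indicator {v::'a. norm v \<ge> d * real n} v"
      proof (cases "norm v \<ge> d * real n")
        case True
        then show ?thesis using B[of z] B[of "z + v /\<^sub>R c"] \<eta> by simp
      next
        case False
        then have "norm ((z + v /\<^sub>R c) - z) < d" using c by (simp add: c_def field_simps)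
        then show ?thesis using uc[of "z + v /\<^sub>R c" z] False by simp
      qed
      then have "\<bar>f (z + v /\<^sub>R c) - f z\<bar> * ?e v \<le> (\<eta>/2 + 2 * B * indicator {v::'a. norm v \<ge> d * real n} v) * ?e v"
        by (rule mult_right_mono) simp
      then show "\<bar>f (z + v /\<^sub>R c) * ?e v - f z * ?e v\<bar> \<le> \<eta>/2 * ?e v + 2 * B * ?t n v"
        by (simp add: abs_mult left_diff_distrib[symmetric] distrib_right mult.assoc)
    qed
    also have "\<dots> = (LINT v|lborel. \<eta>/2 * ?e v) + (LINT v|lborel. 2 * B * ?t n v)"
      by (rule Bochner_Integration.integral_add) (rule integrable_mult_right, (rule i ti))+
    also have "\<dots> = \<eta>/2 * I + 2 * B * (LINT v|lborel. ?t n v)"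
      by (simp only: I_def integral_mult_right_zero)
    also have "\<dots> \<le> \<eta>/2 * I + 2 * B * (\<eta> * I / (4 * B))"
      using n B1 by (intro add_left_mono mult_left_mono) auto
    also have "\<dots> = \<eta> * I" using B1 by simp
    finally have "\<bar>(LINT v|lborel. f (z + v /\<^sub>R c) * ?e v) - f z * I\<bar> \<le> \<eta> * I" .
    moreover have "(LINT v|lborel. f (z + v /\<^sub>R c) * ?e v) / I - f z = ((LINT v|lborel. f (z + v /\<^sub>R c) * ?e v) - f z * I) / I"
      using I by (simp add: diff_divide_distrib)
    ultimately show ?thesis using I by (simp only: abs_divide) (simp add: pos_divide_le_eq)
  qed
  then show ?thesis using c by blast
qed

text \<open>Smooth \<open>f\<close> with a Gaussian. The error is uniformly small, hence harmless for measures of bounded mass,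
  and the integrals of the smoothed function are integrals of Gaussian kernels, which converge by
  \<open>gauss_kernel_tendsto\<close>.\<close>

lemma vague_convergence:
  fixes \<mu> :: "nat \<Rightarrow> 'a::euclidean_space measure" and f :: "'a \<Rightarrow> real"
  assumes fin: "\<And>n. finite_measure (\<mu> n)" and sets[measurable_cong]: "\<And>n. sets (\<mu> n) = sets borel"
    and bd: "\<And>n. measure (\<mu> n) UNIV \<le> C"
    and fin0: "finite_measure \<mu>0" and sets0[measurable_cong]: "sets \<mu>0 = sets borel"
    and char: "\<And>\<xi>. (\<lambda>n. LINT z|\<mu> n. cis (\<xi> \<bullet> z)) \<longlonglongrightarrow> (LINT z|\<mu>0. cis (\<xi> \<bullet> z))"
    and f: "continuous_on UNIV f" "compact K" "\<And>x. x \<notin> K \<Longrightarrow> f x = 0"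
  shows "(\<lambda>n. LINT z|\<mu> n. f z) \<longlonglongrightarrow> (LINT z|\<mu>0. f z)"
proof (rule LIMSEQ_I)
  fix r :: real assume r: "r > 0"
  interpret F: finite_measure "\<mu> n" for n by (rule fin)
  interpret F0: finite_measure \<mu>0 by fact
  have sp: "space (\<mu> n) = UNIV" for n using sets_eq_imp_space_eq[OF sets] by simp
  have sp0: "space \<mu>0 = UNIV" using sets_eq_imp_space_eq[OF sets0] by simp
  define C' where "C' = max 1 (max C (measure \<mu>0 UNIV))"
  define \<eta> where "\<eta> = r / (4 * C')"
  have C': "C' \<ge> 1" "C \<le> C'" "measure \<mu>0 UNIV \<le> C'" by (auto simp: C'_def)
  have \<eta>: "\<eta> > 0" using r C' by (simp add: \<eta>_def)
  define I where "I = (LINT v|lborel. exp (- (norm (v::'a))\<^sup>2 / 2))"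
  obtain c where c: "c > 0" and
    uni: "\<And>z. \<bar>(LINT v|lborel. f (z + v /\<^sub>R c) * exp (- (norm v)\<^sup>2 / 2)) / I - f z\<bar> \<le> \<eta>"
    using gauss_smooth_uniform[OF f \<eta>] unfolding I_def by blast
  define g where "g z = (LINT v|lborel. f (z + v /\<^sub>R c) * exp (- (norm v)\<^sup>2 / 2)) / I" for z
  have [measurable]: "f \<in> borel_measurable borel" using f(1) by (rule borel_measurable_continuous_onI)
  have [measurable]: "g \<in> borel_measurable borel" unfolding g_def by measurable
  have "bounded (f ` K)"
    by (intro compact_imp_bounded compact_continuous_image f continuous_on_subset[OF f(1)]) auto
  then obtain B0 where B0: "\<And>x. x \<in> K \<Longrightarrow> \<bar>f x\<bar> \<le> B0" by (auto simp: bounded_iff)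
  define B where "B = max B0 1"
  have B: "\<bar>f x\<bar> \<le> B" for x using B0[of x] f(3)[of x] by (cases "x \<in> K") (auto simp: B_def)
  have gB: "\<bar>g x\<bar> \<le> B + \<eta>" for x using B[of x] uni[of x] unfolding g_def by linarith
  have close: "\<bar>(LINT z|m. f z) - (LINT z|m. g z)\<bar> \<le> \<eta> * C'"
    if m: "finite_measure m" "sets m = sets borel" "measure m UNIV \<le> C'" for m :: "'a measure"
  proof -
    interpret m: finite_measure m by fact
    note [measurable_cong] = m(2)
    have [simp]: "space m = UNIV" using sets_eq_imp_space_eq[OF m(2)] by simp
    have i: "integrable m f" "integrable m g"
      using B gB by (intro m.integrable_const_bound[where B=B] m.integrable_const_bound[where B="B + \<eta>"]; simp)+
    have "\<bar>(LINT z|m. f z) - (LINT z|m. g z)\<bar> = \<bar>LINT z|m. f z - g z\<bar>" using i by simp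
    also have "\<dots> \<le> (LINT z|m. \<eta>)"
    proof (rule order_trans[OF integral_abs_bound], rule integral_mono)
      show "integrable m (\<lambda>z. \<bar>f z - g z\<bar>)" using i by simp
      show "\<bar>f z - g z\<bar> \<le> \<eta>" for z using uni[of z] by (simp add: g_def abs_minus_commute)
    qed simp
    also have "\<dots> \<le> \<eta> * C'" using m(3) \<eta> by simp
    finally show ?thesis .
  qed
  have fi: "integrable lborel f"
  proof -
    have "set_integrable lborel K f"
      unfolding set_integrable_def by (rule borel_integrable_compact[OF f(2)]) (rule continuous_on_subset[OF f(1)], simp)
    moreover have "(\<lambda>x. indicator K x *\<^sub>R f x) = f" using f(3) by (auto simp: fun_eq_iff indicator_def)
    ultimately show ?thesis by (simp add: set_integrable_def)
  qed
  have gL: "(LINT z|m. g z) = c ^ DIM('a) * (LINT a|lborel. f a * (LINT z|m. exp (- (norm (c *\<^sub>R (z - a)))\<^sup>2 / 2))) / I"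
    if m: "finite_measure m" "sets m = sets borel" for m :: "'a measure"
    unfolding g_def using gauss_smooth_fubini[OF m fi c] by simp
  have "(\<lambda>n. LINT a|lborel. f a * (LINT z|\<mu> n. exp (- (norm (c *\<^sub>R (z - a)))\<^sup>2 / 2)))
     \<longlonglongrightarrow> (LINT a|lborel. f a * (LINT z|\<mu>0. exp (- (norm (c *\<^sub>R (z - a)))\<^sup>2 / 2)))"
  proof (rule integral_dominated_convergence[where w="\<lambda>a. \<bar>f a\<bar> * C"])
    show "integrable lborel (\<lambda>a. \<bar>f a\<bar> * C)" using fi by simp
    show "AE a in lborel. (\<lambda>n. f a * (LINT z|\<mu> n. exp (- (norm (c *\<^sub>R (z - a)))\<^sup>2 / 2)))
     \<longlonglongrightarrow> f a * (LINT z|\<mu>0. exp (- (norm (c *\<^sub>R (z - a)))\<^sup>2 / 2))"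
      by (intro AE_I2 tendsto_mult tendsto_const gauss_kernel_tendsto[where C=C] fin sets bd fin0 sets0 char)
    fix n
    have "\<bar>LINT z|\<mu> n. exp (- (norm (c *\<^sub>R (z - a)))\<^sup>2 / 2)\<bar> \<le> C" for a
    proof -
      have "\<bar>LINT z|\<mu> n. exp (- (norm (c *\<^sub>R (z - a)))\<^sup>2 / 2)\<bar> \<le> (LINT z|\<mu> n. 1)"
        by (rule order_trans[OF integral_abs_bound], rule integral_mono)
          (auto intro!: F.integrable_const_bound[where B=1])
      then show ?thesis using bd[of n] sp[of n] by simp
    qed
    then show "AE a in lborel. norm (f a * (LINT z|\<mu> n. exp (- (norm (c *\<^sub>R (z - a)))\<^sup>2 / 2))) \<le> \<bar>f a\<bar> * C"
      by (intro AE_I2) (simp add: abs_mult mult_left_mono)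
    show "(\<lambda>a. f a * (LINT z|\<mu> n. exp (- (norm (c *\<^sub>R (z - a)))\<^sup>2 / 2))) \<in> borel_measurable lborel"
      by measurable
  next
    show "(\<lambda>a. f a * (LINT z|\<mu>0. exp (- (norm (c *\<^sub>R (z - a)))\<^sup>2 / 2))) \<in> borel_measurable lborel"
      by measurable
  qed
  then have "(\<lambda>n. LINT z|\<mu> n. g z) \<longlonglongrightarrow> (LINT z|\<mu>0. g z)"
    unfolding gL[OF fin sets] gL[OF fin0 sets0] divide_inverse by (intro tendsto_intros)
  then obtain N where N: "\<And>n. n \<ge> N \<Longrightarrow> \<bar>(LINT z|\<mu> n. g z) - (LINT z|\<mu>0. g z)\<bar> < r / 2"
    using r by (metis LIMSEQ_D half_gt_zero real_norm_def)
  have \<eta>C: "\<eta> * C' = r / 4" using C' by (simp add: \<eta>_def)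
  show "\<exists>N. \<forall>n\<ge>N. norm ((LINT z|\<mu> n. f z) - (LINT z|\<mu>0. f z)) < r"
  proof (intro exI allI impI)
    fix n assume "n \<ge> N"
    have "\<bar>(LINT z|\<mu> n. f z) - (LINT z|\<mu> n. g z)\<bar> \<le> r/4" "\<bar>(LINT z|\<mu>0. f z) - (LINT z|\<mu>0. g z)\<bar> \<le> r/4"
      using close[OF fin sets, of n] bd[of n] C' close[OF fin0 sets0] by (auto simp: \<eta>C)
    then show "norm ((LINT z|\<mu> n. f z) - (LINT z|\<mu>0. f z)) < r" using N[OF \<open>n \<ge> N\<close>] r by (simp add: abs_if split: if_splits)
  qed
qed

section \<open>Small-time behaviour and the jump intensity\<close>

text \<open>Makes the characteristic exponent finite and the integrals in it absolutely convergent.\<close>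

lemma one_minus_cos_bound: "1 - cos (\<xi> \<bullet> z) \<le> (2 + (norm \<xi>)\<^sup>2) * min ((norm (z::'a::real_inner))\<^sup>2) 1"
proof -
  have "1 - cos (\<xi> \<bullet> z) \<le> (\<xi> \<bullet> z)\<^sup>2 / 2"
  proof -
    have "1 - cos t \<le> t\<^sup>2 / 2" for t :: real
    proof -
      have "1 - cos t = 2 * (sin (t/2))\<^sup>2" using cos_double_sin[of "t/2"] by simp
      also have "(sin (t/2))\<^sup>2 \<le> (t/2)\<^sup>2"
        using abs_sin_x_le_abs_x[of "t/2"] by (metis abs_le_square_iff)
      finally show ?thesis by (simp add: power_divide)
    qed
    then show ?thesis .
  qed
  also have "(\<xi> \<bullet> z)\<^sup>2 \<le> (norm \<xi> * norm z)\<^sup>2"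
    using Cauchy_Schwarz_ineq2[of \<xi> z] by (metis abs_le_square_iff abs_mult abs_norm_cancel)
  finally have 1: "1 - cos (\<xi> \<bullet> z) \<le> (norm \<xi>)\<^sup>2 * (norm z)\<^sup>2"
    using zero_le_power2[of "norm \<xi> * norm z"] unfolding power_mult_distrib by linarith
  have 2: "1 - cos (\<xi> \<bullet> z) \<le> 2 + (norm \<xi>)\<^sup>2"
    using cos_ge_minus_one[of "\<xi> \<bullet> z"] zero_le_power2[of "norm \<xi>"] by linarith
  show ?thesis
  proof (cases "(norm z)\<^sup>2 \<le> 1")
    case True
    have "(norm \<xi>)\<^sup>2 * (norm z)\<^sup>2 \<le> (2 + (norm \<xi>)\<^sup>2) * (norm z)\<^sup>2"
      by (rule mult_right_mono) auto
    then show ?thesis using 1 True by (auto simp only: min_def if_True)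
  next
    case False
    then show ?thesis using 2 by (simp only: min_def if_False mult_1_right)
  qed
qed

lemma integral_odd_lborel:
  fixes f :: "'a::euclidean_space \<Rightarrow> real"
  assumes "integrable lborel f" "\<And>z. f (- z) = - f z"
  shows "(LINT z|lborel. f z) = 0"
proof -
  have [measurable]: "f \<in> borel_measurable borel" using assms(1) by auto
  have 1: "(lborel::'a measure) = density (distr lborel borel (\<lambda>x. 0 + (-1) *\<^sub>R x)) (\<lambda>_. ennreal (\<bar>-1\<bar>^DIM('a)))"
    by (subst lborel_affine[of "-1" 0]) auto
  have "(LINT z|lborel. f z) = (LINT z|lborel. f (- z))"
    by (subst 1) (simp add: density_1 integral_distr)
  then show ?thesis using assms by simp
qed

lemma one_minus_exp_quotient_tendsto:
  fixes h :: "nat \<Rightarrow> real"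
  assumes "\<And>k. h k > 0" "h \<longlonglongrightarrow> 0"
  shows "(\<lambda>k. (1 - exp (- h k * a)) / h k) \<longlonglongrightarrow> a"
proof -
  have "((\<lambda>x. exp (- x * a)) has_real_derivative - a) (at 0)"
    by (auto intro!: derivative_eq_intros)
  then have "((\<lambda>x. (exp (- x * a) - 1) / x) \<longlongrightarrow> - a) (at 0)"
    by (simp add: has_field_derivative_iff)
  moreover have "filterlim h (at 0) sequentially"
    using assms by (auto simp: filterlim_at intro!: always_eventually) (metis less_irrefl)
  ultimately have "(\<lambda>k. (exp (- h k * a) - 1) / h k) \<longlonglongrightarrow> - a"
    by (rule filterlim_compose)
  then have "(\<lambda>k. - ((exp (- h k * a) - 1) / h k)) \<longlonglongrightarrow> - (- a)" by (rule tendsto_minus)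
  then show ?thesis by (simp add: minus_divide_left)
qed

text \<open>Weighting a measure by \<open>1 - cos (u \<bullet> z)\<close> takes a second difference of its characteristic
  function.\<close>

lemma cis_modulated:
  fixes z :: "'a::real_inner"
  shows "complex_of_real (1 - cos (u \<bullet> z)) * cis (\<xi> \<bullet> z)
    = cis (\<xi> \<bullet> z) - cis ((\<xi> + u) \<bullet> z) / 2 - cis ((\<xi> - u) \<bullet> z) / 2"
proof -
  have "complex_of_real (cos (u \<bullet> z)) = (cis (u \<bullet> z) + cis (- (u \<bullet> z))) / 2"
    by (simp add: complex_eq_iff)
  then show ?thesis
    by (simp add: inner_add_left inner_diff_left algebra_simps cis_mult[symmetric] diff_divide_distrib add_divide_distrib)
      (simp add: cis_mult algebra_simps)
qed

text \<open>The measures \<open>Q k / h k\<close> have masses tending to infinity, so the continuity theorem cannot be applied to them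
  directly. Weighted by \<open>1 - cos (u \<bullet> z)\<close> they become bounded, and their characteristic functions,
  being second differences of \<open>exp (- h \<psi>) / h\<close>, converge to those of the Levy measure with the same
  weight. Averaging over a Gaussian \<open>u\<close> replaces the weight by \<open>w(z) = 1 - exp (- |z|\<^sup>2 / 2)\<close>, which is
  bounded below on \<open>V\<close>; Fatou's lemma puts the limit inside this average, and the
  weight is removed by integrating \<open>1/w\<close> over \<open>V\<close>.\<close>

lemma small_time_jump_bound:
  fixes n :: "'a::euclidean_space \<Rightarrow> real" and Q :: "nat \<Rightarrow> 'a measure" and h :: "nat \<Rightarrow> real"
  assumes n[measurable]: "n \<in> borel_measurable borel" and n0: "\<And>z. 0 \<le> n z" and even: "\<And>z. n (- z) = n z"
    and int: "integrable lborel (\<lambda>z. min ((norm z)\<^sup>2) 1 * n z)"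
  defines "\<psi> \<equiv> \<lambda>\<xi>. LINT z|lborel. (1 - cos (\<xi> \<bullet> z)) * n z"
  assumes h: "\<And>k. h k > 0" "h \<longlonglongrightarrow> 0"
    and Q: "\<And>k. prob_space (Q k)" and sets[measurable_cong]: "\<And>k. sets (Q k) = sets borel"
    and char: "\<And>k \<xi>. (LINT z|Q k. cis (\<xi> \<bullet> z)) = complex_of_real (exp (- h k * \<psi> \<xi>))"
    and V: "open V" "0 \<notin> closure V"
  shows "(\<integral>\<^sup>+z\<in>V. ennreal (n z) \<partial>lborel) \<le> liminf (\<lambda>k. ennreal (1 / h k) * emeasure (Q k) V)"
proof -
  interpret Q: prob_space "Q k" for k by (rule Q)
  interpret G: prob_space "gauss :: 'a measure" by (rule prob_space_gauss)
  have sp: "space (Q k) = UNIV" for k using sets_eq_imp_space_eq[OF sets] by simp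
  have [measurable]: "V \<in> sets borel" using V by simp
  have ci: "integrable lborel (\<lambda>z. (1 - cos (\<xi> \<bullet> z)) * n z)" for \<xi>
  proof (rule Bochner_Integration.integrable_bound)
    show "integrable lborel (\<lambda>z. (2 + (norm \<xi>)\<^sup>2) * (min ((norm z)\<^sup>2) 1 * n z))" using int by simp
    show "AE z in lborel. norm ((1 - cos (\<xi> \<bullet> z)) * n z) \<le> norm ((2 + (norm \<xi>)\<^sup>2) * (min ((norm z)\<^sup>2) 1 * n z))"
      using one_minus_cos_bound[of \<xi>] n0
      by (intro AE_I2) (auto simp: abs_mult mult.assoc[symmetric] intro!: mult_right_mono)
  qed measurable
  define \<mu> where "\<mu> u k = density (Q k) (\<lambda>z. ennreal ((1 - cos (u \<bullet> z)) / h k))" for u k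
  define \<mu>0 where "\<mu>0 u = density lborel (\<lambda>z. ennreal ((1 - cos (u \<bullet> z)) * n z))" for u
  have s1[measurable_cong, simp]: "sets (\<mu> u k) = sets borel" for u k by (simp add: \<mu>_def sets)
  have s2[measurable_cong, simp]: "sets (\<mu>0 u) = sets borel" for u by (simp add: \<mu>0_def)
  have qi: "integrable (Q k) (\<lambda>z. cis (\<xi> \<bullet> z))" for k \<xi>
    by (rule Q.integrable_const_bound[where B=1]) auto
  have char_\<mu>: "(LINT z|\<mu> u k. cis (\<xi> \<bullet> z)) = complex_of_real
     (((1 - exp (- h k * \<psi> (\<xi> + u))) / h k) / 2 + ((1 - exp (- h k * \<psi> (\<xi> - u))) / h k) / 2 - (1 - exp (- h k * \<psi> \<xi>)) / h k)" for u k \<xi>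
  proof -
    have "(LINT z|\<mu> u k. cis (\<xi> \<bullet> z)) = (LINT z|Q k. ((1 - cos (u \<bullet> z)) / h k) *\<^sub>R cis (\<xi> \<bullet> z))"
      unfolding \<mu>_def by (rule integral_density) (use h(1) in \<open>auto intro!: AE_I2 divide_nonneg_pos\<close>)
    also have "\<dots> = (LINT z|Q k. (cis (\<xi> \<bullet> z) - cis ((\<xi> + u) \<bullet> z) / 2 - cis ((\<xi> - u) \<bullet> z) / 2) / h k)"
      unfolding cis_modulated[symmetric] by (simp add: scaleR_conv_of_real)
    also have "\<dots> = ((LINT z|Q k. cis (\<xi> \<bullet> z)) - (LINT z|Q k. cis ((\<xi> + u) \<bullet> z)) / 2 - (LINT z|Q k. cis ((\<xi> - u) \<bullet> z)) / 2) / h k"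
      using qi by simp
    also have "\<dots> = complex_of_real ((exp (- h k * \<psi> \<xi>) - exp (- h k * \<psi> (\<xi> + u)) / 2 - exp (- h k * \<psi> (\<xi> - u)) / 2) / h k)"
      unfolding char by simp
    also have "(exp (- h k * \<psi> \<xi>) - exp (- h k * \<psi> (\<xi> + u)) / 2 - exp (- h k * \<psi> (\<xi> - u)) / 2) / h k
      = ((1 - exp (- h k * \<psi> (\<xi> + u))) / h k) / 2 + ((1 - exp (- h k * \<psi> (\<xi> - u))) / h k) / 2 - (1 - exp (- h k * \<psi> \<xi>)) / h k"
      by (simp only: diff_divide_distrib) simp
    finally show ?thesis .
  qed
  have char_\<mu>0: "(LINT z|\<mu>0 u. cis (\<xi> \<bullet> z)) = complex_of_real (\<psi> (\<xi> + u) / 2 + \<psi> (\<xi> - u) / 2 - \<psi> \<xi>)" for u \<xi>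
  proof -
    have i: "integrable lborel (\<lambda>z. ((1 - cos (u \<bullet> z)) * n z) *\<^sub>R cis (\<xi> \<bullet> z))"
      by (rule Bochner_Integration.integrable_bound[OF ci[of u]]) auto
    have "(LINT z|\<mu>0 u. cis (\<xi> \<bullet> z)) = (LINT z|lborel. ((1 - cos (u \<bullet> z)) * n z) *\<^sub>R cis (\<xi> \<bullet> z))"
      unfolding \<mu>0_def by (rule integral_density) (use n0 in \<open>auto intro!: AE_I2\<close>)
    also have "\<dots> = complex_of_real (\<psi> (\<xi> + u) / 2 + \<psi> (\<xi> - u) / 2 - \<psi> \<xi>)"
    proof (rule complex_eqI)
      have "Re (LINT z|lborel. ((1 - cos (u \<bullet> z)) * n z) *\<^sub>R cis (\<xi> \<bullet> z)) = (LINT z|lborel. Re (((1 - cos (u \<bullet> z)) * n z) *\<^sub>R cis (\<xi> \<bullet> z)))"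
        by (rule integral_Re[OF i, symmetric])
      also have "\<dots> = (LINT z|lborel. ((1 - cos ((\<xi> + u) \<bullet> z)) * n z) / 2 + ((1 - cos ((\<xi> - u) \<bullet> z)) * n z) / 2 - (1 - cos (\<xi> \<bullet> z)) * n z)"
        by (intro Bochner_Integration.integral_cong refl) (simp add: inner_add_left inner_diff_left cos_add cos_diff field_simps)
      also have "\<dots> = \<psi> (\<xi> + u) / 2 + \<psi> (\<xi> - u) / 2 - \<psi> \<xi>"
        unfolding \<psi>_def using ci by simp
      finally show "Re (LINT z|lborel. ((1 - cos (u \<bullet> z)) * n z) *\<^sub>R cis (\<xi> \<bullet> z)) = Re (complex_of_real (\<psi> (\<xi> + u) / 2 + \<psi> (\<xi> - u) / 2 - \<psi> \<xi>))"
        by simp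
      have "Im (LINT z|lborel. ((1 - cos (u \<bullet> z)) * n z) *\<^sub>R cis (\<xi> \<bullet> z)) = (LINT z|lborel. Im (((1 - cos (u \<bullet> z)) * n z) *\<^sub>R cis (\<xi> \<bullet> z)))"
        by (rule integral_Im[OF i, symmetric])
      also have "\<dots> = 0"
        by (rule integral_odd_lborel) (use integrable_Im[OF i] even in auto)
      finally show "Im (LINT z|lborel. ((1 - cos (u \<bullet> z)) * n z) *\<^sub>R cis (\<xi> \<bullet> z)) = Im (complex_of_real (\<psi> (\<xi> + u) / 2 + \<psi> (\<xi> - u) / 2 - \<psi> \<xi>))"
        by simp
    qed
    finally show ?thesis .
  qed
  have \<psi>0: "0 \<le> \<psi> \<xi>" for \<xi> unfolding \<psi>_def by (rule Bochner_Integration.integral_nonneg) (use n0 in auto)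
  have fin: "finite_measure (\<mu> u k)" "measure (\<mu> u k) UNIV \<le> \<psi> u" for u k
  proof -
    have i: "integrable (Q k) (\<lambda>z. (1 - cos (u \<bullet> z)) / h k)"
      by (rule Q.integrable_const_bound[where B="2 / h k"]) (use h(1)[of k] in \<open>auto simp: abs_mult divide_le_cancel\<close>)
    have "(\<integral>\<^sup>+z. ennreal ((1 - cos (u \<bullet> z)) / h k) \<partial>Q k) = ennreal (LINT z|Q k. (1 - cos (u \<bullet> z)) / h k)"
      by (rule nn_integral_eq_integral[OF i]) (use h(1) in \<open>auto intro!: AE_I2 divide_nonneg_pos\<close>)
    then have e: "emeasure (\<mu> u k) UNIV = ennreal (LINT z|Q k. (1 - cos (u \<bullet> z)) / h k)"
      unfolding \<mu>_def by (simp add: emeasure_density sets)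
    show f: "finite_measure (\<mu> u k)"
      by standard (simp add: e sets_eq_imp_space_eq[OF s1])
    interpret F: finite_measure "\<mu> u k" by fact
    have "complex_of_real (measure (\<mu> u k) UNIV) = (LINT z|\<mu> u k. cis (0 \<bullet> z))"
      by (simp add: sets_eq_imp_space_eq[OF s1] scaleR_conv_of_real)
    also have "\<dots> = complex_of_real ((1 - exp (- h k * \<psi> u)) / h k)"
      unfolding char_\<mu> by (simp add: \<psi>_def)
    finally have "measure (\<mu> u k) UNIV = (1 - exp (- h k * \<psi> u)) / h k"
      by (simp only: of_real_eq_iff)
    also have "\<dots> \<le> \<psi> u"
      using exp_ge_add_one_self[of "- h k * \<psi> u"] h(1)[of k] by (simp add: field_simps)
    finally show "measure (\<mu> u k) UNIV \<le> \<psi> u" .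
  qed
  have fin0: "finite_measure (\<mu>0 u)" for u
  proof
    have "(\<integral>\<^sup>+z. ennreal ((1 - cos (u \<bullet> z)) * n z) \<partial>lborel) = ennreal (LINT z|lborel. (1 - cos (u \<bullet> z)) * n z)"
      by (rule nn_integral_eq_integral[OF ci]) (use n0 in auto)
    then show "emeasure (\<mu>0 u) (space (\<mu>0 u)) \<noteq> \<infinity>"
      by (simp add: \<mu>0_def emeasure_density)
  qed
  have conv: "(\<lambda>k. LINT z|\<mu> u k. f z) \<longlonglongrightarrow> (LINT z|\<mu>0 u. f z)"
    if f: "continuous_on UNIV f" "compact K" "\<And>x. x \<notin> K \<Longrightarrow> f x = 0" for f :: "'a \<Rightarrow> real" and K u
    by (rule vague_convergence[OF fin(1) s1 fin(2) fin0 s2 _ f])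
      (unfold char_\<mu> char_\<mu>0, intro tendsto_intros one_minus_exp_quotient_tendsto h, simp_all)
  define w where "w z = 1 - exp (- (norm (z::'a))\<^sup>2 / 2)" for z
  have [measurable]: "w \<in> borel_measurable borel" unfolding w_def by measurable
  have w_gauss: "(\<integral>\<^sup>+u. ennreal (1 - cos (u \<bullet> z)) \<partial>gauss) = ennreal (w z)" for z :: 'a
  proof -
    have i: "integrable gauss (\<lambda>u. cos (u \<bullet> z))"
      by (rule G.integrable_const_bound[where B=1]) auto
    have "(\<integral>\<^sup>+u. ennreal (1 - cos (u \<bullet> z)) \<partial>gauss) = ennreal (LINT u|gauss. 1 - cos (u \<bullet> z))"
      by (rule nn_integral_eq_integral) (use i in auto)
    also have "(LINT u|gauss. 1 - cos (u \<bullet> z)) = w z"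
      using i G.prob_space by (simp add: w_def char_gauss_re)
    finally show ?thesis .
  qed
  obtain r where r: "r > 0" "\<And>z. z \<in> V \<Longrightarrow> r \<le> norm z"
  proof -
    have "open (- closure V)" "0 \<in> - closure V" using V by auto
    then obtain r where "r > 0" "ball 0 r \<subseteq> - closure V" unfolding open_contains_ball by blast
    then have "r \<le> norm z" if "z \<in> V" for z
      using that closure_subset[of V] by (force simp: subset_iff not_le)
    then show ?thesis using that[of r] \<open>r > 0\<close> by blast
  qed
  define w0 where "w0 = 1 - exp (- r\<^sup>2 / 2)"
  have w0: "w0 > 0" using r by (simp add: w0_def)
  have wV: "w z \<ge> w0" if "z \<in> V" for z
    using r(2)[OF that] r(1) by (simp add: w_def w0_def power_mono)
  \<comment> \<open>The maximum is attained by \<open>w\<close> on \<open>V\<close>; it only keeps the quotient continuous elsewhere.\<close>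
  define F where "F z = indicator V z / max (w z) w0" for z
  have [measurable]: "F \<in> borel_measurable borel" unfolding F_def by measurable
  have F0: "0 \<le> F z" for z using w0 by (auto simp: F_def)
  \<comment> \<open>Continuous functions of compact support that increase to \<open>F\<close>.\<close>
  define Fj where "Fj j z = min 1 (real j * infdist z (- V)) * max 0 (min 1 (real j - norm z)) / max (w z) w0" for j z
  have [continuous_intros]: "continuous_on UNIV (Fj j)" for j
    unfolding Fj_def w_def using w0 by (intro continuous_intros) (auto simp: max_def)
  have [measurable]: "Fj j \<in> borel_measurable borel" for j
    by (rule borel_measurable_continuous_onI) (rule continuous_intros)
  have Fj0: "0 \<le> Fj j z" for j z using w0 by (auto simp: Fj_def infdist_nonneg intro!: divide_nonneg_pos mult_nonneg_nonneg)
  have V_ne: "- V \<noteq> {}" using V closure_subset by auto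
  have Fj_le: "Fj j z \<le> F z" for j z
  proof (cases "z \<in> V")
    case True
    then show ?thesis using w0 by (auto simp: Fj_def F_def infdist_nonneg intro!: divide_right_mono mult_le_one)
  next
    case False
    then show ?thesis by (simp add: Fj_def F_def)
  qed
  have Fj_mono: "Fj i z \<le> Fj j z" if "i \<le> j" for i j z
    unfolding Fj_def using w0 that
    by (intro divide_right_mono mult_mono min.mono max.mono order_refl) (auto simp: infdist_nonneg intro: mult_right_mono)
  have Fj_lim: "(SUP j. ennreal (Fj j z)) = ennreal (F z)" for z
  proof -
    have "(\<lambda>j. Fj j z) \<longlonglongrightarrow> F z"
    proof (rule tendsto_eventually)
      show "\<forall>\<^sub>F j in sequentially. Fj j z = F z"
      proof (cases "z \<in> V")
        case True
        have "closed (- V)" using V by auto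
        then have d: "infdist z (- V) > 0" using True V_ne by (metis ComplD in_closed_iff_infdist_zero infdist_nonneg less_eq_real_def)
        obtain N :: nat where N: "max (1 / infdist z (- V)) (norm z + 1) < real N" using reals_Archimedean2 by blast
        show ?thesis using eventually_ge_at_top[of N]
        proof eventually_elim
          case (elim j)
          then have "1 / infdist z (- V) < real j" "norm z + 1 < real j" using N by auto
          then have "1 \<le> real j * infdist z (- V)" "1 \<le> real j - norm z" using d by (auto simp: field_simps)
          then show ?case using True by (simp add: Fj_def F_def)
        qed
      next
        case False
        then show ?thesis by (simp add: Fj_def F_def)
      qed
    qed
    then have "(\<lambda>j. ennreal (Fj j z)) \<longlonglongrightarrow> ennreal (F z)" by (rule tendsto_ennrealI)
    moreover have "(\<lambda>j. ennreal (Fj j z)) \<longlonglongrightarrow> (SUP j. ennreal (Fj j z))"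
      by (rule LIMSEQ_SUP) (auto simp: incseq_def Fj_mono intro!: ennreal_leI)
    ultimately show ?thesis by (rule LIMSEQ_unique[symmetric])
  qed
  have step: "(\<integral>\<^sup>+z. ennreal (F z) \<partial>\<mu>0 u) \<le> liminf (\<lambda>k. \<integral>\<^sup>+z. ennreal (F z) \<partial>\<mu> u k)" for u
  proof -
    have "(\<integral>\<^sup>+z. ennreal (F z) \<partial>\<mu>0 u) = (\<integral>\<^sup>+z. (SUP j. ennreal (Fj j z)) \<partial>\<mu>0 u)" by (simp add: Fj_lim)
    also have "\<dots> = (SUP j. \<integral>\<^sup>+z. ennreal (Fj j z) \<partial>\<mu>0 u)"
      by (rule nn_integral_monotone_convergence_SUP) (auto simp: incseq_def le_fun_def Fj_mono intro!: ennreal_leI)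
    also have "\<dots> \<le> liminf (\<lambda>k. \<integral>\<^sup>+z. ennreal (F z) \<partial>\<mu> u k)"
    proof (rule SUP_least)
      fix j :: nat
      have z: "Fj j z = 0" if "z \<notin> cball 0 (real j)" for z using that by (auto simp: Fj_def)
      have bd: "norm (Fj j z) \<le> 1 / w0" for z
        using Fj_le[of j z] Fj0[of j z] w0 by (auto simp: F_def indicator_def frac_le split: if_splits intro: order_trans)
      have e: "(\<integral>\<^sup>+z. ennreal (Fj j z) \<partial>m) = ennreal (LINT z|m. Fj j z)"
        if m: "finite_measure m" "sets m = sets borel" for m :: "'a measure"
      proof -
        interpret m: finite_measure m by fact
        note [measurable_cong] = m(2)
        show ?thesis
          by (rule nn_integral_eq_integral) (use bd Fj0 in \<open>auto intro!: m.integrable_const_bound[where B="1 / w0"]\<close>)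
      qed
      have "(\<lambda>k. \<integral>\<^sup>+z. ennreal (Fj j z) \<partial>\<mu> u k) \<longlonglongrightarrow> (\<integral>\<^sup>+z. ennreal (Fj j z) \<partial>\<mu>0 u)"
        unfolding e[OF fin(1) s1] e[OF fin0 s2]
        by (intro tendsto_ennrealI conv[of _ "cball 0 (real j)"] z) (auto intro: continuous_intros)
      then have "(\<integral>\<^sup>+z. ennreal (Fj j z) \<partial>\<mu>0 u) = liminf (\<lambda>k. \<integral>\<^sup>+z. ennreal (Fj j z) \<partial>\<mu> u k)"
        by (rule lim_imp_Liminf[symmetric, rotated]) simp
      also have "\<dots> \<le> liminf (\<lambda>k. \<integral>\<^sup>+z. ennreal (F z) \<partial>\<mu> u k)"
        by (intro Liminf_mono always_eventually allI nn_integral_mono ennreal_leI Fj_le)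
      finally show "(\<integral>\<^sup>+z. ennreal (Fj j z) \<partial>\<mu>0 u) \<le> liminf (\<lambda>k. \<integral>\<^sup>+z. ennreal (F z) \<partial>\<mu> u k)" .
    qed
    finally show ?thesis .
  qed
  have Fw: "ennreal (w z) * ennreal (F z) = indicator V z" for z
    using wV[of z] w0 F0[of z] by (auto simp: F_def indicator_def max_def ennreal_mult'[symmetric])
  interpret PL: pair_sigma_finite "gauss :: 'a measure" "lborel :: 'a measure" ..
  have "(\<integral>\<^sup>+z\<in>V. ennreal (n z) \<partial>lborel) = (\<integral>\<^sup>+z. (\<integral>\<^sup>+u. ennreal (1 - cos (u \<bullet> z)) \<partial>gauss) * (ennreal (F z) * ennreal (n z)) \<partial>lborel)"
    unfolding w_gauss mult.assoc[symmetric] Fw by (simp add: mult.commute)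
  also have "\<dots> = (\<integral>\<^sup>+z. (\<integral>\<^sup>+u. ennreal (1 - cos (u \<bullet> z)) * (ennreal (F z) * ennreal (n z)) \<partial>gauss) \<partial>lborel)"
    by (intro nn_integral_cong nn_integral_multc[symmetric]) simp
  also have "\<dots> = (\<integral>\<^sup>+u. (\<integral>\<^sup>+z. ennreal (1 - cos (u \<bullet> z)) * (ennreal (F z) * ennreal (n z)) \<partial>lborel) \<partial>gauss)"
    by (rule PL.Fubini') measurable
  also have "\<dots> = (\<integral>\<^sup>+u. (\<integral>\<^sup>+z. ennreal (F z) \<partial>\<mu>0 u) \<partial>gauss)"
    unfolding \<mu>0_def by (subst nn_integral_density) (auto simp: ennreal_mult' n0 mult_ac)
  also have "\<dots> \<le> (\<integral>\<^sup>+u. liminf (\<lambda>k. \<integral>\<^sup>+z. ennreal (F z) \<partial>\<mu> u k) \<partial>gauss)"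
    by (intro nn_integral_mono step)
  also have "\<dots> \<le> liminf (\<lambda>k. \<integral>\<^sup>+u. (\<integral>\<^sup>+z. ennreal (F z) \<partial>\<mu> u k) \<partial>gauss)"
    unfolding \<mu>_def by (rule nn_integral_liminf) (subst nn_integral_density; measurable)
  also have "(\<lambda>k. \<integral>\<^sup>+u. (\<integral>\<^sup>+z. ennreal (F z) \<partial>\<mu> u k) \<partial>gauss) = (\<lambda>k. ennreal (1 / h k) * emeasure (Q k) V)"
  proof
    fix k
    interpret P: pair_sigma_finite "gauss :: 'a measure" "Q k" ..
    have "(\<integral>\<^sup>+u. (\<integral>\<^sup>+z. ennreal (F z) \<partial>\<mu> u k) \<partial>gauss) = (\<integral>\<^sup>+u. (\<integral>\<^sup>+z. ennreal (1 - cos (u \<bullet> z)) * (ennreal (1 / h k) * ennreal (F z)) \<partial>Q k) \<partial>gauss)"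
      unfolding \<mu>_def using h(1)[of k] by (subst nn_integral_density) (auto simp: divide_inverse ennreal_mult' mult_ac)
    also have "\<dots> = (\<integral>\<^sup>+z. (\<integral>\<^sup>+u. ennreal (1 - cos (u \<bullet> z)) * (ennreal (1 / h k) * ennreal (F z)) \<partial>gauss) \<partial>Q k)"
      by (rule P.Fubini'[symmetric]) measurable
    also have "\<dots> = (\<integral>\<^sup>+z. ennreal (1 / h k) * indicator V z \<partial>Q k)"
      by (intro nn_integral_cong) (subst nn_integral_multc, simp, simp only: w_gauss Fw[symmetric] mult_ac)
    also have "\<dots> = ennreal (1 / h k) * emeasure (Q k) V"
      by (subst nn_integral_cmult) (auto simp: sets)
    finally show "(\<integral>\<^sup>+u. (\<integral>\<^sup>+z. ennreal (F z) \<partial>\<mu> u k) \<partial>gauss) = ennreal (1 / h k) * emeasure (Q k) V" .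
  qed
  finally show ?thesis .
qed

section \<open>Right-continuous Levy processes and the Markov property\<close>

text \<open>A Levy process with right-continuous paths that start at \<open>0\<close> without exception; subtracting the value at
  time \<open>0\<close> brings every Levy process into this form. The law of the increments is left open.\<close>

locale rc_levy = prob_space M for M :: "'w measure" +
  fixes X :: "real \<Rightarrow> 'w \<Rightarrow> 'a::euclidean_space"
  assumes X_meas: "0 \<le> t \<Longrightarrow> X t \<in> borel_measurable M"
    and X_zero: "\<omega> \<in> space M \<Longrightarrow> X 0 \<omega> = 0"
    and indep_increments: "0 \<le> (ts::nat \<Rightarrow> real) 0 \<Longrightarrow> (\<And>i. i < n \<Longrightarrow> ts i \<le> ts (Suc i)) \<Longrightarrow>
      indep_vars (\<lambda>_. borel) (\<lambda>i \<omega>. X (ts (Suc i)) \<omega> - X (ts i) \<omega>) {..<n}"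
    and stationary: "0 \<le> s \<Longrightarrow> s \<le> t \<Longrightarrow> distr M borel (\<lambda>\<omega>. X t \<omega> - X s \<omega>) = distr M borel (X (t - s))"
    and rcont: "\<omega> \<in> space M \<Longrightarrow> 0 \<le> t \<Longrightarrow> ((\<lambda>s. X s \<omega>) \<longlongrightarrow> X t \<omega>) (at_right t)"
begin

text \<open>The natural filtration, neither completed nor made right-continuous.\<close>

definition past :: "real \<Rightarrow> 'w measure" where
  "past u = sigma (space M) (\<Union>s\<in>{0..u}. {X s -` B \<inter> space M |B. B \<in> sets borel})"

lemma space_past [simp]: "space (past u) = space M"
  unfolding past_def by (rule space_measure_of) auto

lemma sets_past: "sets (past u) = sigma_sets (space M) (\<Union>s\<in>{0..u}. {X s -` B \<inter> space M |B. B \<in> sets borel})"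
  unfolding past_def by (rule sets_measure_of) auto

lemma sets_past_subset: "sets (past u) \<subseteq> sets M"
  unfolding sets_past by (rule sets.sigma_sets_subset) (use X_meas in \<open>auto intro: measurable_sets\<close>)

lemma X_past [measurable (raw)]: "0 \<le> s \<Longrightarrow> s \<le> u \<Longrightarrow> X s \<in> borel_measurable (past u)"
  unfolding measurable_def sets_past by (auto intro!: sigma_sets.Basic) fastforce

lemma past_mono: "u \<le> v \<Longrightarrow> sets (past u) \<subseteq> sets (past v)"
  unfolding sets_past by (rule sigma_sets_mono', rule UN_mono) auto

lemma measurable_past_id: "(\<lambda>\<omega>. \<omega>) \<in> M \<rightarrow>\<^sub>M past u"
proof (rule measurableI)
  fix A assume "A \<in> sets (past u)"
  then have "A \<in> sets M" using sets_past_subset by blast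
  then show "(\<lambda>\<omega>. \<omega>) -` A \<inter> space M \<in> sets M" by auto
qed simp

text \<open>A generator of \<open>past u\<close> that is closed under intersections.\<close>

definition cylinders :: "real \<Rightarrow> 'w set set" where
  "cylinders u = {(\<Inter>s\<in>J. X s -` B s) \<inter> space M |J B. finite J \<and> J \<subseteq> {0..u} \<and> (\<forall>s. B s \<in> sets borel)}"

lemma Int_stable_cylinders: "Int_stable (cylinders u)"
proof (rule Int_stableI)
  fix a b assume "a \<in> cylinders u" "b \<in> cylinders u"
  then obtain J B J' B' where a: "a = (\<Inter>s\<in>J. X s -` B s) \<inter> space M" "finite J" "J \<subseteq> {0..u}" "\<forall>s. B s \<in> sets borel"
    and b: "b = (\<Inter>s\<in>J'. X s -` B' s) \<inter> space M" "finite J'" "J' \<subseteq> {0..u}" "\<forall>s. B' s \<in> sets borel"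
    unfolding cylinders_def by blast
  let ?B = "\<lambda>s. (if s \<in> J then B s else UNIV) \<inter> (if s \<in> J' then B' s else UNIV)"
  have "a \<inter> b = (\<Inter>s\<in>J \<union> J'. X s -` ?B s) \<inter> space M"
    unfolding a(1) b(1) by (auto split: if_splits)
  moreover have "\<forall>s. ?B s \<in> sets borel" using a b by auto
  ultimately show "a \<inter> b \<in> cylinders u"
    unfolding cylinders_def using a b by (intro CollectI exI[of _ "J \<union> J'"] exI[of _ ?B]) auto
qed

lemma sigma_cylinders: "sigma_sets (space M) (cylinders u) = sets (past u)"
proof
  show "sigma_sets (space M) (cylinders u) \<subseteq> sets (past u)"
  proof (subst space_past[of u, symmetric], rule sets.sigma_sets_subset, rule subsetI)
    fix a assume "a \<in> cylinders u"
    then obtain J B where a: "a = (\<Inter>s\<in>J. X s -` B s) \<inter> space M" "finite J" "J \<subseteq> {0..u}" "\<forall>s. B s \<in> sets borel"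
      unfolding cylinders_def by blast
    have "a = {\<omega>\<in>space (past u). \<forall>s\<in>J. X s \<omega> \<in> B s}" using a(1) by auto
    also have "\<dots> \<in> sets (past u)"
    proof (rule sets.sets_Collect_finite_All)
      fix s assume "s \<in> J"
      then show "{\<omega>\<in>space (past u). X s \<omega> \<in> B s} \<in> sets (past u)"
        using a measurable_sets[OF X_past[of s u], of "B s"] by (auto simp: vimage_def Int_def conj_commute)
    qed fact
    finally show "a \<in> sets (past u)" .
  qed
  show "sets (past u) \<subseteq> sigma_sets (space M) (cylinders u)"
    unfolding sets_past
  proof (rule sigma_sets_mono', rule subsetI)
    fix a assume "a \<in> (\<Union>s\<in>{0..u}. {X s -` B \<inter> space M |B. B \<in> sets borel})"
    then obtain s B where "s \<in> {0..u}" "B \<in> sets borel" "a = X s -` B \<inter> space M" by blast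
    then show "a \<in> cylinders u"
      unfolding cylinders_def by (intro CollectI exI[of _ "{s}"] exI[of _ "\<lambda>_. B"]) auto
  qed
qed

text \<open>Listing the finitely many times in increasing order, followed by \<open>u\<close> and \<open>u + h\<close>, turns the cylinder
  into an event about all increments but the last one.\<close>

lemma indep_cylinder_increment:
  assumes "0 \<le> u" "0 \<le> h" and a: "a \<in> cylinders u" and C: "C \<in> sets borel"
  shows "prob (a \<inter> ((\<lambda>\<omega>. X (u + h) \<omega> - X u \<omega>) -` C \<inter> space M)) =
    prob a * prob ((\<lambda>\<omega>. X (u + h) \<omega> - X u \<omega>) -` C \<inter> space M)"
proof -
  obtain J B where J: "a = (\<Inter>s\<in>J. X s -` B s) \<inter> space M" "finite J" "J \<subseteq> {0..u}" "\<forall>s. B s \<in> sets borel"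
    using a unfolding cylinders_def by blast
  define l where "l = sorted_list_of_set (insert 0 J)"
  define m where "m = length l"
  define t where "t i = (if i < m then l ! i else if i = m then u else u + h)" for i
  have sl: "set l = insert 0 J" "sorted l" using J(2)
    by (simp_all only: l_def set_sorted_list_of_set finite_insert sorted_sorted_list_of_set)
  have m: "m > 0" using sl(1) by (cases l) (auto simp: m_def)
  have range: "l ! i \<in> {0..u}" if "i < m" for i
    using nth_mem[of i l] that sl(1) J(3) assms(1) by (auto simp: m_def)
  have l0: "l ! 0 = 0"
  proof -
    obtain i where i: "i < m" "l ! i = 0" using sl(1) by (metis in_set_conv_nth insertI1 m_def)
    then have "l ! 0 \<le> 0" using sorted_nth_mono[OF sl(2), of 0 i] by (simp add: m_def)
    then show ?thesis using range[OF m] by auto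
  qed
  have mono: "t i \<le> t (Suc i)" if "i < Suc m" for i
  proof -
    consider "Suc i < m" | "Suc i = m" | "i = m" using \<open>i < Suc m\<close> by linarith
    then show ?thesis
    proof cases
      case 1
      then show ?thesis using sorted_nth_mono[OF sl(2), of i "Suc i"] by (simp add: t_def m_def)
    next
      case 2
      then show ?thesis using range[of i] by (simp add: t_def)
    next
      case 3
      then show ?thesis using assms by (simp add: t_def)
    qed
  qed
  have t0: "t 0 = 0" using m l0 by (simp add: t_def)
  define I where "I i \<omega> = X (t (Suc i)) \<omega> - X (t i) \<omega>" for i \<omega>
  have ind: "indep_vars (\<lambda>_. borel) I {..<Suc m}"
    unfolding I_def by (rule indep_increments) (use t0 mono in auto)
  have ind2: "indep_var (PiM {..<m} (\<lambda>_. borel)) (\<lambda>\<omega>. restrict (\<lambda>i. I i \<omega>) {..<m})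
     (PiM {m} (\<lambda>_. borel)) (\<lambda>\<omega>. restrict (\<lambda>i. I i \<omega>) {m})"
    by (rule indep_var_restrict[OF ind]) auto
  have tel: "X (t i) \<omega> = (\<Sum>j<i. I j \<omega>)" if "\<omega> \<in> space M" for i \<omega>
    using that by (induct i) (auto simp: I_def t0 X_zero)
  \<comment> \<open>Position of \<open>s\<close> in the list of times, so that \<open>X s\<close> is the sum of the first \<open>idx s\<close> increments.\<close>
  define idx where "idx s = (SOME i. i < m \<and> l ! i = s)" for s
  have idx: "idx s < m" "l ! (idx s) = s" if "s \<in> J" for s
  proof -
    have "\<exists>i. i < m \<and> l ! i = s" using that sl(1) by (metis in_set_conv_nth insertI2 m_def)
    from someI_ex[OF this] show "idx s < m" "l ! (idx s) = s" by (auto simp: idx_def)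
  qed
  have Xidx: "X s \<omega> = (\<Sum>j<idx s. I j \<omega>)" if "s \<in> J" "\<omega> \<in> space M" for s \<omega>
    using tel[OF that(2), of "idx s"] idx[OF that(1)] by (simp add: t_def)
  define E where "E = {f\<in>space (PiM {..<m} (\<lambda>_. borel :: 'a measure)). \<forall>s\<in>J. (\<Sum>j<idx s. f j) \<in> B s}"
  have E: "E \<in> sets (PiM {..<m} (\<lambda>_. borel))"
    unfolding E_def
  proof (rule sets.sets_Collect_finite_All[OF _ J(2)])
    fix s assume s: "s \<in> J"
    have "(\<lambda>f. \<Sum>j<idx s. f j) \<in> borel_measurable (PiM {..<m} (\<lambda>_. borel :: 'a measure))"
      by (intro borel_measurable_sum measurable_component_singleton) (use idx[OF s] in auto)
    from measurable_sets[OF this, of "B s"] J(4)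
    show "{f\<in>space (PiM {..<m} (\<lambda>_. borel)). (\<Sum>j<idx s. f j) \<in> B s} \<in> sets (PiM {..<m} (\<lambda>_. borel))"
      by (auto simp: vimage_def Int_def conj_commute)
  qed
  define F where "F = {f\<in>space (PiM {m} (\<lambda>_. borel :: 'a measure)). f m \<in> C}"
  have F: "F \<in> sets (PiM {m} (\<lambda>_. borel))"
  proof -
    have "(\<lambda>f. f m) \<in> borel_measurable (PiM {m} (\<lambda>_. borel :: 'a measure))"
      by (rule measurable_component_singleton) simp
    from measurable_sets[OF this C] show ?thesis
      by (auto simp: F_def vimage_def Int_def conj_commute)
  qed
  have aE: "a = (\<lambda>\<omega>. restrict (\<lambda>i. I i \<omega>) {..<m}) -` E \<inter> space M"
  proof -
    have "(\<Sum>j<idx s. restrict (\<lambda>i. I i \<omega>) {..<m} j) = X s \<omega>" if "s \<in> J" "\<omega> \<in> space M" for s \<omega>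
      unfolding Xidx[OF that] using idx[OF that(1)] by (intro sum.cong) auto
    then show ?thesis unfolding J(1) E_def by (auto simp: space_PiM)
  qed
  have Im: "I m \<omega> = X (u + h) \<omega> - X u \<omega>" for \<omega> by (simp add: I_def t_def)
  have cF: "(\<lambda>\<omega>. X (u + h) \<omega> - X u \<omega>) -` C \<inter> space M = (\<lambda>\<omega>. restrict (\<lambda>i. I i \<omega>) {m}) -` F \<inter> space M"
    unfolding F_def by (auto simp: space_PiM Im)
  have "a \<inter> ((\<lambda>\<omega>. X (u + h) \<omega> - X u \<omega>) -` C \<inter> space M)
    = (\<lambda>\<omega>. (restrict (\<lambda>i. I i \<omega>) {..<m}, restrict (\<lambda>i. I i \<omega>) {m})) -` (E \<times> F) \<inter> space M"
    unfolding aE cF by auto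
  then show ?thesis
    using indep_varD[OF ind2 E F] unfolding aE cF by simp
qed

lemma indep_past_increment:
  assumes "0 \<le> u" "0 \<le> h" and A: "A \<in> sets (past u)" and C: "C \<in> sets borel"
  shows "prob (A \<inter> ((\<lambda>\<omega>. X (u + h) \<omega> - X u \<omega>) -` C \<inter> space M)) =
    prob A * prob ((\<lambda>\<omega>. X (u + h) \<omega> - X u \<omega>) -` C \<inter> space M)"
proof -
  let ?D = "\<lambda>\<omega>. X (u + h) \<omega> - X u \<omega>"
  have D[measurable]: "?D \<in> borel_measurable M" using X_meas[of u] X_meas[of "u+h"] assms by simp
  have "indep_set (cylinders u) {?D -` C \<inter> space M |C. C \<in> sets borel}"
  proof (rule indep_setI)
    show "cylinders u \<subseteq> events"
      using sigma_cylinders[of u] sets_past_subset[of u] by (auto intro: sigma_sets.Basic)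
    show "{?D -` C \<inter> space M |C. C \<in> sets borel} \<subseteq> events" by (auto intro: measurable_sets[OF D])
    fix a b assume "a \<in> cylinders u" "b \<in> {?D -` C \<inter> space M |C. C \<in> sets borel}"
    then show "prob (a \<inter> b) = prob a * prob b" using indep_cylinder_increment[OF assms(1,2)] by blast
  qed
  then have "indep_set (sigma_sets (space M) (cylinders u)) (sigma_sets (space M) {?D -` C \<inter> space M |C. C \<in> sets borel})"
  proof (rule indep_set_sigma_sets)
    show "Int_stable {?D -` C \<inter> space M |C. C \<in> sets borel}"
    proof (rule Int_stableI)
      fix a b assume "a \<in> {?D -` C \<inter> space M |C. C \<in> sets borel}" "b \<in> {?D -` C \<inter> space M |C. C \<in> sets borel}"
      then obtain C C' where "C \<in> sets borel" "C' \<in> sets borel" "a = ?D -` C \<inter> space M" "b = ?D -` C' \<inter> space M" by blast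
      then show "a \<inter> b \<in> {?D -` C \<inter> space M |C. C \<in> sets borel}"
        by (intro CollectI exI[of _ "C \<inter> C'"]) auto
    qed
  qed (rule Int_stable_cylinders)
  then show ?thesis
    by (rule indep_setD) (use A C in \<open>auto simp: sigma_cylinders intro!: sigma_sets.Basic\<close>)
qed

text \<open>The past up to \<open>u\<close> and the next increment have a product law, so in any joint functional of the two the
  increment may be replaced by an independent copy of \<open>X h\<close>. This is the form in which the Markov
  property is used below.\<close>

lemma freeze_past:
  assumes "0 \<le> u" "0 \<le> h" and \<Phi>: "\<Phi> \<in> borel_measurable (past u \<Otimes>\<^sub>M borel)"
  shows "(\<integral>\<^sup>+\<omega>. \<Phi> (\<omega>, X (u + h) \<omega> - X u \<omega>) \<partial>M) = (\<integral>\<^sup>+\<omega>. (\<integral>\<^sup>+\<omega>'. \<Phi> (\<omega>, X h \<omega>') \<partial>M) \<partial>M)"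
proof -
  let ?D = "\<lambda>\<omega>. X (u + h) \<omega> - X u \<omega>"
  have D[measurable]: "?D \<in> borel_measurable M" using X_meas[of u] X_meas[of "u+h"] assms by simp
  have [measurable]: "X h \<in> borel_measurable M" using X_meas assms by simp
  note [measurable] = measurable_past_id[of u] \<Phi>
  interpret A: prob_space "distr M (past u) (\<lambda>\<omega>. \<omega>)" by (rule prob_space_distr) (rule measurable_past_id)
  interpret B: prob_space "distr M borel ?D" by (rule prob_space_distr) (rule D)
  interpret C: prob_space "distr M borel (X h)" by (rule prob_space_distr) measurable
  have st: "distr M borel ?D = distr M borel (X h)" using stationary[of u "u + h"] assms by simp
  have "(\<integral>\<^sup>+\<omega>. \<Phi> (\<omega>, ?D \<omega>) \<partial>M) = (\<integral>\<^sup>+y. \<Phi> y \<partial>distr M (past u \<Otimes>\<^sub>M borel) (\<lambda>\<omega>. (\<omega>, ?D \<omega>)))"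
    by (rule nn_integral_distr[symmetric]) measurable
  also have "distr M (past u \<Otimes>\<^sub>M borel) (\<lambda>\<omega>. (\<omega>, ?D \<omega>)) = distr M (past u) (\<lambda>\<omega>. \<omega>) \<Otimes>\<^sub>M distr M borel ?D"
  proof (rule pair_measure_eqI[symmetric])
    show "sigma_finite_measure (distr M (past u) (\<lambda>\<omega>. \<omega>))" "sigma_finite_measure (distr M borel ?D)"
      by unfold_locales
    fix A C assume A: "A \<in> sets (distr M (past u) (\<lambda>\<omega>. \<omega>))" and C: "C \<in> sets (distr M borel ?D)"
    have "(\<lambda>\<omega>. (\<omega>, ?D \<omega>)) -` (A \<times> C) \<inter> space M = A \<inter> (?D -` C \<inter> space M)" by auto
    moreover have "A \<inter> space M = A" using A sets.sets_into_space[of A "past u"] by auto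
    ultimately show "emeasure (distr M (past u) (\<lambda>\<omega>. \<omega>)) A * emeasure (distr M borel ?D) C =
      emeasure (distr M (past u \<Otimes>\<^sub>M borel) (\<lambda>\<omega>. (\<omega>, ?D \<omega>))) (A \<times> C)"
      using A C indep_past_increment[OF assms(1,2), of A C]
      by (simp add: emeasure_distr emeasure_eq_measure ennreal_mult')
  qed (simp cong: sets_pair_measure_cong)
  also have "(\<integral>\<^sup>+y. \<Phi> y \<partial>(distr M (past u) (\<lambda>\<omega>. \<omega>) \<Otimes>\<^sub>M distr M borel ?D))
    = (\<integral>\<^sup>+\<omega>. (\<integral>\<^sup>+z. \<Phi> (\<omega>, z) \<partial>distr M borel ?D) \<partial>distr M (past u) (\<lambda>\<omega>. \<omega>))"
    by (rule B.nn_integral_fst[symmetric]) (simp add: \<Phi> cong: measurable_cong_sets)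
  also have "\<dots> = (\<integral>\<^sup>+\<omega>. (\<integral>\<^sup>+z. \<Phi> (\<omega>, z) \<partial>distr M borel (X h)) \<partial>M)"
    unfolding st
  proof (rule nn_integral_distr[OF measurable_past_id])
    have "(\<lambda>\<omega>. \<integral>\<^sup>+z. \<Phi> (\<omega>, z) \<partial>distr M borel (X h)) \<in> borel_measurable (past u)"
      by (rule C.borel_measurable_nn_integral_fst) (simp add: \<Phi> cong: measurable_cong_sets sets_pair_measure_cong)
    then show "(\<lambda>\<omega>. \<integral>\<^sup>+z. \<Phi> (\<omega>, z) \<partial>distr M borel (X h)) \<in> borel_measurable (distr M (past u) (\<lambda>\<omega>. \<omega>))"
      by simp
  qed
  also have "\<dots> = (\<integral>\<^sup>+\<omega>. (\<integral>\<^sup>+\<omega>'. \<Phi> (\<omega>, X h \<omega>') \<partial>M) \<partial>M)"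
    by (intro nn_integral_cong) (subst nn_integral_distr, auto)
  finally show ?thesis .
qed

end

section \<open>The strong Markov property at dyadic times\<close>

text \<open>The first dyadic time of level \<open>m\<close> that is strictly larger than \<open>s\<close>. Being strictly larger, it turns
  the strict inequalities that define an optional time into events of the past, and it approaches \<open>s\<close>
  from the side on which the paths are continuous.\<close>

definition dyad_up :: "nat \<Rightarrow> real \<Rightarrow> real" where
  "dyad_up m s = real (Suc (nat \<lfloor>s * 2 ^ m\<rfloor>)) / 2 ^ m"

lemma dyad_up_gt: "0 \<le> s \<Longrightarrow> s < dyad_up m s"
  and dyad_up_le: "0 \<le> s \<Longrightarrow> dyad_up m s \<le> s + 1 / 2 ^ m"
proof -
  assume s: "0 \<le> s"
  have "real (nat \<lfloor>s * 2 ^ m\<rfloor>) = of_int \<lfloor>s * 2 ^ m\<rfloor>" using s by simp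
  then have "s * 2 ^ m < real (Suc (nat \<lfloor>s * 2 ^ m\<rfloor>))" "real (Suc (nat \<lfloor>s * 2 ^ m\<rfloor>)) \<le> s * 2 ^ m + 1"
    using floor_correct[of "s * 2 ^ m"] by linarith+
  then show "s < dyad_up m s" "dyad_up m s \<le> s + 1 / 2 ^ m"
    by (auto simp: dyad_up_def field_simps)
qed

lemma dyad_up_tendsto: "0 \<le> s \<Longrightarrow> (\<lambda>m. dyad_up m s) \<longlonglongrightarrow> s"
proof (rule tendsto_sandwich)
  assume s: "0 \<le> s"
  show "\<forall>\<^sub>F m in sequentially. s \<le> dyad_up m s" using dyad_up_gt[OF s] by (auto intro: always_eventually less_imp_le)
  show "\<forall>\<^sub>F m in sequentially. dyad_up m s \<le> s + 1 / 2 ^ m" using dyad_up_le[OF s] by (auto intro: always_eventually)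
  have "(\<lambda>m. s + (1 / 2) ^ m) \<longlonglongrightarrow> s + 0" by (intro tendsto_intros LIMSEQ_power_zero) auto
  then show "(\<lambda>m. s + 1 / 2 ^ m) \<longlonglongrightarrow> s" by (simp add: power_one_over)
qed simp

lemma measurable_dyad_up [measurable]: "dyad_up m \<in> borel_measurable borel"
  unfolding dyad_up_def by measurable

lemma dyad_up_mult_le:
  assumes "0 \<le> r" "r < 1"
  shows "\<exists>k\<le>2 ^ n. dyad_up n r = real k / 2 ^ n"
proof (intro exI conjI)
  show "dyad_up n r = real (Suc (nat \<lfloor>r * 2 ^ n\<rfloor>)) / 2 ^ n" by (simp add: dyad_up_def)
  have "r * 2 ^ n < 2 ^ n" using assms by simp
  then have "\<lfloor>r * 2 ^ n\<rfloor> < 2 ^ n" by (simp add: floor_less_iff)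
  then have "nat \<lfloor>r * 2 ^ n\<rfloor> < 2 ^ n" by (simp add: nat_less_iff assms)
  then show "Suc (nat \<lfloor>r * 2 ^ n\<rfloor>) \<le> 2 ^ n" by (rule Suc_leI)
qed

context rc_levy begin

lemma X_rcont_seq:
  assumes "\<omega> \<in> space M" "0 \<le> t" "s \<longlonglongrightarrow> t" "\<And>n::nat. t \<le> s n"
  shows "(\<lambda>n. X (s n) \<omega>) \<longlonglongrightarrow> X t \<omega>"
proof -
  have "((\<lambda>s. X s \<omega>) \<longlongrightarrow> X t \<omega>) (at t within {t..})"
    using rcont[OF assms(1,2)] by (simp add: at_within_Ici_at_right)
  then have "continuous (at t within {t..}) (\<lambda>s. X s \<omega>)" by (simp add: continuous_within)
  then show ?thesis
    using assms(3,4) unfolding continuous_within_sequentially by (auto simp: o_def)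
qed

lemma X_joint [measurable]: "(\<lambda>(t, \<omega>). X (max 0 t) \<omega>) \<in> borel_measurable (borel \<Otimes>\<^sub>M M)"
proof (rule borel_measurable_LIMSEQ_metric)
  fix m :: nat
  have [measurable]: "X (real (Suc k) / 2 ^ m) \<in> borel_measurable M" for k by (rule X_meas) simp
  have "(\<lambda>x. X (real (Suc (nat \<lfloor>max 0 (fst x :: real) * 2 ^ m\<rfloor>)) / 2 ^ m) (snd x)) \<in> borel_measurable (borel \<Otimes>\<^sub>M M)"
    by (rule measurable_compose_countable[where f="\<lambda>k x. X (real (Suc k) / 2 ^ m) (snd x)"]) measurable
  then show "(\<lambda>x. X (dyad_up m (max 0 (fst x :: real))) (snd x)) \<in> borel_measurable (borel \<Otimes>\<^sub>M M)"
    by (simp add: dyad_up_def)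
next
  fix x :: "real \<times> 'w" assume "x \<in> space (borel \<Otimes>\<^sub>M M)"
  then have "snd x \<in> space M" by (auto simp: space_pair_measure)
  then show "(\<lambda>m. X (dyad_up m (max 0 (fst x))) (snd x)) \<longlonglongrightarrow> (case x of (t, \<omega>) \<Rightarrow> X (max 0 t) \<omega>)"
    by (auto simp: case_prod_beta intro!: X_rcont_seq dyad_up_tendsto less_imp_le[OF dyad_up_gt])
qed

lemma X_joint': "f \<in> borel_measurable N \<Longrightarrow> g \<in> N \<rightarrow>\<^sub>M M \<Longrightarrow> (\<And>x. x \<in> space N \<Longrightarrow> 0 \<le> f x) \<Longrightarrow>
  (\<lambda>x. X (f x) (g x)) \<in> borel_measurable N"
proof -
  assume [measurable]: "f \<in> borel_measurable N" "g \<in> N \<rightarrow>\<^sub>M M" and nn: "\<And>x. x \<in> space N \<Longrightarrow> 0 \<le> f x"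
  have "(\<lambda>x. (\<lambda>(t, \<omega>). X (max 0 t) \<omega>) (f x, g x)) \<in> borel_measurable N" by measurable
  then show ?thesis by (rule measurable_cong[THEN iffD1, rotated]) (simp add: nn max_def)
qed

text \<open>Right-continuity at \<open>0\<close> and dominated convergence.\<close>

lemma stochastic_continuity:
  assumes "h \<longlonglongrightarrow> 0" "\<And>n::nat. 0 \<le> h n" "0 \<le> L"
  shows "(\<lambda>n. expectation (\<lambda>\<omega>. min 1 (L * norm (X (h n) \<omega>)))) \<longlonglongrightarrow> 0"
proof -
  have [measurable]: "X (h n) \<in> borel_measurable M" for n by (rule X_meas) (rule assms)
  have "(\<lambda>n. expectation (\<lambda>\<omega>. min 1 (L * norm (X (h n) \<omega>)))) \<longlonglongrightarrow> expectation (\<lambda>\<omega>. 0)"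
  proof (rule integral_dominated_convergence[where w="\<lambda>_. 1"])
    show "AE \<omega> in M. (\<lambda>n. min 1 (L * norm (X (h n) \<omega>))) \<longlonglongrightarrow> 0"
    proof (rule AE_I2)
      fix \<omega> assume \<omega>: "\<omega> \<in> space M"
      have "(\<lambda>n. X (h n) \<omega>) \<longlonglongrightarrow> X 0 \<omega>" by (rule X_rcont_seq[OF \<omega>]) (use assms in auto)
      then have "(\<lambda>n. min 1 (L * norm (X (h n) \<omega>))) \<longlonglongrightarrow> min 1 (L * norm (X 0 \<omega>))" by (intro tendsto_intros)
      then show "(\<lambda>n. min 1 (L * norm (X (h n) \<omega>))) \<longlonglongrightarrow> 0" using \<omega> by (simp add: X_zero)
    qed
    show "AE \<omega> in M. norm (min 1 (L * norm (X (h n) \<omega>))) \<le> 1" for n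
      using assms(3) by (auto simp: min_def)
  qed auto
  then show ?thesis by simp
qed

lemma prob_X_small_time:
  assumes "h \<longlonglongrightarrow> 0" "\<And>n::nat. 0 \<le> h n" "0 < \<epsilon>"
  shows "(\<lambda>n. emeasure M {\<omega>\<in>space M. \<epsilon> < norm (X (h n) \<omega>)}) \<longlonglongrightarrow> 0"
proof -
  have [measurable]: "X (h n) \<in> borel_measurable M" for n by (rule X_meas) (rule assms)
  have le: "emeasure M {\<omega>\<in>space M. \<epsilon> < norm (X (h n) \<omega>)} \<le> ennreal (expectation (\<lambda>\<omega>. min 1 ((1/\<epsilon>) * norm (X (h n) \<omega>))))" for n
  proof -
    have "emeasure M {\<omega>\<in>space M. \<epsilon> < norm (X (h n) \<omega>)} = (\<integral>\<^sup>+\<omega>. indicator {\<omega>\<in>space M. \<epsilon> < norm (X (h n) \<omega>)} \<omega> \<partial>M)" by simp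
    also have "\<dots> \<le> (\<integral>\<^sup>+\<omega>. ennreal (min 1 ((1/\<epsilon>) * norm (X (h n) \<omega>))) \<partial>M)"
      using assms(3) by (intro nn_integral_mono) (auto simp: indicator_def min_def field_simps)
    also have "\<dots> = ennreal (expectation (\<lambda>\<omega>. min 1 ((1/\<epsilon>) * norm (X (h n) \<omega>))))"
      using assms(3) by (intro nn_integral_eq_integral integrable_const_bound[where B=1]) (auto simp: min_def)
    finally show ?thesis .
  qed
  have "(\<lambda>n. ennreal (expectation (\<lambda>\<omega>. min 1 ((1/\<epsilon>) * norm (X (h n) \<omega>))))) \<longlonglongrightarrow> ennreal 0"
    by (intro tendsto_ennrealI stochastic_continuity assms(1,2)) (use assms(3) in auto)
  then have "(\<lambda>n. ennreal (expectation (\<lambda>\<omega>. min 1 ((1/\<epsilon>) * norm (X (h n) \<omega>))))) \<longlonglongrightarrow> 0" by simp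
  from tendsto_sandwich[OF _ _ tendsto_const[of 0] this, of "\<lambda>n. emeasure M {\<omega>\<in>space M. \<epsilon> < norm (X (h n) \<omega>)}"]
  show ?thesis using le by simp
qed

text \<open>Strict inequalities suit hitting times of open sets, which are determined by the rational times, and
  limits of such hitting times.\<close>

definition optional_time :: "('w \<Rightarrow> ennreal) \<Rightarrow> bool" where
  "optional_time T \<longleftrightarrow> (\<forall>u>0. {\<omega>\<in>space M. T \<omega> < ennreal u} \<in> sets (past u))"

lemma optional_time_measurable:
  assumes "optional_time T" shows "T \<in> borel_measurable M"
proof (rule borel_measurableI_less)
  fix y :: ennreal
  have 1: "{\<omega>\<in>space M. T \<omega> < ennreal u} \<in> sets M" if "u > 0" for u
    using assms that sets_past_subset[of u] unfolding optional_time_def by blast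
  have "{\<omega>\<in>space M. T \<omega> < y} = (\<Union>u\<in>{u\<in>\<rat>. 0 < u \<and> ennreal u \<le> y}. {\<omega>\<in>space M. T \<omega> < ennreal u})"
  proof (intro equalityI subsetI)
    fix \<omega> assume "\<omega> \<in> {\<omega>\<in>space M. T \<omega> < y}"
    then have \<omega>: "\<omega> \<in> space M" "T \<omega> < y" by auto
    then obtain r where r: "T \<omega> < ennreal (real_of_rat r)" "ennreal (real_of_rat r) < y" "0 \<le> real_of_rat r"
      using ennreal_rat_dense[OF \<omega>(2)] ennreal_neg not_less by (metis linear less_le_trans not_less_zero zero_le)
    then have "0 < real_of_rat r" by (metis ennreal_0 less_eq_real_def not_less_zero)
    with r \<omega> show "\<omega> \<in> (\<Union>u\<in>{u\<in>\<rat>. 0 < u \<and> ennreal u \<le> y}. {\<omega>\<in>space M. T \<omega> < ennreal u})"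
      by (intro UN_I[of "real_of_rat r"]) auto
  qed auto
  also have "\<dots> \<in> sets M"
    by (intro sets.countable_UN'') (use 1 countable_rat in \<open>auto intro: countable_subset\<close>)
  finally show "{\<omega>\<in>space M. T \<omega> < y} \<in> sets M" .
qed

text \<open>On the event that the dyadic time takes a given value, which belongs to the past at that value, the
  Markov property at a fixed time applies. The delay \<open>h\<close> may depend on the dyadic time, so that
  \<open>h s = t - s\<close> observes the process at the fixed time \<open>t\<close>.\<close>

lemma dyadic_strong_markov:
  fixes m :: nat
  assumes T: "optional_time T" and h: "\<And>s. 0 \<le> h s"
    and \<Phi>: "\<And>s. (\<lambda>(a, b). \<Phi> s a b) \<in> borel_measurable (borel \<Otimes>\<^sub>M borel)"
  defines "\<tau> \<equiv> \<lambda>\<omega>. dyad_up m (enn2real (T \<omega>))"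
  shows "(\<integral>\<^sup>+\<omega>. (if T \<omega> < \<infinity> then \<Phi> (\<tau> \<omega>) (X (\<tau> \<omega>) \<omega>) (X (\<tau> \<omega> + h (\<tau> \<omega>)) \<omega> - X (\<tau> \<omega>) \<omega>) else 0) \<partial>M)
    = (\<integral>\<^sup>+\<omega>. (if T \<omega> < \<infinity> then (\<integral>\<^sup>+\<omega>'. \<Phi> (\<tau> \<omega>) (X (\<tau> \<omega>) \<omega>) (X (h (\<tau> \<omega>)) \<omega>') \<partial>M) else 0) \<partial>M)"
proof -
  define u where "u k = real (Suc k) / 2 ^ m" for k
  define A where "A k = {\<omega>\<in>space M. T \<omega> < \<infinity> \<and> nat \<lfloor>enn2real (T \<omega>) * 2 ^ m\<rfloor> = k}" for k
  have u0: "0 < u k" for k by (simp add: u_def)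
  have \<tau>A: "\<tau> \<omega> = u k" if "\<omega> \<in> A k" for \<omega> k using that unfolding A_def \<tau>_def u_def dyad_up_def by blast
  note [measurable] = optional_time_measurable[OF T] \<Phi>
  have Xm[measurable]: "X (u k) \<in> borel_measurable M" "X (u k + h (u k)) \<in> borel_measurable M" "X (h (u k)) \<in> borel_measurable M" for k
    using u0[of k] h[of "u k"] by (auto intro!: X_meas)
  have A_past: "A k \<in> sets (past (u k))" for k
  proof -
    have "A k = {\<omega>\<in>space M. T \<omega> < ennreal (u k)} - {\<omega>\<in>space M. T \<omega> < ennreal (real k / 2 ^ m)}"
    proof (intro set_eqI)
      fix \<omega>
      show "\<omega> \<in> A k \<longleftrightarrow> \<omega> \<in> {\<omega>\<in>space M. T \<omega> < ennreal (u k)} - {\<omega>\<in>space M. T \<omega> < ennreal (real k / 2 ^ m)}"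
      proof (cases "T \<omega>")
        case (real r)
        have "nat \<lfloor>r * 2 ^ m\<rfloor> = k \<longleftrightarrow> real k \<le> r * 2 ^ m \<and> r * 2 ^ m < real k + 1"
          using real(1) by (auto simp: nat_eq_iff floor_eq_iff)
        moreover have "T \<omega> < ennreal (u k) \<longleftrightarrow> r * 2 ^ m < real k + 1"
          using real by (simp add: ennreal_less_iff u_def field_simps)
        moreover have "T \<omega> < ennreal (real k / 2 ^ m) \<longleftrightarrow> r * 2 ^ m < real k"
          using real by (simp add: ennreal_less_iff field_simps)
        ultimately show ?thesis using real by (auto simp: A_def)
      next
        case top
        then show ?thesis by (auto simp: A_def)
      qed
    qed
    moreover have "{\<omega>\<in>space M. T \<omega> < ennreal (u k)} \<in> sets (past (u k))"
      using T u0 by (simp add: optional_time_def)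
    moreover have "{\<omega>\<in>space M. T \<omega> < ennreal (real k / 2 ^ m)} \<in> sets (past (u k))"
    proof (cases "k = 0")
      case False
      then have "{\<omega>\<in>space M. T \<omega> < ennreal (real k / 2 ^ m)} \<in> sets (past (real k / 2 ^ m))"
        using T by (simp add: optional_time_def)
      moreover have "sets (past (real k / 2 ^ m)) \<subseteq> sets (past (u k))"
        by (rule past_mono) (simp add: u_def divide_right_mono)
      ultimately show ?thesis by blast
    qed simp
    ultimately show ?thesis by auto
  qed
  have AM[measurable]: "A k \<in> sets M" for k using A_past sets_past_subset by blast
  have split: "(if T \<omega> < \<infinity> then F \<omega> else 0) = (\<Sum>k. indicator (A k) \<omega> * F \<omega>)" if "\<omega> \<in> space M" for \<omega> and F :: "'w \<Rightarrow> ennreal"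
  proof (cases "T \<omega> < \<infinity>")
    case True
    define k0 where "k0 = nat \<lfloor>enn2real (T \<omega>) * 2 ^ m\<rfloor>"
    have in_iff: "\<omega> \<in> A k \<longleftrightarrow> k = k0" for k using True that unfolding A_def k0_def by blast
    have "(\<Sum>k. indicator (A k) \<omega> * F \<omega>) = (\<Sum>k\<in>{k0}. indicator (A k) \<omega> * F \<omega>)"
      by (rule suminf_finite) (simp_all add: in_iff)
    then show ?thesis using True by (simp add: in_iff)
  next
    case False
    then have "\<omega> \<notin> A k" for k unfolding A_def by blast
    then show ?thesis using False by simp
  qed
  have each: "(\<integral>\<^sup>+\<omega>. indicator (A k) \<omega> * \<Phi> (u k) (X (u k) \<omega>) (X (u k + h (u k)) \<omega> - X (u k) \<omega>) \<partial>M)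
    = (\<integral>\<^sup>+\<omega>. indicator (A k) \<omega> * (\<integral>\<^sup>+\<omega>'. \<Phi> (u k) (X (u k) \<omega>) (X (h (u k)) \<omega>') \<partial>M) \<partial>M)" for k
  proof -
    let ?\<Psi> = "\<lambda>(\<omega>, z). indicator (A k) \<omega> * \<Phi> (u k) (X (u k) \<omega>) z"
    have [measurable]: "A k \<in> sets (past (u k))" by (rule A_past)
    have [measurable]: "X (u k) \<in> borel_measurable (past (u k))" by (rule X_past) (use u0[of k] in auto)
    have "?\<Psi> \<in> borel_measurable (past (u k) \<Otimes>\<^sub>M borel)" by measurable
    from freeze_past[OF less_imp_le[OF u0] h this]
    have "(\<integral>\<^sup>+\<omega>. indicator (A k) \<omega> * \<Phi> (u k) (X (u k) \<omega>) (X (u k + h (u k)) \<omega> - X (u k) \<omega>) \<partial>M)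
      = (\<integral>\<^sup>+\<omega>. (\<integral>\<^sup>+\<omega>'. indicator (A k) \<omega> * \<Phi> (u k) (X (u k) \<omega>) (X (h (u k)) \<omega>') \<partial>M) \<partial>M)"
      by (simp only: prod.case)
    also have "\<dots> = (\<integral>\<^sup>+\<omega>. indicator (A k) \<omega> * (\<integral>\<^sup>+\<omega>'. \<Phi> (u k) (X (u k) \<omega>) (X (h (u k)) \<omega>') \<partial>M) \<partial>M)"
      by (intro nn_integral_cong nn_integral_cmult) measurable
    finally show ?thesis .
  qed
  have "(\<integral>\<^sup>+\<omega>. (if T \<omega> < \<infinity> then \<Phi> (\<tau> \<omega>) (X (\<tau> \<omega>) \<omega>) (X (\<tau> \<omega> + h (\<tau> \<omega>)) \<omega> - X (\<tau> \<omega>) \<omega>) else 0) \<partial>M)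
     = (\<integral>\<^sup>+\<omega>. (\<Sum>k. indicator (A k) \<omega> * \<Phi> (u k) (X (u k) \<omega>) (X (u k + h (u k)) \<omega> - X (u k) \<omega>)) \<partial>M)"
  proof (rule nn_integral_cong)
    fix \<omega> assume "\<omega> \<in> space M"
    then show "(if T \<omega> < \<infinity> then \<Phi> (\<tau> \<omega>) (X (\<tau> \<omega>) \<omega>) (X (\<tau> \<omega> + h (\<tau> \<omega>)) \<omega> - X (\<tau> \<omega>) \<omega>) else 0)
      = (\<Sum>k. indicator (A k) \<omega> * \<Phi> (u k) (X (u k) \<omega>) (X (u k + h (u k)) \<omega> - X (u k) \<omega>))"
      by (subst split, assumption, intro arg_cong[of _ _ suminf] ext) (simp add: indicator_def \<tau>A)
  qed
  also have "\<dots> = (\<Sum>k. \<integral>\<^sup>+\<omega>. indicator (A k) \<omega> * \<Phi> (u k) (X (u k) \<omega>) (X (u k + h (u k)) \<omega> - X (u k) \<omega>) \<partial>M)"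
    by (rule nn_integral_suminf) measurable
  also have "\<dots> = (\<Sum>k. \<integral>\<^sup>+\<omega>. indicator (A k) \<omega> * (\<integral>\<^sup>+\<omega>'. \<Phi> (u k) (X (u k) \<omega>) (X (h (u k)) \<omega>') \<partial>M) \<partial>M)"
    by (simp only: each)
  also have "\<dots> = (\<integral>\<^sup>+\<omega>. (\<Sum>k. indicator (A k) \<omega> * (\<integral>\<^sup>+\<omega>'. \<Phi> (u k) (X (u k) \<omega>) (X (h (u k)) \<omega>') \<partial>M)) \<partial>M)"
    by (rule nn_integral_suminf[symmetric]) measurable
  also have "\<dots> = (\<integral>\<^sup>+\<omega>. (if T \<omega> < \<infinity> then (\<integral>\<^sup>+\<omega>'. \<Phi> (\<tau> \<omega>) (X (\<tau> \<omega>) \<omega>) (X (h (\<tau> \<omega>)) \<omega>') \<partial>M) else 0) \<partial>M)"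
  proof (rule nn_integral_cong)
    fix \<omega> assume "\<omega> \<in> space M"
    then show "(\<Sum>k. indicator (A k) \<omega> * (\<integral>\<^sup>+\<omega>'. \<Phi> (u k) (X (u k) \<omega>) (X (h (u k)) \<omega>') \<partial>M))
      = (if T \<omega> < \<infinity> then (\<integral>\<^sup>+\<omega>'. \<Phi> (\<tau> \<omega>) (X (\<tau> \<omega>) \<omega>) (X (h (\<tau> \<omega>)) \<omega>') \<partial>M) else 0)"
      by (subst split, assumption, intro arg_cong[of _ _ suminf] ext) (simp add: indicator_def \<tau>A)
  qed
  finally show ?thesis .
qed

text \<open>Exact equality in law holds at the dyadic times just after \<open>T\<close>; right-continuity and Fatou's lemma, applied
  to the open condition \<open>\<epsilon> < norm\<close>, give the inequality in the limit.\<close>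

lemma increment_after_optional:
  assumes T: "optional_time T" and h: "0 \<le> h"
  shows "emeasure M {\<omega>\<in>space M. T \<omega> < \<infinity> \<and> \<epsilon> < norm (X (enn2real (T \<omega>) + h) \<omega> - X (enn2real (T \<omega>)) \<omega>)}
    \<le> emeasure M {\<omega>\<in>space M. \<epsilon> < norm (X h \<omega>)}"
proof -
  note [measurable] = optional_time_measurable[OF T]
  have [measurable]: "X h \<in> borel_measurable M" using h by (rule X_meas)
  define \<tau> where "\<tau> m \<omega> = dyad_up m (enn2real (T \<omega>))" for m \<omega>
  define I where "I m \<omega> = (if T \<omega> < \<infinity> then indicator {z. \<epsilon> < norm z} (X (\<tau> m \<omega> + h) \<omega> - X (\<tau> m \<omega>) \<omega>) else 0 :: ennreal)" for m \<omega>
  have \<tau>0: "0 \<le> \<tau> m \<omega>" for m \<omega>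
    unfolding \<tau>_def by (rule order_trans[OF enn2real_nonneg less_imp_le[OF dyad_up_gt[OF enn2real_nonneg]]])
  have [measurable]: "\<tau> m \<in> borel_measurable M" for m unfolding \<tau>_def by measurable
  have [measurable]: "(\<lambda>\<omega>. X (\<tau> m \<omega> + h) \<omega>) \<in> borel_measurable M" "(\<lambda>\<omega>. X (\<tau> m \<omega>) \<omega>) \<in> borel_measurable M" for m
    using \<tau>0 h by (auto intro!: X_joint')
  have [measurable]: "(\<lambda>\<omega>. X (enn2real (T \<omega>) + h) \<omega>) \<in> borel_measurable M" "(\<lambda>\<omega>. X (enn2real (T \<omega>)) \<omega>) \<in> borel_measurable M"
    using h by (auto intro!: X_joint')
  have Im[measurable]: "I m \<in> borel_measurable M" for m
    unfolding I_def by measurable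
  have bd: "(\<integral>\<^sup>+\<omega>. I m \<omega> \<partial>M) \<le> emeasure M {\<omega>\<in>space M. \<epsilon> < norm (X h \<omega>)}" for m
  proof -
    have "(\<integral>\<^sup>+\<omega>. I m \<omega> \<partial>M) = (\<integral>\<^sup>+\<omega>. (if T \<omega> < \<infinity> then (\<integral>\<^sup>+\<omega>'. indicator {z. \<epsilon> < norm z} (X h \<omega>') \<partial>M) else 0) \<partial>M)"
      unfolding I_def \<tau>_def
      by (rule dyadic_strong_markov[OF T, where h="\<lambda>_. h" and \<Phi>="\<lambda>_ _ z. indicator {z. \<epsilon> < norm z} z"]) (use h in auto)
    also have "(\<integral>\<^sup>+\<omega>'. indicator {z. \<epsilon> < norm z} (X h \<omega>') \<partial>M) = emeasure M {\<omega>\<in>space M. \<epsilon> < norm (X h \<omega>)}"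
    proof -
      have "(\<integral>\<^sup>+\<omega>'. indicator {z. \<epsilon> < norm z} (X h \<omega>') \<partial>M) = (\<integral>\<^sup>+\<omega>'. indicator {\<omega>\<in>space M. \<epsilon> < norm (X h \<omega>)} \<omega>' \<partial>M)"
        by (rule nn_integral_cong) (auto simp: indicator_def)
      then show ?thesis by simp
    qed
    also have "(\<integral>\<^sup>+\<omega>. (if T \<omega> < \<infinity> then emeasure M {\<omega>\<in>space M. \<epsilon> < norm (X h \<omega>)} else 0) \<partial>M)
      \<le> (\<integral>\<^sup>+\<omega>. emeasure M {\<omega>\<in>space M. \<epsilon> < norm (X h \<omega>)} \<partial>M)" by (rule nn_integral_mono) auto
    also have "\<dots> = emeasure M {\<omega>\<in>space M. \<epsilon> < norm (X h \<omega>)}" by (simp add: emeasure_space_1)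
    finally show ?thesis .
  qed
  have "emeasure M {\<omega>\<in>space M. T \<omega> < \<infinity> \<and> \<epsilon> < norm (X (enn2real (T \<omega>) + h) \<omega> - X (enn2real (T \<omega>)) \<omega>)}
    = (\<integral>\<^sup>+\<omega>. indicator {\<omega>\<in>space M. T \<omega> < \<infinity> \<and> \<epsilon> < norm (X (enn2real (T \<omega>) + h) \<omega> - X (enn2real (T \<omega>)) \<omega>)} \<omega> \<partial>M)"
    by simp
  also have "\<dots> \<le> (\<integral>\<^sup>+\<omega>. liminf (\<lambda>m. I m \<omega>) \<partial>M)"
  proof (rule nn_integral_mono)
    fix \<omega> assume \<omega>: "\<omega> \<in> space M"
    let ?s = "enn2real (T \<omega>)"
    show "indicator {\<omega>\<in>space M. T \<omega> < \<infinity> \<and> \<epsilon> < norm (X (enn2real (T \<omega>) + h) \<omega> - X (enn2real (T \<omega>)) \<omega>)} \<omega> \<le> liminf (\<lambda>m. I m \<omega>)"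
    proof (cases "T \<omega> < \<infinity> \<and> \<epsilon> < norm (X (?s + h) \<omega> - X ?s \<omega>)")
      case True
      have t: "(\<lambda>m. \<tau> m \<omega>) \<longlonglongrightarrow> ?s" unfolding \<tau>_def by (rule dyad_up_tendsto) simp
      have gt: "?s \<le> \<tau> m \<omega>" for m unfolding \<tau>_def by (rule less_imp_le[OF dyad_up_gt]) simp
      have "(\<lambda>m. norm (X (\<tau> m \<omega> + h) \<omega> - X (\<tau> m \<omega>) \<omega>)) \<longlonglongrightarrow> norm (X (?s + h) \<omega> - X ?s \<omega>)"
        by (intro tendsto_intros X_rcont_seq \<omega> t) (use gt h in auto)
      then have "\<forall>\<^sub>F m in sequentially. \<epsilon> < norm (X (\<tau> m \<omega> + h) \<omega> - X (\<tau> m \<omega>) \<omega>)"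
        using True by (intro order_tendstoD(1)) auto
      then have "\<forall>\<^sub>F m in sequentially. 1 \<le> I m \<omega>"
        by eventually_elim (use True in \<open>auto simp: I_def\<close>)
      then have "1 \<le> liminf (\<lambda>m. I m \<omega>)" by (rule Liminf_bounded)
      then show ?thesis by (auto simp: indicator_def)
    qed simp
  qed
  also have "\<dots> \<le> liminf (\<lambda>m. \<integral>\<^sup>+\<omega>. I m \<omega> \<partial>M)" by (rule nn_integral_liminf) (rule Im)
  also have "\<dots> \<le> liminf (\<lambda>m::nat. emeasure M {\<omega>\<in>space M. \<epsilon> < norm (X h \<omega>)})"
    by (rule Liminf_mono) (simp add: bd)
  also have "\<dots> = emeasure M {\<omega>\<in>space M. \<epsilon> < norm (X h \<omega>)}" by (simp add: Liminf_const)
  finally show ?thesis .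
qed

end

section \<open>The exit time\<close>

lemma infdist_triangle_norm: "infdist a S \<le> infdist b S + norm (a - b)" for a b :: "'a::real_normed_vector"
  using infdist_triangle[of a S b] by (simp add: dist_norm)

locale levy_exit = rc_levy M X for M :: "'w measure" and X :: "real \<Rightarrow> 'w \<Rightarrow> 'a::euclidean_space" +
  fixes D :: "'a set"
  assumes open_D: "open D" and complement_nonempty: "- D \<noteq> {}"
begin

text \<open>Neighbourhoods of the complement that shrink to it.\<close>

definition near :: "nat \<Rightarrow> 'a set" where
  "near n = {y. infdist y (- D) < 1 / real (Suc n)}"

definition reach :: "nat \<Rightarrow> 'a \<Rightarrow> 'w \<Rightarrow> ennreal" where
  "reach n x \<omega> = (INF q\<in>\<rat> \<inter> {0<..}. if x + X q \<omega> \<in> near n then ennreal q else \<infinity>)"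

text \<open>Each \<open>reach n\<close> is an infimum over rational times and hence measurable. The supremum is the time at which
  the left limit or the value of the path first touches the complement of \<open>D\<close>; it announces the exit
  unless the path approaches the complement and jumps away at that very moment.\<close>

definition exit_limit :: "'a \<Rightarrow> 'w \<Rightarrow> ennreal" where
  "exit_limit x \<omega> = (SUP n. reach n x \<omega>)"

lemma open_near: "open (near n)"
  unfolding near_def by (intro open_Collect_less continuous_intros)

lemma near_borel [measurable]: "near n \<in> sets borel"
  using open_near by simp

lemma near_mono: "m \<le> n \<Longrightarrow> near n \<subseteq> near m"
proof -
  assume "m \<le> n"
  then have "1 / real (Suc n) \<le> 1 / real (Suc m)" by (intro frac_le) auto
  then show ?thesis unfolding near_def by auto
qed

lemma outside_near: "y \<notin> D \<Longrightarrow> y \<in> near n"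
  by (simp add: near_def)

lemma infdist_pos: "y \<in> D \<Longrightarrow> 0 < infdist y (- D)"
  using in_closed_iff_infdist_zero[of "- D" y] open_D complement_nonempty infdist_nonneg[of y "- D"]
  by (auto simp: closed_Compl less_eq_real_def)

lemma reach_less_iff: "reach n x \<omega> < ennreal u \<longleftrightarrow> (\<exists>q\<in>\<rat>. 0 < q \<and> q < u \<and> x + X q \<omega> \<in> near n)"
  unfolding reach_def INF_less_iff by (auto simp: ennreal_less_iff split: if_splits)

lemma reach_mono: "m \<le> n \<Longrightarrow> reach m x \<omega> \<le> reach n x \<omega>"
  unfolding reach_def by (intro INF_mono) (use near_mono[of m n] in auto)

lemma reach_le_exit_limit: "reach n x \<omega> \<le> exit_limit x \<omega>"
  unfolding exit_limit_def by (rule SUP_upper) simp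

lemma optional_reach: "optional_time (reach n x)"
  unfolding optional_time_def
proof (intro allI impI)
  fix u :: real assume u: "0 < u"
  have "{\<omega>\<in>space M. reach n x \<omega> < ennreal u} = (\<Union>q\<in>{q\<in>\<rat>. 0 < q \<and> q < u}. {\<omega>\<in>space (past u). x + X q \<omega> \<in> near n})"
    by (auto simp: reach_less_iff)
  also have "\<dots> \<in> sets (past u)"
  proof (rule sets.countable_UN'')
    show "countable {q\<in>\<rat>. 0 < q \<and> q < u}" using countable_rat by (auto intro: countable_subset)
    fix q assume "q \<in> {q\<in>\<rat>. 0 < q \<and> q < u}"
    then have [measurable]: "X q \<in> borel_measurable (past u)" by (intro X_past) auto
    show "{\<omega>\<in>space (past u). x + X q \<omega> \<in> near n} \<in> sets (past u)" by measurable
  qed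
  finally show "{\<omega>\<in>space M. reach n x \<omega> < ennreal u} \<in> sets (past u)" .
qed

lemma exit_limit_less_iff: "exit_limit x \<omega> < ennreal u \<longleftrightarrow> (\<exists>q\<in>\<rat>. 0 < q \<and> q < u \<and> (\<forall>n. reach n x \<omega> < ennreal q))"
proof
  assume "exit_limit x \<omega> < ennreal u"
  then obtain r where r: "exit_limit x \<omega> = ennreal r" "0 \<le> r" "r < u"
    by (cases "exit_limit x \<omega>") (auto simp: ennreal_less_iff)
  then obtain q where q: "q \<in> \<rat>" "r < q" "q < u" using Rats_dense_in_real by blast
  then show "\<exists>q\<in>\<rat>. 0 < q \<and> q < u \<and> (\<forall>n. reach n x \<omega> < ennreal q)"
    using r by (intro bexI[of _ q]) (auto intro!: le_less_trans[OF reach_le_exit_limit] simp: ennreal_less_iff)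
next
  assume "\<exists>q\<in>\<rat>. 0 < q \<and> q < u \<and> (\<forall>n. reach n x \<omega> < ennreal q)"
  then obtain q where q: "0 < q" "q < u" "\<And>n. reach n x \<omega> < ennreal q" by blast
  have "exit_limit x \<omega> \<le> ennreal q" unfolding exit_limit_def using q(3) by (intro SUP_least) (auto intro: less_imp_le)
  also have "\<dots> < ennreal u" using q by (simp add: ennreal_less_iff)
  finally show "exit_limit x \<omega> < ennreal u" .
qed

lemma optional_exit_limit: "optional_time (exit_limit x)"
  unfolding optional_time_def
proof (intro allI impI)
  fix u :: real assume u: "0 < u"
  have "{\<omega>\<in>space M. exit_limit x \<omega> < ennreal u} = (\<Union>q\<in>{q\<in>\<rat>. 0 < q \<and> q < u}. (\<Inter>n. {\<omega>\<in>space M. reach n x \<omega> < ennreal q}))"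
    by (auto simp: exit_limit_less_iff)
  also have "\<dots> \<in> sets (past u)"
  proof (rule sets.countable_UN'')
    show "countable {q\<in>\<rat>. 0 < q \<and> q < u}" using countable_rat by (auto intro: countable_subset)
    fix q assume "q \<in> {q\<in>\<rat>. 0 < q \<and> q < u}"
    then have "{\<omega>\<in>space M. reach n x \<omega> < ennreal q} \<in> sets (past u)" for n
      using optional_reach[of n x] past_mono[of q u] unfolding optional_time_def by auto
    then show "(\<Inter>n. {\<omega>\<in>space M. reach n x \<omega> < ennreal q}) \<in> sets (past u)" by auto
  qed
  finally show "{\<omega>\<in>space M. exit_limit x \<omega> < ennreal u} \<in> sets (past u)" .
qed

lemma exit_limit_joint [measurable]: "(\<lambda>(x, \<omega>). exit_limit x \<omega>) \<in> borel_measurable (borel \<Otimes>\<^sub>M M)"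
proof -
  have "(\<lambda>z. SUP n. INF q\<in>\<rat> \<inter> {0<..}. if fst z + X q (snd z) \<in> near n then ennreal q else \<infinity>) \<in> borel_measurable (borel \<Otimes>\<^sub>M M)"
  proof (intro borel_measurable_SUP borel_measurable_INF)
    show "countable (\<rat> \<inter> {0<..} :: real set)" using countable_rat by (auto intro: countable_subset)
    fix q :: real assume "q \<in> \<rat> \<inter> {0<..}"
    then have [measurable]: "X q \<in> borel_measurable M" by (intro X_meas) auto
    show "(\<lambda>z. if fst z + X q (snd z) \<in> near n then ennreal q else \<infinity>) \<in> borel_measurable (borel \<Otimes>\<^sub>M M)" for n
      by measurable
  qed auto
  then show ?thesis by (simp add: exit_limit_def reach_def case_prod_beta)
qed

lemma exit_limit_le_exit_time:
  assumes \<omega>: "\<omega> \<in> space M"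
  shows "exit_limit x \<omega> \<le> exit_time D X x \<omega>"
  unfolding exit_time_def
proof (rule Inf_greatest, safe)
  fix t assume t: "0 < t" "x + X t \<omega> \<notin> D"
  show "exit_limit x \<omega> \<le> ennreal t" unfolding exit_limit_def
  proof (rule SUP_least, rule ccontr)
    fix n assume "\<not> reach n x \<omega> \<le> ennreal t"
    then have "ennreal t < reach n x \<omega>" by simp
    then obtain r where r: "ennreal t < r" "r < reach n x \<omega>" using dense by blast
    then obtain r' where r': "r = ennreal r'" "t < r'"
      using t by (cases r) (auto simp: ennreal_less_iff)
    have "((\<lambda>s. x + X s \<omega>) \<longlongrightarrow> x + X t \<omega>) (at_right t)" using t by (intro tendsto_intros rcont \<omega>) auto
    then have "\<forall>\<^sub>F s in at_right t. x + X s \<omega> \<in> near n"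
      by (rule topological_tendstoD) (use open_near outside_near[OF t(2)] in auto)
    then obtain b where b: "b > t" "\<And>s. t < s \<Longrightarrow> s < b \<Longrightarrow> x + X s \<omega> \<in> near n"
      unfolding eventually_at_right_field by auto
    obtain q where q: "q \<in> \<rat>" "t < q" "q < min b r'" using Rats_dense_in_real[of t "min b r'"] b r' by auto
    then have "reach n x \<omega> < ennreal r'" unfolding reach_less_iff using t b(2)[of q] by (intro bexI[of _ q]) auto
    then show False using r r' by auto
  qed
qed

text \<open>Paths that start in \<open>D\<close> stay away from the complement for a while.\<close>

lemma exit_limit_pos:
  assumes \<omega>: "\<omega> \<in> space M" and x: "x \<in> D"
  shows "0 < exit_limit x \<omega>"
proof -
  let ?d = "infdist x (- D)"
  have d: "0 < ?d" using x by (rule infdist_pos)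
  have "((\<lambda>s. infdist (x + X s \<omega>) (- D)) \<longlongrightarrow> infdist (x + X 0 \<omega>) (- D)) (at_right 0)"
    by (intro tendsto_intros rcont \<omega>) auto
  then have "\<forall>\<^sub>F s in at_right 0. ?d / 2 < infdist (x + X s \<omega>) (- D)"
    using d by (intro order_tendstoD(1)) (auto simp: X_zero[OF \<omega>])
  then obtain b where b: "b > 0" "\<And>s. 0 < s \<Longrightarrow> s < b \<Longrightarrow> ?d / 2 < infdist (x + X s \<omega>) (- D)"
    unfolding eventually_at_right_field by auto
  obtain n :: nat where n: "2 / ?d < real n" using reals_Archimedean2 by blast
  have n': "1 / real (Suc n) \<le> ?d / 2"
  proof -
    have "2 / ?d \<le> real (Suc n)" using n by simp
    then show ?thesis using d by (simp add: field_simps)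
  qed
  have "\<not> reach n x \<omega> < ennreal b"
    unfolding reach_less_iff near_def using b n' by force
  then have "ennreal b \<le> exit_limit x \<omega>" using reach_le_exit_limit[of n x \<omega>] by (auto simp: not_less intro: order_trans)
  then show ?thesis using b(1) by (metis ennreal_less_zero_iff less_le_trans)
qed

lemma reach_position:
  assumes \<omega>: "\<omega> \<in> space M" and fin: "reach n x \<omega> < \<infinity>"
  shows "infdist (x + X (enn2real (reach n x \<omega>)) \<omega>) (- D) \<le> 1 / real (Suc n)"
proof -
  obtain r where r: "reach n x \<omega> = ennreal r" "0 \<le> r" using fin by (cases "reach n x \<omega>") auto
  have "\<exists>q. r \<le> q \<and> q < r + 1 / real (Suc k) \<and> x + X q \<omega> \<in> near n" for k
  proof -
    have "reach n x \<omega> < ennreal (r + 1 / real (Suc k))" using r by (simp add: ennreal_less_iff)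
    then obtain q where q: "q \<in> \<rat>" "0 < q" "q < r + 1 / real (Suc k)" "x + X q \<omega> \<in> near n"
      unfolding reach_less_iff by blast
    have "r \<le> q"
    proof (rule ccontr)
      assume "\<not> r \<le> q"
      then obtain q' where "q < q'" "q' < r" using dense[of q r] by auto
      then have "reach n x \<omega> < ennreal q'" unfolding reach_less_iff using q by blast
      then show False using \<open>q' < r\<close> r by (simp add: ennreal_less_iff)
    qed
    then show ?thesis using q by blast
  qed
  then obtain q where q: "\<And>k. r \<le> q k" "\<And>k. q k < r + 1 / real (Suc k)" "\<And>k. x + X (q k) \<omega> \<in> near n" by metis
  have "q \<longlonglongrightarrow> r"
  proof (rule tendsto_sandwich[OF _ _ tendsto_const])
    show "(\<lambda>k. r + 1 / real (Suc k)) \<longlonglongrightarrow> r"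
      using tendsto_add[OF tendsto_const LIMSEQ_inverse_real_of_nat, of r] by (simp add: inverse_eq_divide)
    show "\<forall>\<^sub>F k in sequentially. r \<le> q k" using q(1) by simp
    show "\<forall>\<^sub>F k in sequentially. q k \<le> r + 1 / real (Suc k)"
      by (intro always_eventually allI less_imp_le q(2))
  qed
  then have "(\<lambda>k. infdist (x + X (q k) \<omega>) (- D)) \<longlonglongrightarrow> infdist (x + X r \<omega>) (- D)"
    by (intro tendsto_intros X_rcont_seq \<omega> r q)
  then have "infdist (x + X r \<omega>) (- D) \<le> 1 / real (Suc n)"
    by (rule LIMSEQ_le_const2) (use q(3) in \<open>auto simp: near_def less_imp_le\<close>)
  then show ?thesis using r by simp
qed

text \<open>This is quasi-left-continuity. Suppose that the position at the limit time is far from the complement. Then so are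
  the positions slightly later, hence also those at \<open>reach n + h\<close> for small \<open>h\<close> and all large \<open>n\<close>, whereas the
  position at \<open>reach n\<close> is close to it: the increment over a time span \<open>h\<close> is larger than \<open>\<epsilon>\<close>. The
  probability of this is at most that of \<open>\<epsilon> < norm (X h)\<close>, uniformly in \<open>n\<close>, and tends to \<open>0\<close>
  with \<open>h\<close>. Fatou's lemma is used for \<open>n\<close> and then for \<open>h\<close>, and left limits do not enter.\<close>

lemma exit_limit_position_far_null:
  assumes "0 < \<epsilon>" and x: "x \<in> D"
  shows "emeasure M {\<omega>\<in>space M. exit_limit x \<omega> < \<infinity> \<and> 2 * \<epsilon> < infdist (x + X (enn2real (exit_limit x \<omega>)) \<omega>) (- D)} = 0" (is "emeasure M ?A = 0")
proof -
  define h where "h j = 1 / real (Suc j)" for j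
  have h: "0 < h j" for j by (simp add: h_def)
  have h0: "h \<longlonglongrightarrow> 0" using LIMSEQ_inverse_real_of_nat by (simp add: h_def[abs_def] inverse_eq_divide)
  define B where "B j n = {\<omega>\<in>space M. reach n x \<omega> < \<infinity> \<and> \<epsilon> < norm (X (enn2real (reach n x \<omega>) + h j) \<omega> - X (enn2real (reach n x \<omega>)) \<omega>)}" for j n
  note [measurable] = optional_time_measurable[OF optional_reach[of _ x]] optional_time_measurable[OF optional_exit_limit[of x]]
  have [measurable]: "(\<lambda>\<omega>. X (enn2real (exit_limit x \<omega>)) \<omega>) \<in> borel_measurable M" by (rule X_joint') auto
  have [measurable]: "(\<lambda>\<omega>. X (enn2real (reach n x \<omega>) + h j) \<omega>) \<in> borel_measurable M" "(\<lambda>\<omega>. X (enn2real (reach n x \<omega>)) \<omega>) \<in> borel_measurable M" for j n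
    using h[of j] by (auto intro!: X_joint' simp: less_imp_le)
  have [measurable]: "(\<lambda>y. infdist y (- D)) \<in> borel_measurable borel"
    by (intro borel_measurable_continuous_onI continuous_intros)
  have Bm[measurable]: "B j n \<in> sets M" for j n unfolding B_def by measurable
  have Am: "?A \<in> sets M" by measurable
  have Bb: "emeasure M (B j n) \<le> emeasure M {\<omega>\<in>space M. \<epsilon> < norm (X (h j) \<omega>)}" for j n
    unfolding B_def by (rule increment_after_optional[OF optional_reach]) (use h[of j] in simp)
  have path: "(indicator ?A \<omega> :: ennreal) \<le> liminf (\<lambda>j. liminf (\<lambda>n. indicator (B j n) \<omega>))" if \<omega>: "\<omega> \<in> space M" for \<omega>
  proof (cases "\<omega> \<in> ?A")
    case True
    then obtain T where T: "exit_limit x \<omega> = ennreal T" "0 \<le> T" by (cases "exit_limit x \<omega>") auto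
    have "((\<lambda>s. infdist (x + X s \<omega>) (- D)) \<longlongrightarrow> infdist (x + X T \<omega>) (- D)) (at_right T)"
      by (intro tendsto_intros rcont \<omega> T)
    then have "\<forall>\<^sub>F s in at_right T. 2 * \<epsilon> < infdist (x + X s \<omega>) (- D)"
      using True T by (intro order_tendstoD(1)) auto
    then obtain b where b: "b > T" "\<And>s. T < s \<Longrightarrow> s < b \<Longrightarrow> 2 * \<epsilon> < infdist (x + X s \<omega>) (- D)"
      unfolding eventually_at_right_field by auto
    have "\<forall>\<^sub>F j in sequentially. h j < b - T" using h0 b by (intro order_tendstoD(2)) auto
    then have "\<forall>\<^sub>F j in sequentially. 1 \<le> liminf (\<lambda>n. indicator (B j n) \<omega> :: ennreal)"
    proof eventually_elim
      case (elim j)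
      have "ennreal (T - h j) < exit_limit x \<omega>" using T h[of j] exit_limit_pos[OF \<omega> x]
        by (cases "0 \<le> T - h j") (auto simp: ennreal_less_iff ennreal_neg)
      then obtain N where N: "ennreal (T - h j) < reach N x \<omega>" unfolding exit_limit_def less_SUP_iff by blast
      have "\<forall>\<^sub>F n in sequentially. N \<le> n" by (rule eventually_ge_at_top)
      moreover have "\<forall>\<^sub>F n in sequentially. 1 / real (Suc n) < \<epsilon>"
        using LIMSEQ_inverse_real_of_nat assms(1) by (intro order_tendstoD(2)) (auto simp: inverse_eq_divide)
      ultimately have "\<forall>\<^sub>F n in sequentially. (1::ennreal) \<le> indicator (B j n) \<omega>"
      proof eventually_elim
        case (elim n)
        have le: "reach n x \<omega> \<le> ennreal T" using reach_le_exit_limit[of n x \<omega>] T by simp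
        then obtain r where r: "reach n x \<omega> = ennreal r" "0 \<le> r" by (cases "reach n x \<omega>") (auto simp: top_unique)
        have "r \<le> T" using le r T by simp
        have "ennreal (T - h j) < ennreal r" using N reach_mono[OF elim(1), of x \<omega>] r by simp
        then have "T - h j < r" by (metis ennreal_leI leD not_le_imp_less)
        then have "2 * \<epsilon> < infdist (x + X (r + h j) \<omega>) (- D)"
          using b(2)[of "r + h j"] \<open>r \<le> T\<close> \<open>h j < b - T\<close> by simp
        moreover have "infdist (x + X r \<omega>) (- D) < \<epsilon>"
          using reach_position[OF \<omega>, of n x] r elim(2) by simp
        moreover have "infdist (x + X (r + h j) \<omega>) (- D) \<le> infdist (x + X r \<omega>) (- D) + norm (X (r + h j) \<omega> - X r \<omega>)"
          using infdist_triangle_norm[of "x + X (r + h j) \<omega>" "- D" "x + X r \<omega>"] by simp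
        ultimately have "\<epsilon> < norm (X (r + h j) \<omega> - X r \<omega>)" by linarith
        then show ?case using \<omega> r by (simp add: B_def)
      qed
      then show ?case by (rule Liminf_bounded)
    qed
    then have "1 \<le> liminf (\<lambda>j. liminf (\<lambda>n. indicator (B j n) \<omega> :: ennreal))" by (rule Liminf_bounded)
    then show ?thesis using True by simp
  qed simp
  have "emeasure M ?A = (\<integral>\<^sup>+\<omega>. indicator ?A \<omega> \<partial>M)" using Am by simp
  also have "\<dots> \<le> (\<integral>\<^sup>+\<omega>. liminf (\<lambda>j. liminf (\<lambda>n. indicator (B j n) \<omega>)) \<partial>M)"
    by (rule nn_integral_mono) (rule path)
  also have "\<dots> \<le> liminf (\<lambda>j. \<integral>\<^sup>+\<omega>. liminf (\<lambda>n. indicator (B j n) \<omega>) \<partial>M)"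
    by (rule nn_integral_liminf) measurable
  also have "\<dots> \<le> liminf (\<lambda>j. liminf (\<lambda>n. \<integral>\<^sup>+\<omega>. indicator (B j n) \<omega> \<partial>M))"
    by (intro Liminf_mono always_eventually allI nn_integral_liminf) measurable
  also have "\<dots> \<le> liminf (\<lambda>j. liminf (\<lambda>n::nat. emeasure M {\<omega>\<in>space M. \<epsilon> < norm (X (h j) \<omega>)}))"
    by (intro Liminf_mono always_eventually allI) (simp add: Bb)
  also have "\<dots> = liminf (\<lambda>j. emeasure M {\<omega>\<in>space M. \<epsilon> < norm (X (h j) \<omega>)})" by (simp add: Liminf_const)
  also have "\<dots> = 0"
    by (rule lim_imp_Liminf) (auto intro!: prob_X_small_time h0 less_imp_le[OF h] assms(1))
  finally show ?thesis by simp
qed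

lemma exit_limit_position:
  assumes x: "x \<in> D"
  shows "AE \<omega> in M. exit_limit x \<omega> < \<infinity> \<longrightarrow> x + X (enn2real (exit_limit x \<omega>)) \<omega> \<notin> D"
proof -
  note [measurable] = optional_time_measurable[OF optional_exit_limit[of x]]
  have [measurable]: "(\<lambda>\<omega>. X (enn2real (exit_limit x \<omega>)) \<omega>) \<in> borel_measurable M" by (rule X_joint') auto
  have [measurable]: "(\<lambda>y. infdist y (- D)) \<in> borel_measurable borel"
    by (intro borel_measurable_continuous_onI continuous_intros)
  have "AE \<omega> in M. \<forall>i::nat. \<not> (exit_limit x \<omega> < \<infinity> \<and> 2 * (1 / real (Suc i)) < infdist (x + X (enn2real (exit_limit x \<omega>)) \<omega>) (- D))"
  proof (subst AE_all_countable, rule allI)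
    fix i :: nat
    show "AE \<omega> in M. \<not> (exit_limit x \<omega> < \<infinity> \<and> 2 * (1 / real (Suc i)) < infdist (x + X (enn2real (exit_limit x \<omega>)) \<omega>) (- D))"
      by (rule AE_I'[OF _ subset_refl], rule null_setsI) (use exit_limit_position_far_null[of "1 / real (Suc i)" x] x in auto)
  qed
  then show ?thesis
  proof eventually_elim
    case (elim \<omega>)
    show ?case
    proof (intro impI notI)
      assume f: "exit_limit x \<omega> < \<infinity>" and "x + X (enn2real (exit_limit x \<omega>)) \<omega> \<in> D"
      then have "0 < infdist (x + X (enn2real (exit_limit x \<omega>)) \<omega>) (- D) / 2" using infdist_pos by simp
      then obtain i where "inverse (real (Suc i)) < infdist (x + X (enn2real (exit_limit x \<omega>)) \<omega>) (- D) / 2"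
        using reals_Archimedean by blast
      then show False using elim f by (auto simp: inverse_eq_divide field_simps)
    qed
  qed
qed

theorem exit_time_eq_exit_limit:
  assumes x: "x \<in> D"
  shows "AE \<omega> in M. exit_time D X x \<omega> = exit_limit x \<omega>"
  using exit_limit_position[OF x]
proof (rule AE_mp, intro AE_I2 impI)
  fix \<omega> assume \<omega>: "\<omega> \<in> space M" and out: "exit_limit x \<omega> < \<infinity> \<longrightarrow> x + X (enn2real (exit_limit x \<omega>)) \<omega> \<notin> D"
  show "exit_time D X x \<omega> = exit_limit x \<omega>"
  proof (rule antisym[OF _ exit_limit_le_exit_time[OF \<omega>]])
    show "exit_time D X x \<omega> \<le> exit_limit x \<omega>"
    proof (cases "exit_limit x \<omega>")
      case (real r)
      then have "0 < r" using exit_limit_pos[OF \<omega> x] by simp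
      moreover have "x + X r \<omega> \<notin> D" using out real by simp
      ultimately show ?thesis unfolding exit_time_def real by (intro Inf_lower) auto
    qed simp
  qed
qed

end

section \<open>The strong Markov property in terms of transition densities\<close>

lemma nn_integral_lborel_translate:
  fixes c :: "'a::euclidean_space"
  assumes "f \<in> borel_measurable borel"
  shows "(\<integral>\<^sup>+x. f (x + c) \<partial>lborel) = (\<integral>\<^sup>+x. f x \<partial>lborel)"
proof -
  have "(\<integral>\<^sup>+x. f x \<partial>lborel) = (\<integral>\<^sup>+x. f x \<partial>distr lborel borel ((+) c))"
    by (simp add: lborel_distr_plus)
  also have "\<dots> = (\<integral>\<^sup>+x. f (x + c) \<partial>lborel)"
    using assms by (subst nn_integral_distr) (auto simp: add.commute)
  finally show ?thesis by simp
qed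

context rc_levy begin

text \<open>Reduces to an increment over the time span \<open>|s n - s0|\<close>, by stationarity, so that left and right
  limits in time are treated alike.\<close>

lemma transition_continuous:
  fixes f :: "'a \<Rightarrow> real"
  assumes f01: "\<And>z. 0 \<le> f z" "\<And>z. f z \<le> 1" and L: "0 \<le> L" "\<And>a b. \<bar>f a - f b\<bar> \<le> L * norm (a - b)"
    and s: "s \<longlonglongrightarrow> s0" "\<And>n::nat. 0 \<le> s n" "0 \<le> s0" and y: "y \<longlonglongrightarrow> y0"
  shows "(\<lambda>n. expectation (\<lambda>\<omega>. f (y n + X (s n) \<omega>))) \<longlonglongrightarrow> expectation (\<lambda>\<omega>. f (y0 + X s0 \<omega>))"
proof -
  have "continuous_on UNIV f"
  proof (rule continuous_onI)
    fix x :: 'a and e :: real assume "e > 0"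
    then show "\<exists>d>0. \<forall>x'\<in>UNIV. dist x' x < d \<longrightarrow> dist (f x') (f x) \<le> e"
      using L by (intro exI[of _ "e / (L + 1)"])
        (auto simp: dist_norm pos_less_divide_eq intro!: order_trans[OF L(2)], smt (verit) mult.commute mult_left_mono norm_ge_zero)
  qed
  then have [measurable]: "f \<in> borel_measurable borel" by (rule borel_measurable_continuous_onI)
  have [measurable]: "X (s n) \<in> borel_measurable M" "X s0 \<in> borel_measurable M" "X \<bar>s n - s0\<bar> \<in> borel_measurable M" for n
    using s by (auto intro!: X_meas)
  have fi: "integrable M (\<lambda>\<omega>. f (a + X (s n) \<omega>))" "integrable M (\<lambda>\<omega>. f (a + X s0 \<omega>))" for a n
    by (rule integrable_const_bound[where B=1]; use f01 in \<open>auto simp: abs_of_nonneg\<close>)+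
  have st: "expectation (\<lambda>\<omega>. min 1 (L * norm (X (s n) \<omega> - X s0 \<omega>))) = expectation (\<lambda>\<omega>. min 1 (L * norm (X \<bar>s n - s0\<bar> \<omega>)))" for n
  proof -
    have *: "expectation (\<lambda>\<omega>. min 1 (L * norm (X b \<omega> - X a \<omega>))) = expectation (\<lambda>\<omega>. min 1 (L * norm (X (b - a) \<omega>)))"
      if "0 \<le> a" "a \<le> b" for a b
    proof -
      have [measurable]: "X a \<in> borel_measurable M" "X b \<in> borel_measurable M" "X (b - a) \<in> borel_measurable M"
        using that by (auto intro!: X_meas)
      have "expectation (\<lambda>\<omega>. min 1 (L * norm (X b \<omega> - X a \<omega>))) = (LINT z|distr M borel (\<lambda>\<omega>. X b \<omega> - X a \<omega>). min 1 (L * norm z))"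
        by (rule integral_distr[symmetric]) measurable
      also have "\<dots> = (LINT z|distr M borel (X (b - a)). min 1 (L * norm z))"
        using stationary[OF that] by simp
      also have "\<dots> = expectation (\<lambda>\<omega>. min 1 (L * norm (X (b - a) \<omega>)))"
        by (rule integral_distr) measurable
      finally show ?thesis .
    qed
    show ?thesis
    proof (cases "s0 \<le> s n")
      case True
      then show ?thesis using *[of s0 "s n"] s by simp
    next
      case False
      then show ?thesis using *[of "s n" s0] s by (simp add: norm_minus_commute)
    qed
  qed
  have bound: "norm (expectation (\<lambda>\<omega>. f (y n + X (s n) \<omega>)) - expectation (\<lambda>\<omega>. f (y0 + X s0 \<omega>)))
      \<le> L * norm (y n - y0) + expectation (\<lambda>\<omega>. min 1 (L * norm (X \<bar>s n - s0\<bar> \<omega>)))" for n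
  proof -
    have i: "integrable M (\<lambda>\<omega>. min 1 (L * norm (X (s n) \<omega> - X s0 \<omega>)))"
      by (rule integrable_const_bound[where B=1]) (use L in \<open>auto simp: min_def\<close>)
    have "norm (expectation (\<lambda>\<omega>. f (y n + X (s n) \<omega>)) - expectation (\<lambda>\<omega>. f (y0 + X s0 \<omega>)))
      = norm (expectation (\<lambda>\<omega>. f (y n + X (s n) \<omega>) - f (y0 + X s0 \<omega>)))" using fi by simp
    also have "\<dots> \<le> expectation (\<lambda>\<omega>. norm (f (y n + X (s n) \<omega>) - f (y0 + X s0 \<omega>)))"
      by (rule integral_norm_bound)
    also have "\<dots> \<le> expectation (\<lambda>\<omega>. L * norm (y n - y0) + min 1 (L * norm (X (s n) \<omega> - X s0 \<omega>)))"
    proof (rule integral_mono)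
      fix \<omega>
      let ?a = "y n + X (s n) \<omega>" and ?b = "y0 + X (s n) \<omega>" and ?c = "y0 + X s0 \<omega>"
      have "\<bar>f ?a - f ?b\<bar> \<le> L * norm (y n - y0)" using L(2)[of ?a ?b] by simp
      moreover have "\<bar>f ?b - f ?c\<bar> \<le> L * norm (X (s n) \<omega> - X s0 \<omega>)" using L(2)[of ?b ?c] by simp
      moreover have "\<bar>f ?b - f ?c\<bar> \<le> 1" using f01[of ?b] f01[of ?c] by linarith
      ultimately show "norm (f ?a - f ?c) \<le> L * norm (y n - y0) + min 1 (L * norm (X (s n) \<omega> - X s0 \<omega>))"
        by (auto simp: min_def)
    qed (use i fi in \<open>auto\<close>)
    also have "\<dots> = L * norm (y n - y0) + expectation (\<lambda>\<omega>. min 1 (L * norm (X (s n) \<omega> - X s0 \<omega>)))"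
      using i by (simp add: prob_space)
    finally show ?thesis by (simp only: st)
  qed
  have "(\<lambda>n. L * norm (y n - y0) + expectation (\<lambda>\<omega>. min 1 (L * norm (X \<bar>s n - s0\<bar> \<omega>)))) \<longlonglongrightarrow> L * norm (y0 - y0) + 0"
  proof (intro tendsto_intros y stochastic_continuity L(1))
    have "(\<lambda>n. \<bar>s n - s0\<bar>) \<longlonglongrightarrow> \<bar>s0 - s0\<bar>" by (intro tendsto_intros s)
    then show "(\<lambda>n. \<bar>s n - s0\<bar>) \<longlonglongrightarrow> 0" by simp
  qed simp
  then have "(\<lambda>n. L * norm (y n - y0) + expectation (\<lambda>\<omega>. min 1 (L * norm (X \<bar>s n - s0\<bar> \<omega>)))) \<longlonglongrightarrow> 0" by simp
  from Lim_null_comparison[OF always_eventually[OF allI[OF bound]] this] show ?thesis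
    by (subst LIM_zero_iff[symmetric])
qed

text \<open>The limit of \<open>dyadic_strong_markov\<close> with delay \<open>t - s\<close>. The dyadic times approach \<open>T\<close> from the right,
  so the paths converge; the remaining time \<open>t - s\<close> increases to \<open>t - T\<close>, and there the
  continuity of the transition operators is needed.\<close>

lemma strong_markov_lipschitz:
  fixes f :: "'a \<Rightarrow> real"
  assumes T: "optional_time T" and t: "0 < t"
    and f01: "\<And>z. 0 \<le> f z" "\<And>z. f z \<le> 1" and L: "0 \<le> L" "\<And>a b. \<bar>f a - f b\<bar> \<le> L * norm (a - b)"
    and [measurable]: "f \<in> borel_measurable borel"
  shows "(\<integral>\<^sup>+\<omega>. (if T \<omega> < ennreal t then ennreal (f (x + X t \<omega>)) else 0) \<partial>M) =
    (\<integral>\<^sup>+\<omega>. (if T \<omega> < ennreal t then (\<integral>\<^sup>+\<omega>'. ennreal (f (x + X (enn2real (T \<omega>)) \<omega> + X (t - enn2real (T \<omega>)) \<omega>')) \<partial>M) else 0) \<partial>M)"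
proof -
  note [measurable] = optional_time_measurable[OF T]
  define \<tau> where "\<tau> m \<omega> = dyad_up m (enn2real (T \<omega>))" for m \<omega>
  have \<tau>gt: "enn2real (T \<omega>) < \<tau> m \<omega>" for m \<omega> unfolding \<tau>_def by (rule dyad_up_gt[OF enn2real_nonneg])
  have \<tau>lim: "(\<lambda>m. \<tau> m \<omega>) \<longlonglongrightarrow> enn2real (T \<omega>)" for \<omega> unfolding \<tau>_def by (rule dyad_up_tendsto[OF enn2real_nonneg])
  have \<tau>0: "0 \<le> \<tau> m \<omega>" for m \<omega> by (rule order_trans[OF enn2real_nonneg less_imp_le[OF \<tau>gt]])
  have [measurable]: "\<tau> m \<in> borel_measurable M" for m unfolding \<tau>_def by measurable
  define h where "h s = max 0 (t - s)" for s
  define \<Phi> where "\<Phi> s a b = (if s < t then ennreal (f (x + a + b)) else 0)" for s a b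
  have [measurable]: "X t \<in> borel_measurable M" using t by (intro X_meas) simp
  have [measurable]: "(\<lambda>\<omega>. X (\<tau> m \<omega>) \<omega>) \<in> borel_measurable M" for m
    using \<tau>0 by (auto intro!: X_joint')
  have [measurable]: "(\<lambda>\<omega>. X (enn2real (T \<omega>)) \<omega>) \<in> borel_measurable M"
    by (auto intro!: X_joint')
  have hX: "(\<lambda>(\<omega>, \<omega>'). X (h (g \<omega>)) \<omega>') \<in> borel_measurable (M \<Otimes>\<^sub>M M)" if [measurable]: "g \<in> borel_measurable M" for g :: "'w \<Rightarrow> real"
    unfolding case_prod_beta by (rule X_joint') (auto simp: h_def)
  define Kf where "Kf s y = expectation (\<lambda>\<omega>. f (y + X s \<omega>))" for s y
  have K_nn: "(\<integral>\<^sup>+\<omega>'. ennreal (f (y + X s \<omega>')) \<partial>M) = ennreal (Kf s y)" if "0 \<le> s" for s y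
  proof -
    have [measurable]: "X s \<in> borel_measurable M" using that by (rule X_meas)
    show ?thesis unfolding Kf_def
      by (intro nn_integral_eq_integral integrable_const_bound[where B=1]) (use f01 in \<open>auto simp: abs_of_nonneg\<close>)
  qed
  have K01: "ennreal (Kf s y) \<le> 1" if "0 \<le> s" for s y
  proof -
    have "(\<integral>\<^sup>+\<omega>'. ennreal (f (y + X s \<omega>')) \<partial>M) \<le> (\<integral>\<^sup>+\<omega>'. 1 \<partial>M)"
      by (rule nn_integral_mono) (simp add: f01 ennreal_le_1)
    then show ?thesis using K_nn[OF that] by (simp add: emeasure_space_1)
  qed
  have less_iff: "T \<omega> < ennreal t \<longleftrightarrow> T \<omega> < \<infinity> \<and> enn2real (T \<omega>) < t" for \<omega>
    by (cases "T \<omega>") (auto simp: ennreal_less_iff)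
  have h_eq: "h (enn2real (T \<omega>)) = t - enn2real (T \<omega>)" if "T \<omega> < ennreal t" for \<omega>
    using iffD1[OF less_iff that] unfolding h_def by linarith
  define A where "A m \<omega> = (if T \<omega> < \<infinity> then if \<tau> m \<omega> < t then ennreal (f (x + X t \<omega>)) else 0 else 0)" for m \<omega>
  define B where "B m \<omega> = (if T \<omega> < \<infinity> then if \<tau> m \<omega> < t then ennreal (Kf (t - \<tau> m \<omega>) (x + X (\<tau> m \<omega>) \<omega>)) else 0 else 0)" for m \<omega>
  have AB: "(\<integral>\<^sup>+\<omega>. A m \<omega> \<partial>M) = (\<integral>\<^sup>+\<omega>. B m \<omega> \<partial>M)" for m
  proof -
    have "(\<integral>\<^sup>+\<omega>. A m \<omega> \<partial>M) = (\<integral>\<^sup>+\<omega>. (if T \<omega> < \<infinity> then \<Phi> (\<tau> m \<omega>) (X (\<tau> m \<omega>) \<omega>) (X (\<tau> m \<omega> + h (\<tau> m \<omega>)) \<omega> - X (\<tau> m \<omega>) \<omega>) else 0) \<partial>M)"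
      by (rule nn_integral_cong) (auto simp: A_def \<Phi>_def h_def max_def)
    also have "\<dots> = (\<integral>\<^sup>+\<omega>. (if T \<omega> < \<infinity> then (\<integral>\<^sup>+\<omega>'. \<Phi> (\<tau> m \<omega>) (X (\<tau> m \<omega>) \<omega>) (X (h (\<tau> m \<omega>)) \<omega>') \<partial>M) else 0) \<partial>M)"
      unfolding \<tau>_def by (rule dyadic_strong_markov[OF T]) (auto simp: h_def \<Phi>_def)
    also have "\<dots> = (\<integral>\<^sup>+\<omega>. B m \<omega> \<partial>M)"
      by (rule nn_integral_cong) (auto simp: B_def \<Phi>_def h_def max_def K_nn)
    finally show ?thesis .
  qed
  define A' where "A' \<omega> = (if T \<omega> < ennreal t then ennreal (f (x + X t \<omega>)) else 0)" for \<omega>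
  define B' where "B' \<omega> = (if T \<omega> < ennreal t then ennreal (Kf (t - enn2real (T \<omega>)) (x + X (enn2real (T \<omega>)) \<omega>)) else 0)" for \<omega>
  have [measurable]: "A m \<in> borel_measurable M" "A' \<in> borel_measurable M" for m
    unfolding A_def A'_def by measurable
  have Km: "(\<lambda>\<omega>. ennreal (Kf (h (g \<omega>)) (k \<omega>))) \<in> borel_measurable M"
    if [measurable]: "g \<in> borel_measurable M" "k \<in> borel_measurable M" for g k
  proof -
    have [measurable]: "(\<lambda>(\<omega>, \<omega>'). X (h (g \<omega>)) \<omega>') \<in> borel_measurable (M \<Otimes>\<^sub>M M)" by (rule hX) measurable
    have "(\<lambda>\<omega>. \<integral>\<^sup>+\<omega>'. ennreal (f (k \<omega> + X (h (g \<omega>)) \<omega>')) \<partial>M) \<in> borel_measurable M" by measurable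
    then show ?thesis by (subst (asm) K_nn) (auto simp: h_def)
  qed
  have [measurable]: "B m \<in> borel_measurable M" for m
  proof -
    have "B m = (\<lambda>\<omega>. if T \<omega> < \<infinity> then if \<tau> m \<omega> < t then ennreal (Kf (h (\<tau> m \<omega>)) (x + X (\<tau> m \<omega>) \<omega>)) else 0 else 0)"
      by (auto simp: B_def h_def fun_eq_iff max_def)
    moreover have [measurable]: "(\<lambda>\<omega>. ennreal (Kf (h (\<tau> m \<omega>)) (x + X (\<tau> m \<omega>) \<omega>))) \<in> borel_measurable M"
      by (rule Km) measurable
    ultimately show ?thesis by simp
  qed
  have [measurable]: "B' \<in> borel_measurable M"
  proof -
    have "B' = (\<lambda>\<omega>. if T \<omega> < ennreal t then ennreal (Kf (h (enn2real (T \<omega>))) (x + X (enn2real (T \<omega>)) \<omega>)) else 0)"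
      unfolding B'_def by (intro ext if_cong refl) (simp only: h_eq)
    moreover have [measurable]: "(\<lambda>\<omega>. ennreal (Kf (h (enn2real (T \<omega>))) (x + X (enn2real (T \<omega>)) \<omega>))) \<in> borel_measurable M"
      by (rule Km) measurable
    ultimately show ?thesis by simp
  qed
  have A1: "A m \<omega> \<le> 1" "B m \<omega> \<le> 1" for m \<omega>
    by (auto simp: A_def B_def f01 ennreal_le_1 K01[simplified])
  have ev: "\<forall>\<^sub>F m in sequentially. (T \<omega> < \<infinity> \<and> \<tau> m \<omega> < t) = (T \<omega> < ennreal t)" for \<omega>
  proof (cases "T \<omega> < ennreal t")
    case True
    then have "\<forall>\<^sub>F m in sequentially. \<tau> m \<omega> < t" using order_tendstoD(2)[OF \<tau>lim[of \<omega>]] iffD1[OF less_iff] by blast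
    then show ?thesis using iffD1[OF less_iff True] True by (auto elim: eventually_mono)
  next
    case False
    have "\<not> (T \<omega> < \<infinity> \<and> \<tau> m \<omega> < t)" for m using False \<tau>gt[of \<omega> m] less_iff[of \<omega>] less_trans by blast
    then show ?thesis using False by simp
  qed
  have "(\<lambda>m. \<integral>\<^sup>+\<omega>. A m \<omega> \<partial>M) \<longlonglongrightarrow> (\<integral>\<^sup>+\<omega>. A' \<omega> \<partial>M)"
  proof (rule nn_integral_dominated_convergence[where w="\<lambda>_. 1"])
    show "AE \<omega> in M. (\<lambda>m. A m \<omega>) \<longlonglongrightarrow> A' \<omega>"
    proof (rule AE_I2, rule tendsto_eventually)
      fix \<omega>
      show "\<forall>\<^sub>F m in sequentially. A m \<omega> = A' \<omega>" using ev[of \<omega>] by eventually_elim (auto simp: A_def A'_def)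
    qed
  qed (auto simp: A1 emeasure_space_1)
  moreover have "(\<lambda>m. \<integral>\<^sup>+\<omega>. B m \<omega> \<partial>M) \<longlonglongrightarrow> (\<integral>\<^sup>+\<omega>. B' \<omega> \<partial>M)"
  proof (rule nn_integral_dominated_convergence[where w="\<lambda>_. 1"])
    show "AE \<omega> in M. (\<lambda>m. B m \<omega>) \<longlonglongrightarrow> B' \<omega>"
    proof (rule AE_I2)
      fix \<omega> assume \<omega>: "\<omega> \<in> space M"
      show "(\<lambda>m. B m \<omega>) \<longlonglongrightarrow> B' \<omega>"
      proof (cases "T \<omega> < ennreal t")
        case True
        have "(\<lambda>m. x + X (\<tau> m \<omega>) \<omega>) \<longlonglongrightarrow> x + X (enn2real (T \<omega>)) \<omega>"
          by (intro tendsto_intros X_rcont_seq[OF \<omega>] \<tau>lim less_imp_le[OF \<tau>gt]) simp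
        moreover have "(\<lambda>m. h (\<tau> m \<omega>)) \<longlonglongrightarrow> h (enn2real (T \<omega>))"
          unfolding h_def by (intro tendsto_intros \<tau>lim)
        ultimately have "(\<lambda>m. Kf (h (\<tau> m \<omega>)) (x + X (\<tau> m \<omega>) \<omega>)) \<longlonglongrightarrow> Kf (h (enn2real (T \<omega>))) (x + X (enn2real (T \<omega>)) \<omega>)"
          unfolding Kf_def by (intro transition_continuous[OF f01 L]) (auto simp: h_def)
        then have "(\<lambda>m. ennreal (Kf (h (\<tau> m \<omega>)) (x + X (\<tau> m \<omega>) \<omega>))) \<longlonglongrightarrow> ennreal (Kf (h (enn2real (T \<omega>))) (x + X (enn2real (T \<omega>)) \<omega>))"
          by (rule tendsto_ennrealI)
        moreover have "ennreal (Kf (h (enn2real (T \<omega>))) (x + X (enn2real (T \<omega>)) \<omega>)) = B' \<omega>"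
          using True by (simp only: B'_def h_eq if_True)
        moreover have "\<forall>\<^sub>F m in sequentially. ennreal (Kf (h (\<tau> m \<omega>)) (x + X (\<tau> m \<omega>) \<omega>)) = B m \<omega>"
          using ev[of \<omega>] by eventually_elim (use True in \<open>auto simp: B_def h_def max_def\<close>)
        ultimately show ?thesis using Lim_transform_eventually by fastforce
      next
        case False
        show ?thesis
        proof (rule tendsto_eventually)
          show "\<forall>\<^sub>F m in sequentially. B m \<omega> = B' \<omega>" using ev[of \<omega>] by eventually_elim (use False in \<open>auto simp: B_def B'_def\<close>)
        qed
      qed
    qed
  qed (auto simp: A1 emeasure_space_1)
  ultimately have eq: "(\<integral>\<^sup>+\<omega>. A' \<omega> \<partial>M) = (\<integral>\<^sup>+\<omega>. B' \<omega> \<partial>M)"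
    unfolding AB by (rule LIMSEQ_unique)
  have "(\<integral>\<^sup>+\<omega>. B' \<omega> \<partial>M) = (\<integral>\<^sup>+\<omega>. (if T \<omega> < ennreal t then (\<integral>\<^sup>+\<omega>'. ennreal (f (x + X (enn2real (T \<omega>)) \<omega> + X (t - enn2real (T \<omega>)) \<omega>')) \<partial>M) else 0) \<partial>M)"
    unfolding B'_def
    by (intro nn_integral_cong if_cong refl K_nn[symmetric]) (use less_iff in \<open>blast intro: less_imp_le diff_ge_0_iff_ge[THEN iffD2]\<close>)
  then show ?thesis using eq by (simp add: A'_def)
qed

text \<open>Both sides are finite measures in \<open>B\<close>. They agree on open sets, whose indicators are increasing limits of
  Lipschitz functions, hence everywhere.\<close>

lemma strong_markov_density:
  assumes T: "optional_time T" and t: "0 < t"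
    and p: "(\<lambda>(s, z). p s z) \<in> borel_measurable (borel \<Otimes>\<^sub>M borel)"
    and dens: "\<And>s. 0 < s \<Longrightarrow> distr M borel (X s) = density lborel (p s)"
    and B: "B \<in> sets borel"
  shows "emeasure M {\<omega>\<in>space M. T \<omega> < ennreal t \<and> x + X t \<omega> \<in> B} =
    (\<integral>\<^sup>+z\<in>B. (\<integral>\<^sup>+\<omega>. (if T \<omega> < ennreal t then p (t - enn2real (T \<omega>)) (z - (x + X (enn2real (T \<omega>)) \<omega>)) else 0) \<partial>M) \<partial>lborel)"
proof -
  note [measurable] = optional_time_measurable[OF T] p
  have [measurable]: "X t \<in> borel_measurable M" using t by (intro X_meas) simp
  have [measurable]: "(\<lambda>\<omega>. X (enn2real (T \<omega>)) \<omega>) \<in> borel_measurable M"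
    by (auto intro!: X_joint')
  have p1[measurable]: "p s \<in> borel_measurable borel" for s using measurable_Pair2[OF p, of s] by simp
  have pm[measurable]: "(\<lambda>(z, \<omega>). p (t - enn2real (T \<omega>)) (z - (x + X (enn2real (T \<omega>)) \<omega>))) \<in> borel_measurable (borel \<Otimes>\<^sub>M M)"
  proof -
    have "(\<lambda>w. (\<lambda>(s, z). p s z) (t - enn2real (T (snd w)), fst w - (x + X (enn2real (T (snd w))) (snd w)))) \<in> borel_measurable (borel \<Otimes>\<^sub>M M)"
      by (rule measurable_compose[OF _ p]) measurable
    then show ?thesis by (simp add: case_prod_beta)
  qed
  define H where "H z = (\<integral>\<^sup>+\<omega>. (if T \<omega> < ennreal t then p (t - enn2real (T \<omega>)) (z - (x + X (enn2real (T \<omega>)) \<omega>)) else 0) \<partial>M)" for z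
  have [measurable]: "H \<in> borel_measurable borel" unfolding H_def by measurable
  interpret PL: pair_sigma_finite "lborel :: 'a measure" M ..
  have lip: "(\<integral>\<^sup>+\<omega>. (if T \<omega> < ennreal t then ennreal (f (x + X t \<omega>)) else 0) \<partial>M) = (\<integral>\<^sup>+z. ennreal (f z) * H z \<partial>lborel)"
    if f01: "\<And>z. 0 \<le> f z" "\<And>z. f z \<le> 1" and L: "0 \<le> L" "\<And>a b. \<bar>f a - f b\<bar> \<le> L * norm (a - b)"
    and [measurable]: "f \<in> borel_measurable borel" for f :: "'a \<Rightarrow> real" and L
  proof -
    have inner: "(\<integral>\<^sup>+\<omega>'. ennreal (f (y + X s \<omega>')) \<partial>M) = (\<integral>\<^sup>+z. ennreal (f z) * p s (z - y) \<partial>lborel)" if s: "0 < s" for s y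
    proof -
      have [measurable]: "X s \<in> borel_measurable M" using s by (intro X_meas) simp
      have "(\<integral>\<^sup>+\<omega>'. ennreal (f (y + X s \<omega>')) \<partial>M) = (\<integral>\<^sup>+z. ennreal (f (y + z)) \<partial>distr M borel (X s))"
        by (rule nn_integral_distr[symmetric]) measurable
      also have "\<dots> = (\<integral>\<^sup>+z. p s z * ennreal (f (y + z)) \<partial>lborel)"
        unfolding dens[OF s] by (rule nn_integral_density) measurable
      also have "\<dots> = (\<integral>\<^sup>+z. (\<lambda>w. ennreal (f w) * p s (w - y)) (z + y) \<partial>lborel)"
        by (simp add: mult.commute add.commute)
      also have "\<dots> = (\<integral>\<^sup>+z. ennreal (f z) * p s (z - y) \<partial>lborel)"
        by (rule nn_integral_lborel_translate) measurable
      finally show ?thesis .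
    qed
    have "(\<integral>\<^sup>+\<omega>. (if T \<omega> < ennreal t then ennreal (f (x + X t \<omega>)) else 0) \<partial>M)
      = (\<integral>\<^sup>+\<omega>. (if T \<omega> < ennreal t then (\<integral>\<^sup>+\<omega>'. ennreal (f (x + X (enn2real (T \<omega>)) \<omega> + X (t - enn2real (T \<omega>)) \<omega>')) \<partial>M) else 0) \<partial>M)"
      by (rule strong_markov_lipschitz[OF T t f01 L]) measurable
    also have "\<dots> = (\<integral>\<^sup>+\<omega>. (\<integral>\<^sup>+z. ennreal (f z) * (if T \<omega> < ennreal t then p (t - enn2real (T \<omega>)) (z - (x + X (enn2real (T \<omega>)) \<omega>)) else 0) \<partial>lborel) \<partial>M)"
    proof (rule nn_integral_cong)
      fix \<omega>
      show "(if T \<omega> < ennreal t then (\<integral>\<^sup>+\<omega>'. ennreal (f (x + X (enn2real (T \<omega>)) \<omega> + X (t - enn2real (T \<omega>)) \<omega>')) \<partial>M) else 0)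
        = (\<integral>\<^sup>+z. ennreal (f z) * (if T \<omega> < ennreal t then p (t - enn2real (T \<omega>)) (z - (x + X (enn2real (T \<omega>)) \<omega>)) else 0) \<partial>lborel)"
      proof (cases "T \<omega> < ennreal t")
        case True
        then have "0 < t - enn2real (T \<omega>)" by (cases "T \<omega>") (auto simp: ennreal_less_iff)
        then show ?thesis using True inner by simp
      qed simp
    qed
    also have "\<dots> = (\<integral>\<^sup>+z. (\<integral>\<^sup>+\<omega>. ennreal (f z) * (if T \<omega> < ennreal t then p (t - enn2real (T \<omega>)) (z - (x + X (enn2real (T \<omega>)) \<omega>)) else 0) \<partial>M) \<partial>lborel)"
      by (rule PL.Fubini'[of "\<lambda>z \<omega>. ennreal (f z) * (if T \<omega> < ennreal t then p (t - enn2real (T \<omega>)) (z - (x + X (enn2real (T \<omega>)) \<omega>)) else 0)"]) measurable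
    also have "\<dots> = (\<integral>\<^sup>+z. ennreal (f z) * H z \<partial>lborel)"
      unfolding H_def by (intro nn_integral_cong nn_integral_cmult) measurable
    finally show ?thesis .
  qed
  define E where "E = {\<omega>\<in>space M. T \<omega> < ennreal t}"
  have [measurable]: "E \<in> sets M" unfolding E_def by measurable
  \<comment> \<open>The law of the endpoint on the event \<open>T < t\<close>, and the measure with the claimed density.\<close>
  define \<mu>1 where "\<mu>1 = distr (density M (indicator E)) borel (\<lambda>\<omega>. x + X t \<omega>)"
  define \<mu>2 where "\<mu>2 = density lborel H"
  have s1: "sets \<mu>1 = sets borel" "sets \<mu>2 = sets borel" by (auto simp: \<mu>1_def \<mu>2_def)
  have e1: "emeasure \<mu>1 U = (\<integral>\<^sup>+\<omega>. (if T \<omega> < ennreal t then indicator U (x + X t \<omega>) else 0) \<partial>M)" if [measurable]: "U \<in> sets borel" for U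
  proof -
    have "emeasure \<mu>1 U = (\<integral>\<^sup>+\<omega>. indicator E \<omega> * indicator U (x + X t \<omega>) \<partial>M)"
      unfolding \<mu>1_def
      by (subst nn_integral_indicator[symmetric], simp, subst nn_integral_distr, simp, simp, subst nn_integral_density) auto
    also have "\<dots> = (\<integral>\<^sup>+\<omega>. (if T \<omega> < ennreal t then indicator U (x + X t \<omega>) else 0) \<partial>M)"
      by (rule nn_integral_cong) (auto simp: E_def)
    finally show ?thesis .
  qed
  have e2: "emeasure \<mu>2 U = (\<integral>\<^sup>+z. indicator U z * H z \<partial>lborel)" if "U \<in> sets borel" for U
    using that by (simp add: \<mu>2_def emeasure_density mult.commute)
  have op: "emeasure \<mu>1 U = emeasure \<mu>2 U" if U: "open U" for U
  proof (cases "U = UNIV")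
    case True
    have "emeasure \<mu>1 UNIV = emeasure \<mu>2 UNIV"
      using lip[of "\<lambda>_. 1" 0] by (simp add: e1 e2 cong: if_cong)
    then show ?thesis using True by simp
  next
    case False
    then have ne: "- U \<noteq> {}" by auto
    have [measurable]: "U \<in> sets borel" using U by simp
    define f where "f n z = min 1 (real n * infdist z (- U))" for n :: nat and z
    have f01: "0 \<le> f n z" "f n z \<le> 1" for n z by (auto simp: f_def infdist_nonneg)
    have fL: "\<bar>f n a - f n b\<bar> \<le> real n * norm (a - b)" for n a b
    proof -
      have "\<bar>f n a - f n b\<bar> \<le> \<bar>real n * infdist a (- U) - real n * infdist b (- U)\<bar>"
        unfolding f_def min_def by (auto simp: abs_if)
      also have "\<dots> = real n * \<bar>infdist a (- U) - infdist b (- U)\<bar>"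
        by (simp add: abs_mult flip: right_diff_distrib)
      also have "\<dots> \<le> real n * norm (a - b)"
        using infdist_triangle_abs[of a "- U" b] by (intro mult_left_mono) (auto simp: dist_norm)
      finally show ?thesis .
    qed
    have fm[measurable]: "f n \<in> borel_measurable borel" for n
      unfolding f_def by (intro borel_measurable_continuous_onI continuous_intros)
    have f_mono: "f m z \<le> f n z" if "m \<le> n" for m n z
      unfolding f_def using that by (intro min.mono order_refl mult_right_mono) (auto simp: infdist_nonneg)
    have f_sup: "(SUP n. ennreal (f n z)) = indicator U z" for z
    proof -
      have "(\<lambda>n. f n z) \<longlonglongrightarrow> indicator U z"
      proof (cases "z \<in> U")
        case True
        have "closed (- U)" using U by auto
        then have d: "infdist z (- U) > 0" using True ne by (metis ComplD in_closed_iff_infdist_zero infdist_nonneg less_eq_real_def)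
        obtain N :: nat where N: "1 / infdist z (- U) < real N" using reals_Archimedean2 by blast
        have "\<forall>\<^sub>F n in sequentially. f n z = 1"
          using eventually_ge_at_top[of N]
        proof eventually_elim
          case (elim n)
          then have "1 / infdist z (- U) < real n" using N by simp
          then show ?case using d by (auto simp: f_def field_simps)
        qed
        then show ?thesis using True by (auto intro: tendsto_eventually)
      next
        case False
        then show ?thesis by (simp add: f_def)
      qed
      then have "(\<lambda>n. ennreal (f n z)) \<longlonglongrightarrow> ennreal (indicator U z)" by (rule tendsto_ennrealI)
      moreover have "(\<lambda>n. ennreal (f n z)) \<longlonglongrightarrow> (SUP n. ennreal (f n z))"
        by (rule LIMSEQ_SUP) (auto simp: incseq_def f_mono intro!: ennreal_leI)
      ultimately show ?thesis using LIMSEQ_unique by (fastforce simp: indicator_def)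
    qed
    have "emeasure \<mu>1 U = (\<integral>\<^sup>+\<omega>. (SUP n. (if T \<omega> < ennreal t then ennreal (f n (x + X t \<omega>)) else 0)) \<partial>M)"
      unfolding e1[OF \<open>U \<in> sets borel\<close>] by (rule nn_integral_cong) (auto simp: f_sup)
    also have "\<dots> = (SUP n. \<integral>\<^sup>+\<omega>. (if T \<omega> < ennreal t then ennreal (f n (x + X t \<omega>)) else 0) \<partial>M)"
      by (rule nn_integral_monotone_convergence_SUP) (auto simp: incseq_def le_fun_def f_mono intro!: ennreal_leI)
    also have "\<dots> = (SUP n. \<integral>\<^sup>+z. ennreal (f n z) * H z \<partial>lborel)"
      by (subst lip[OF f01 _ fL fm]) auto
    also have "\<dots> = (\<integral>\<^sup>+z. (SUP n. ennreal (f n z) * H z) \<partial>lborel)"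
      by (rule nn_integral_monotone_convergence_SUP[symmetric]) (auto simp: incseq_def le_fun_def f_mono intro!: ennreal_leI mult_right_mono)
    also have "\<dots> = (\<integral>\<^sup>+z. indicator U z * H z \<partial>lborel)"
      by (simp add: SUP_mult_right_ennreal[symmetric] f_sup)
    finally show ?thesis by (simp add: e2)
  qed
  have "\<mu>1 = \<mu>2"
  proof (rule measure_eqI_generator_eq[where E="{U. open U}" and \<Omega>=UNIV and A="\<lambda>_. UNIV"])
    show "Int_stable {U::'a set. open U}" by (auto simp: Int_stable_def)
    have "UNIV \<in> sets (borel :: 'a measure)" by simp
    from e1[OF this] have "emeasure \<mu>1 UNIV \<le> (\<integral>\<^sup>+\<omega>. 1 \<partial>M)"
      by (simp only:) (rule nn_integral_mono, simp)
    then show "emeasure \<mu>1 UNIV \<noteq> \<infinity>" by (auto simp: emeasure_space_1 top_unique)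
  qed (auto simp: s1 op borel_def)
  then have "emeasure \<mu>1 B = emeasure \<mu>2 B" by simp
  moreover have "emeasure \<mu>1 B = emeasure M {\<omega>\<in>space M. T \<omega> < ennreal t \<and> x + X t \<omega> \<in> B}"
  proof -
    note [measurable] = B
    have "emeasure \<mu>1 B = (\<integral>\<^sup>+\<omega>. indicator {\<omega>\<in>space M. T \<omega> < ennreal t \<and> x + X t \<omega> \<in> B} \<omega> \<partial>M)"
      unfolding e1[OF B] by (rule nn_integral_cong) (auto simp: indicator_def)
    then show ?thesis by simp
  qed
  ultimately show ?thesis by (simp add: e2[OF B] H_def mult.commute)
qed

end

section \<open>Skeleton chains, duality and the last step before the exit\<close>

context rc_levy begin

lemma rc_levy_uminus: "rc_levy M (\<lambda>t \<omega>. - X t \<omega>)"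
proof
  show "(\<lambda>\<omega>. - X t \<omega>) \<in> borel_measurable M" if "0 \<le> t" for t using X_meas[OF that] by simp
  show "- X 0 \<omega> = 0" if "\<omega> \<in> space M" for \<omega> using X_zero[OF that] by simp
  show "indep_vars (\<lambda>_. borel) (\<lambda>i \<omega>. - X (ts (Suc i)) \<omega> - - X (ts i) \<omega>) {..<n}"
    if "0 \<le> ts 0" "\<And>i. i < n \<Longrightarrow> ts i \<le> ts (Suc i)" for ts :: "nat \<Rightarrow> real" and n
  proof -
    have "indep_vars (\<lambda>_. borel) (\<lambda>i \<omega>. - (X (ts (Suc i)) \<omega> - X (ts i) \<omega>)) {..<n}"
      by (rule indep_vars_compose2[OF indep_increments[OF that]]) auto
    then show ?thesis by simp
  qed
  show "distr M borel (\<lambda>\<omega>. - X t \<omega> - - X s \<omega>) = distr M borel (\<lambda>\<omega>. - X (t - s) \<omega>)" if "0 \<le> s" "s \<le> t" for s t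
  proof -
    have [measurable]: "X s \<in> borel_measurable M" "X t \<in> borel_measurable M" "X (t - s) \<in> borel_measurable M"
      using that by (auto intro!: X_meas)
    have "distr M borel (\<lambda>\<omega>. - X t \<omega> - - X s \<omega>) = distr M borel (uminus \<circ> (\<lambda>\<omega>. X t \<omega> - X s \<omega>))"
      by (rule arg_cong[of _ _ "distr M borel"]) (simp add: fun_eq_iff)
    also have "\<dots> = distr (distr M borel (\<lambda>\<omega>. X t \<omega> - X s \<omega>)) borel uminus"
      by (rule distr_distr[symmetric]) measurable
    also have "\<dots> = distr (distr M borel (X (t - s))) borel uminus"
      by (simp only: stationary[OF that])
    also have "\<dots> = distr M borel (uminus \<circ> X (t - s))"
      by (rule distr_distr) measurable
    finally show ?thesis by (simp only: o_def)
  qed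
  show "((\<lambda>s. - X s \<omega>) \<longlongrightarrow> - X t \<omega>) (at_right t)" if "\<omega> \<in> space M" "0 \<le> t" for \<omega> t
    by (intro tendsto_minus rcont that)
qed

text \<open>One step of the process observed at multiples of \<open>s\<close> and killed outside \<open>D\<close>.\<close>

definition killed_step :: "'a set \<Rightarrow> real \<Rightarrow> ('a \<Rightarrow> ennreal) \<Rightarrow> 'a \<Rightarrow> ennreal" where
  "killed_step D s f x = (\<integral>\<^sup>+\<omega>. indicator D (x + X s \<omega>) * f (x + X s \<omega>) \<partial>M)"

definition skeleton :: "'a set \<Rightarrow> nat \<Rightarrow> real \<Rightarrow> 'a \<Rightarrow> 'w set" where
  "skeleton D N s x = {\<omega>\<in>space M. \<forall>k\<le>N. x + X (real k * s) \<omega> \<in> D}"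

lemma skeleton_past:
  assumes [measurable]: "D \<in> sets borel" and s: "0 \<le> s"
  shows "skeleton D N s x \<in> sets (past (real N * s))"
proof -
  have "{\<omega>\<in>space (past (real N * s)). \<forall>k\<in>{..N}. x + X (real k * s) \<omega> \<in> D} \<in> sets (past (real N * s))"
  proof (rule sets.sets_Collect_finite_All)
    fix k assume "k \<in> {..N}"
    then have [measurable]: "X (real k * s) \<in> borel_measurable (past (real N * s))"
      using s by (intro X_past mult_right_mono) auto
    show "{\<omega>\<in>space (past (real N * s)). x + X (real k * s) \<omega> \<in> D} \<in> sets (past (real N * s))" by measurable
  qed simp
  moreover have "skeleton D N s x = {\<omega>\<in>space (past (real N * s)). \<forall>k\<in>{..N}. x + X (real k * s) \<omega> \<in> D}"
    unfolding skeleton_def space_past by blast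
  ultimately show ?thesis by (simp only:)
qed

lemma skeleton_sets: "D \<in> sets borel \<Longrightarrow> 0 \<le> s \<Longrightarrow> skeleton D N s x \<in> sets M"
  by (rule subsetD[OF sets_past_subset skeleton_past])

lemma killed_step_measurable:
  assumes [measurable]: "D \<in> sets borel" "f \<in> borel_measurable borel" and s: "0 \<le> s"
  shows "killed_step D s f \<in> borel_measurable borel"
proof -
  have [measurable]: "X s \<in> borel_measurable M" using s by (rule X_meas)
  show ?thesis unfolding killed_step_def by measurable
qed

lemma killed_steps_measurable:
  assumes "D \<in> sets borel" "f \<in> borel_measurable borel" "0 \<le> s"
  shows "(killed_step D s ^^ N) f \<in> borel_measurable borel"
proof (induction N)
  case 0
  show ?case using assms(2) by (simp only: funpow.simps id_apply)
next
  case (Suc N)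
  show ?case unfolding funpow.simps o_apply by (rule killed_step_measurable[OF assms(1) Suc assms(3)])
qed

lemma killed_step_le:
  assumes g: "\<And>z. g z \<le> c"
  shows "killed_step D s g x \<le> c"
proof -
  have "indicator D y * g y \<le> c" for y using g[of y] by (cases "y \<in> D") simp_all
  then have "(\<integral>\<^sup>+\<omega>. indicator D (x + X s \<omega>) * g (x + X s \<omega>) \<partial>M) \<le> (\<integral>\<^sup>+\<omega>. c \<partial>M)"
    by (intro nn_integral_mono)
  then show ?thesis unfolding killed_step_def by (simp add: emeasure_space_1)
qed

lemma killed_steps_le:
  assumes "\<And>z. f z \<le> c"
  shows "(killed_step D s ^^ N) f x \<le> c"
proof (induction N arbitrary: x)
  case 0
  show ?case using assms by (simp only: funpow.simps id_apply)
next
  case (Suc N)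
  show ?case unfolding funpow.simps o_apply by (rule killed_step_le) (rule Suc)
qed

text \<open>Induction on the number of steps, splitting off the last step with the Markov property.\<close>

lemma skeleton_expectation:
  assumes [measurable]: "D \<in> sets borel" and "f \<in> borel_measurable borel" and s: "0 \<le> s"
  shows "(\<integral>\<^sup>+\<omega>. indicator (skeleton D N s x) \<omega> * f (x + X (real N * s) \<omega>) \<partial>M)
    = indicator D x * (killed_step D s ^^ N) f x"
  using assms(2)
proof (induction N arbitrary: f)
  case 0
  have "(\<integral>\<^sup>+\<omega>. indicator (skeleton D 0 s x) \<omega> * f (x + X (real 0 * s) \<omega>) \<partial>M) = (\<integral>\<^sup>+\<omega>. indicator D x * f x \<partial>M)"
    by (rule nn_integral_cong) (auto simp: skeleton_def X_zero indicator_def)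
  then show ?case by (simp add: emeasure_space_1)
next
  case (Suc N)
  note [measurable] = Suc.prems
  let ?u = "real N * s"
  have u: "0 \<le> ?u" using s by simp
  have [measurable]: "skeleton D N s x \<in> sets (past ?u)" by (rule skeleton_past) (use s in auto)
  have [measurable]: "X ?u \<in> borel_measurable (past ?u)" by (rule X_past) (use u in auto)
  let ?\<Phi> = "\<lambda>(\<omega>, z). indicator (skeleton D N s x) \<omega> * (indicator D (x + X ?u \<omega> + z) * f (x + X ?u \<omega> + z))"
  have m: "?\<Phi> \<in> borel_measurable (past ?u \<Otimes>\<^sub>M borel)" by measurable
  have e: "(1 + real N) * s = ?u + s" by (simp add: algebra_simps)
  have "(\<integral>\<^sup>+\<omega>. indicator (skeleton D (Suc N) s x) \<omega> * f (x + X (real (Suc N) * s) \<omega>) \<partial>M)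
    = (\<integral>\<^sup>+\<omega>. ?\<Phi> (\<omega>, X (?u + s) \<omega> - X ?u \<omega>) \<partial>M)"
    by (rule nn_integral_cong) (auto simp: skeleton_def indicator_def e le_Suc_eq)
  also have "\<dots> = (\<integral>\<^sup>+\<omega>. (\<integral>\<^sup>+\<omega>'. ?\<Phi> (\<omega>, X s \<omega>') \<partial>M) \<partial>M)" by (rule freeze_past[OF u s m])
  also have "\<dots> = (\<integral>\<^sup>+\<omega>. indicator (skeleton D N s x) \<omega> * killed_step D s f (x + X ?u \<omega>) \<partial>M)"
  proof -
    have [measurable]: "X s \<in> borel_measurable M" using s by (rule X_meas)
    show ?thesis unfolding killed_step_def prod.case
      by (intro nn_integral_cong nn_integral_cmult) measurable
  qed
  also have "\<dots> = indicator D x * (killed_step D s ^^ N) (killed_step D s f) x"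
    by (rule Suc.IH) (use killed_step_measurable[OF assms(1) Suc.prems s] in simp)
  finally show ?case by (simp add: funpow_swap1)
qed

text \<open>Lebesgue measure is invariant under translations, so a step of \<open>X\<close> is dual to a step of \<open>-X\<close>. This
  replaces time reversal of paths.\<close>

lemma killed_steps_dual:
  assumes D[measurable]: "D \<in> sets borel" and f: "f \<in> borel_measurable borel" and g: "g \<in> borel_measurable borel" and s: "0 \<le> s"
  shows "(\<integral>\<^sup>+x. indicator D x * g x * (killed_step D s ^^ N) f x \<partial>lborel)
    = (\<integral>\<^sup>+x. indicator D x * f x * (rc_levy.killed_step M (\<lambda>t \<omega>. - X t \<omega>) D s ^^ N) g x \<partial>lborel)"
proof -
  interpret R: rc_levy M "\<lambda>t \<omega>. - X t \<omega>" by (rule rc_levy_uminus)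
  have one: "(\<integral>\<^sup>+x. indicator D x * g x * killed_step D s f x \<partial>lborel) = (\<integral>\<^sup>+x. indicator D x * f x * R.killed_step D s g x \<partial>lborel)"
    if [measurable]: "f \<in> borel_measurable borel" "g \<in> borel_measurable borel" for f g
  proof -
    interpret PL: pair_sigma_finite "lborel :: 'a measure" M ..
    have [measurable]: "X s \<in> borel_measurable M" using s by (rule X_meas)
    have "(\<integral>\<^sup>+x. indicator D x * g x * killed_step D s f x \<partial>lborel)
      = (\<integral>\<^sup>+x. (\<integral>\<^sup>+\<omega>. indicator D x * g x * (indicator D (x + X s \<omega>) * f (x + X s \<omega>)) \<partial>M) \<partial>lborel)"
      unfolding killed_step_def by (intro nn_integral_cong nn_integral_cmult[symmetric]) measurable
    also have "\<dots> = (\<integral>\<^sup>+\<omega>. (\<integral>\<^sup>+x. indicator D x * g x * (indicator D (x + X s \<omega>) * f (x + X s \<omega>)) \<partial>lborel) \<partial>M)"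
      by (rule PL.Fubini'[symmetric]) measurable
    also have "\<dots> = (\<integral>\<^sup>+\<omega>. (\<integral>\<^sup>+x. indicator D x * f x * (indicator D (x + - X s \<omega>) * g (x + - X s \<omega>)) \<partial>lborel) \<partial>M)"
    proof (rule nn_integral_cong)
      fix \<omega>
      let ?h = "\<lambda>y. indicator D y * f y * (indicator D (y + - X s \<omega>) * g (y + - X s \<omega>))"
      have "(\<integral>\<^sup>+x. indicator D x * g x * (indicator D (x + X s \<omega>) * f (x + X s \<omega>)) \<partial>lborel) = (\<integral>\<^sup>+x. ?h (x + X s \<omega>) \<partial>lborel)"
        by (rule nn_integral_cong) (simp add: mult_ac)
      also have "\<dots> = (\<integral>\<^sup>+x. ?h x \<partial>lborel)" by (rule nn_integral_lborel_translate) measurable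
      finally show "(\<integral>\<^sup>+x. indicator D x * g x * (indicator D (x + X s \<omega>) * f (x + X s \<omega>)) \<partial>lborel) = (\<integral>\<^sup>+x. ?h x \<partial>lborel)" .
    qed
    also have "\<dots> = (\<integral>\<^sup>+x. (\<integral>\<^sup>+\<omega>. indicator D x * f x * (indicator D (x + - X s \<omega>) * g (x + - X s \<omega>)) \<partial>M) \<partial>lborel)"
      by (rule PL.Fubini') measurable
    also have "\<dots> = (\<integral>\<^sup>+x. indicator D x * f x * R.killed_step D s g x \<partial>lborel)"
      unfolding R.killed_step_def by (intro nn_integral_cong nn_integral_cmult) measurable
    finally show ?thesis .
  qed
  show ?thesis using f g
  proof (induction N arbitrary: f g)
    case 0
    then show ?case by (simp add: mult_ac)
  next
    case (Suc N)
    have "(\<integral>\<^sup>+x. indicator D x * g x * (killed_step D s ^^ Suc N) f x \<partial>lborel)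
      = (\<integral>\<^sup>+x. indicator D x * g x * killed_step D s ((killed_step D s ^^ N) f) x \<partial>lborel)" by simp
    also have "\<dots> = (\<integral>\<^sup>+x. indicator D x * (killed_step D s ^^ N) f x * R.killed_step D s g x \<partial>lborel)"
      by (rule one) (use Suc.prems killed_steps_measurable[OF D _ s] in auto)
    also have "\<dots> = (\<integral>\<^sup>+x. indicator D x * R.killed_step D s g x * (killed_step D s ^^ N) f x \<partial>lborel)"
      by (simp add: mult_ac)
    also have "\<dots> = (\<integral>\<^sup>+x. indicator D x * f x * (R.killed_step D s ^^ N) (R.killed_step D s g) x \<partial>lborel)"
      by (rule Suc.IH) (use Suc.prems R.killed_step_measurable[OF D _ s] in auto)
    finally show ?case by (simp add: funpow_swap1)
  qed
qed

definition step_into :: "'a set \<Rightarrow> real \<Rightarrow> 'a \<Rightarrow> ennreal" where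
  "step_into U h y = emeasure M {\<omega>\<in>space M. y + X h \<omega> \<in> U}"

lemma step_into_eq:
  assumes [measurable]: "U \<in> sets borel" and h: "0 \<le> h"
  shows "step_into U h y = (\<integral>\<^sup>+\<omega>. indicator U (y + X h \<omega>) \<partial>M)"
proof -
  have [measurable]: "X h \<in> borel_measurable M" using h by (rule X_meas)
  have "(\<integral>\<^sup>+\<omega>. indicator U (y + X h \<omega>) \<partial>M) = (\<integral>\<^sup>+\<omega>. indicator {\<omega>\<in>space M. y + X h \<omega> \<in> U} \<omega> \<partial>M)"
    by (rule nn_integral_cong) (auto simp: indicator_def)
  then show ?thesis by (simp add: step_into_def)
qed

lemma step_into_measurable:
  assumes [measurable]: "U \<in> sets borel" and h: "0 \<le> h"
  shows "step_into U h \<in> borel_measurable borel"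
proof -
  have [measurable]: "X h \<in> borel_measurable M" using h by (rule X_meas)
  have "(\<lambda>y. \<integral>\<^sup>+\<omega>. indicator U (y + X h \<omega>) \<partial>M) \<in> borel_measurable borel" by measurable
  then show ?thesis by (simp add: step_into_eq[OF assms, abs_def])
qed

lemma step_into_le_1: "step_into U h y \<le> 1"
  unfolding step_into_def by (simp add: emeasure_eq_measure)

text \<open>The Markov property at the last time of the skeleton.\<close>

lemma skeleton_step_into:
  assumes D[measurable]: "D \<in> sets borel" and U[measurable]: "U \<in> sets borel" and s: "0 \<le> s" and h: "0 \<le> h"
  shows "indicator D x * (killed_step D s ^^ N) (step_into U h) x
    = emeasure M {\<omega>\<in>skeleton D N s x. x + X (real N * s + h) \<omega> \<in> U}"
proof -
  let ?u = "real N * s"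
  have u: "0 \<le> ?u" using s by simp
  have [measurable]: "skeleton D N s x \<in> sets (past ?u)" by (rule skeleton_past) (use s in auto)
  have skM: "skeleton D N s x \<in> sets M" by (rule skeleton_sets) (use s in auto)
  have [measurable]: "X ?u \<in> borel_measurable (past ?u)" by (rule X_past) (use u in auto)
  have [measurable]: "X h \<in> borel_measurable M" "X (?u + h) \<in> borel_measurable M" using h u by (auto intro!: X_meas)
  let ?\<Phi> = "\<lambda>(\<omega>, z). indicator (skeleton D N s x) \<omega> * indicator U (x + X ?u \<omega> + z) :: ennreal"
  have m: "?\<Phi> \<in> borel_measurable (past ?u \<Otimes>\<^sub>M borel)" by measurable
  have "{\<omega>\<in>skeleton D N s x. x + X (?u + h) \<omega> \<in> U} = skeleton D N s x \<inter> {\<omega>\<in>space M. x + X (?u + h) \<omega> \<in> U}"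
    by (auto simp: skeleton_def)
  also have "\<dots> \<in> sets M" using skM by measurable
  finally have "emeasure M {\<omega>\<in>skeleton D N s x. x + X (?u + h) \<omega> \<in> U} = (\<integral>\<^sup>+\<omega>. indicator {\<omega>\<in>skeleton D N s x. x + X (?u + h) \<omega> \<in> U} \<omega> \<partial>M)"
    by simp
  also have "\<dots> = (\<integral>\<^sup>+\<omega>. ?\<Phi> (\<omega>, X (?u + h) \<omega> - X ?u \<omega>) \<partial>M)"
    by (rule nn_integral_cong) (auto simp: indicator_def)
  also have "\<dots> = (\<integral>\<^sup>+\<omega>. (\<integral>\<^sup>+\<omega>'. ?\<Phi> (\<omega>, X h \<omega>') \<partial>M) \<partial>M)" by (rule freeze_past[OF u h m])
  also have "\<dots> = (\<integral>\<^sup>+\<omega>. indicator (skeleton D N s x) \<omega> * step_into U h (x + X ?u \<omega>) \<partial>M)"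
    unfolding prod.case step_into_eq[OF U h]
    by (intro nn_integral_cong nn_integral_cmult) measurable
  also have "\<dots> = indicator D x * (killed_step D s ^^ N) (step_into U h) x"
    by (rule skeleton_expectation) (use s step_into_measurable[OF U h] in auto)
  finally show ?thesis by simp
qed

text \<open>The number \<open>c\<close> is the mesh as a fraction of \<open>t\<close>; the factor \<open>indicator {0<..} t\<close> discards negative times.\<close>

lemma skeleton_step_into_joint:
  assumes D[measurable]: "D \<in> sets borel" and U[measurable]: "U \<in> sets borel" and h: "0 \<le> h" and c: "0 \<le> c"
  shows "(\<lambda>(t, x). indicator {0<..} t * (indicator D x * (killed_step D (t * c) ^^ N) (step_into U h) x))
    \<in> borel_measurable (borel \<Otimes>\<^sub>M borel)"
proof -
  have X1[measurable]: "(\<lambda>z. X (max 0 (real k * (fst (fst z) * c))) (snd z)) \<in> borel_measurable ((borel \<Otimes>\<^sub>M borel) \<Otimes>\<^sub>M M)" for k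
    by (rule X_joint') auto
  have X2[measurable]: "(\<lambda>z. X (max 0 (real N * (fst (fst z) * c) + h)) (snd z)) \<in> borel_measurable ((borel \<Otimes>\<^sub>M borel) \<Otimes>\<^sub>M M)"
    by (rule X_joint') auto
  define E where "E = {z \<in> space ((borel \<Otimes>\<^sub>M borel) \<Otimes>\<^sub>M M). (\<forall>k\<in>{..N}. snd (fst z) + X (max 0 (real k * (fst (fst z) * c))) (snd z) \<in> D)
    \<and> snd (fst z) + X (max 0 (real N * (fst (fst z) * c) + h)) (snd z) \<in> U}"
  have [measurable]: "E \<in> sets ((borel \<Otimes>\<^sub>M borel) \<Otimes>\<^sub>M M)" unfolding E_def by measurable
  have [measurable]: "(\<lambda>w. emeasure M (Pair w -` E)) \<in> borel_measurable (borel \<Otimes>\<^sub>M borel)"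
    by (rule measurable_emeasure_Pair) measurable
  have "indicator {0<..} t * (indicator D x * (killed_step D (t * c) ^^ N) (step_into U h) x) = indicator {0<..} t * emeasure M (Pair (t, x) -` E)" for t x
  proof (cases "0 < t")
    case True
    have nn: "0 \<le> real k * (t * c)" for k using True c by simp
    have "Pair (t, x) -` E = {\<omega>\<in>skeleton D N (t * c) x. x + X (real N * (t * c) + h) \<omega> \<in> U}"
      using nn h by (auto simp: E_def skeleton_def space_pair_measure max_absorb2)
    then show ?thesis using True c h by (simp add: skeleton_step_into[OF D U])
  qed simp
  then show ?thesis by (simp add: case_prod_beta)
qed

text \<open>For two such times \<open>t1\<close> and \<open>t2\<close> with \<open>t1 + h < t2\<close>, the position at time \<open>t1 + h\<close> would be a limit of
  positions at dyadic fractions of \<open>t2\<close>, hence in the closure of \<open>D\<close>. So the times lie in an interval of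
  length \<open>h\<close>.\<close>

lemma last_step_times:
  fixes x :: 'a
  assumes D: "open D" and h: "0 < h" and \<omega>: "\<omega> \<in> space M"
  defines "S \<equiv> {t. 0 < t \<and> (\<forall>n. \<omega> \<in> skeleton D (2 ^ n) (t / 2 ^ n) x) \<and> x + X (t + h) \<omega> \<in> - closure D}"
  shows "emeasure lborel S \<le> ennreal h"
proof (cases "S = {}")
  case False
  have diff: "t2 \<le> t1 + h" if "t1 \<in> S" "t2 \<in> S" for t1 t2
  proof (rule ccontr)
    assume "\<not> t2 \<le> t1 + h"
    then have lt: "t1 + h < t2" by simp
    have t: "0 < t1" "0 < t2" using that by (auto simp: S_def)
    \<comment> \<open>Dyadic approximations from above of the fraction \<open>r\<close> give grid times of \<open>t2\<close> that decrease to
      \<open>t1 + h\<close>.\<close>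
    define r where "r = (t1 + h) / t2"
    have r: "0 \<le> r" "r < 1" using t lt h by (auto simp: r_def)
    have rt: "r * t2 = t1 + h" using t by (simp add: r_def)
    have "x + X (dyad_up n r * t2) \<omega> \<in> D" for n
    proof -
      obtain k where k: "k \<le> 2 ^ n" "dyad_up n r = real k / 2 ^ n" using dyad_up_mult_le[OF r] by blast
      have "\<omega> \<in> skeleton D (2 ^ n) (t2 / 2 ^ n) x" using that(2) by (auto simp: S_def)
      then have "x + X (real k * (t2 / 2 ^ n)) \<omega> \<in> D" using k(1) by (auto simp: skeleton_def)
      then show ?thesis using k(2) by simp
    qed
    moreover have "(\<lambda>n. x + X (dyad_up n r * t2) \<omega>) \<longlonglongrightarrow> x + X (t1 + h) \<omega>"
    proof (intro tendsto_intros X_rcont_seq[OF \<omega>])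
      show "0 \<le> t1 + h" using t h by simp
      show "(\<lambda>n. dyad_up n r * t2) \<longlonglongrightarrow> t1 + h"
        unfolding rt[symmetric] by (intro tendsto_intros dyad_up_tendsto r)
      show "t1 + h \<le> dyad_up n r * t2" for n
        unfolding rt[symmetric] using dyad_up_gt[OF r(1), of n] t by (intro mult_right_mono) auto
    qed
    ultimately have "x + X (t1 + h) \<omega> \<in> closure D"
      unfolding closure_sequential by (intro exI[of _ "\<lambda>n. x + X (dyad_up n r * t2) \<omega>"] conjI allI)
    then show False using that(1) by (auto simp: S_def)
  qed
  have bdd: "bdd_below S" by (rule bdd_belowI[of _ 0]) (auto simp: S_def)
  have "S \<subseteq> {Inf S .. Inf S + h}"
  proof
    fix t assume t: "t \<in> S"
    have "t - h \<le> Inf S" by (rule cInf_greatest) (use False diff[OF _ t] in \<open>auto simp: algebra_simps\<close>)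
    then show "t \<in> {Inf S .. Inf S + h}" using cInf_lower[OF t bdd] by auto
  qed
  then have "emeasure lborel S \<le> emeasure lborel {Inf S .. Inf S + h}" by (rule emeasure_mono) simp
  then show ?thesis using h by simp
qed simp

lemma skeleton_dyadic_decseq:
  assumes "0 \<le> t" "m \<le> n"
  shows "skeleton D (2 ^ n) (t / 2 ^ n) x \<subseteq> skeleton D (2 ^ m) (t / 2 ^ m) x"
proof
  fix \<omega> assume \<omega>: "\<omega> \<in> skeleton D (2 ^ n) (t / 2 ^ n) x"
  obtain d where d: "n = m + d" using assms(2) le_Suc_ex by blast
  have "x + X (real k * (t / 2 ^ m)) \<omega> \<in> D" if "k \<le> 2 ^ m" for k
  proof -
    have "k * 2 ^ d \<le> 2 ^ n" using that by (simp add: d power_add)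
    then have "x + X (real (k * 2 ^ d) * (t / 2 ^ n)) \<omega> \<in> D" using \<omega> by (auto simp: skeleton_def)
    also have "real (k * 2 ^ d) * (t / 2 ^ n) = real k * (t / 2 ^ m)" by (simp add: d power_add)
    finally show ?thesis .
  qed
  then show "\<omega> \<in> skeleton D (2 ^ m) (t / 2 ^ m) x" using \<omega> by (auto simp: skeleton_def)
qed

text \<open>For fixed \<open>t\<close> the infimum over the dyadic skeletons is the probability of the event in \<open>last_step_times\<close>, by
  continuity of the measure from above; then Fubini.\<close>

lemma exit_once_bound:
  assumes D: "open D" and h: "0 < h"
  shows "(\<integral>\<^sup>+t\<in>{0<..}. (INF n. indicator D x * (killed_step D (t / 2 ^ n) ^^ (2 ^ n)) (step_into (- closure D) h) x) \<partial>lborel) \<le> ennreal h"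
proof -
  have Dm[measurable]: "D \<in> sets borel" using D by simp
  have Um[measurable]: "- closure D \<in> sets borel" by simp
  have [measurable]: "(\<lambda>(t, \<omega>). X (max 0 (real k * (t / 2 ^ n))) \<omega>) \<in> borel_measurable (borel \<Otimes>\<^sub>M M)" for k n
    unfolding case_prod_beta by (rule X_joint') auto
  have [measurable]: "(\<lambda>(t, \<omega>). X (max 0 (t + h)) \<omega>) \<in> borel_measurable (borel \<Otimes>\<^sub>M M)"
    unfolding case_prod_beta by (rule X_joint') auto
  define Ev where "Ev = {z \<in> space (borel \<Otimes>\<^sub>M M). 0 < fst z \<and> (\<forall>n. \<forall>k\<in>{..2 ^ n}. x + X (max 0 (real k * (fst z / 2 ^ n))) (snd z) \<in> D)
      \<and> x + X (max 0 (fst z + h)) (snd z) \<in> - closure D}"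
  have Ev[measurable]: "Ev \<in> sets (borel \<Otimes>\<^sub>M M)"
    unfolding Ev_def by measurable
  have Ev_iff: "(t, \<omega>) \<in> Ev \<longleftrightarrow> \<omega> \<in> space M \<and> 0 < t \<and> (\<forall>n. \<omega> \<in> skeleton D (2 ^ n) (t / 2 ^ n) x) \<and> x + X (t + h) \<omega> \<in> - closure D" for t \<omega>
    using h by (cases "0 < t") (auto simp: Ev_def skeleton_def space_pair_measure max_def)
  interpret PL: pair_sigma_finite "lborel :: real measure" M ..
  have inf: "(INF n. indicator D x * (killed_step D (t / 2 ^ n) ^^ (2 ^ n)) (step_into (- closure D) h) x) = (\<integral>\<^sup>+\<omega>. indicator Ev (t, \<omega>) \<partial>M)"
    if t: "0 < t" for t
  proof -
    let ?B = "\<lambda>n::nat. {\<omega>\<in>skeleton D (2 ^ n) (t / 2 ^ n) x. x + X (t + h) \<omega> \<in> - closure D}"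
    have [measurable]: "X (t + h) \<in> borel_measurable M" using t h by (intro X_meas) simp
    have Bm: "?B n \<in> sets M" for n
    proof -
      have "?B n = skeleton D (2 ^ n) (t / 2 ^ n) x \<inter> {\<omega>\<in>space M. x + X (t + h) \<omega> \<in> - closure D}" by (auto simp: skeleton_def)
      also have "\<dots> \<in> sets M"
      proof (rule sets.Int)
        show "skeleton D (2 ^ n) (t / 2 ^ n) x \<in> sets M" using t by (intro skeleton_sets[OF Dm]) simp
        show "{\<omega>\<in>space M. x + X (t + h) \<omega> \<in> - closure D} \<in> sets M" by measurable
      qed
      finally show ?thesis .
    qed
    have "(INF n. indicator D x * (killed_step D (t / 2 ^ n) ^^ (2 ^ n)) (step_into (- closure D) h) x) = (INF n. emeasure M (?B n))"
      using t h by (simp add: skeleton_step_into[OF Dm Um])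
    also have "\<dots> = emeasure M (\<Inter>n. ?B n)"
    proof (rule INF_emeasure_decseq)
      show "range ?B \<subseteq> sets M" using Bm by auto
      show "decseq ?B" unfolding decseq_def using skeleton_dyadic_decseq[of t] t by fastforce
      show "emeasure M (?B i) \<noteq> \<infinity>" for i by simp
    qed
    also have "(\<Inter>n. ?B n) = {\<omega>\<in>space M. (t, \<omega>) \<in> Ev}"
      unfolding Ev_iff using t by (auto simp: skeleton_def)
    also have "emeasure M \<dots> = (\<integral>\<^sup>+\<omega>. indicator {\<omega>\<in>space M. (t, \<omega>) \<in> Ev} \<omega> \<partial>M)"
      by (rule nn_integral_indicator[symmetric]) measurable
    also have "\<dots> = (\<integral>\<^sup>+\<omega>. indicator Ev (t, \<omega>) \<partial>M)"
      by (rule nn_integral_cong) (auto simp: indicator_def)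
    finally show ?thesis .
  qed
  have "(\<integral>\<^sup>+t\<in>{0<..}. (INF n. indicator D x * (killed_step D (t / 2 ^ n) ^^ (2 ^ n)) (step_into (- closure D) h) x) \<partial>lborel)
    \<le> (\<integral>\<^sup>+t. (\<integral>\<^sup>+\<omega>. indicator Ev (t, \<omega>) \<partial>M) \<partial>lborel)"
  proof (rule nn_integral_mono)
    fix t :: real
    show "(INF n. indicator D x * (killed_step D (t / 2 ^ n) ^^ (2 ^ n)) (step_into (- closure D) h) x) * indicator {0<..} t \<le> (\<integral>\<^sup>+\<omega>. indicator Ev (t, \<omega>) \<partial>M)"
      by (cases "0 < t") (simp_all only: inf indicator_simps greaterThan_iff mult_1_right mult_zero_right order_refl zero_le not_False_eq_True)
  qed
  also have "\<dots> = (\<integral>\<^sup>+\<omega>. (\<integral>\<^sup>+t. indicator Ev (t, \<omega>) \<partial>lborel) \<partial>M)"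
    by (rule PL.Fubini'[symmetric]) measurable
  also have "\<dots> \<le> (\<integral>\<^sup>+\<omega>. ennreal h \<partial>M)"
  proof (rule nn_integral_mono)
    fix \<omega> assume \<omega>: "\<omega> \<in> space M"
    have "(\<integral>\<^sup>+t. indicator Ev (t, \<omega>) \<partial>lborel) = (\<integral>\<^sup>+t. indicator {t. (t, \<omega>) \<in> Ev} t \<partial>lborel)"
      by (rule nn_integral_cong) (auto simp: indicator_def)
    also have "\<dots> = emeasure lborel {t. (t, \<omega>) \<in> Ev}"
    proof (rule nn_integral_indicator)
      have "(\<lambda>t. (t, \<omega>)) -` Ev \<inter> space borel \<in> sets (borel :: real measure)"
        by (rule measurable_sets[OF _ Ev]) (use \<omega> in measurable)
      then show "{t. (t, \<omega>) \<in> Ev} \<in> sets lborel" by (simp add: vimage_def)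
    qed
    also have "\<dots> \<le> ennreal h"
      using last_step_times[OF D h \<omega>, of x] \<omega> unfolding Ev_iff by simp
    finally show "(\<integral>\<^sup>+t. indicator Ev (t, \<omega>) \<partial>lborel) \<le> ennreal h" .
  qed
  also have "\<dots> = ennreal h" by (simp add: emeasure_space_1)
  finally show ?thesis .
qed

end

section \<open>The killed transition density and the Green function\<close>

text \<open>The density is required to be jointly measurable and finite. Any transition density that is continuous
  off the origin has such a version, see \<open>density_version\<close> below.\<close>

locale killed_levy = levy_exit M X D for M :: "'w measure" and X :: "real \<Rightarrow> 'w \<Rightarrow> 'a::euclidean_space" and D +
  fixes p :: "real \<Rightarrow> 'a \<Rightarrow> ennreal"
  assumes p_joint: "(\<lambda>(s, z). p s z) \<in> borel_measurable (borel \<Otimes>\<^sub>M borel)"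
    and p_finite: "p s z < \<infinity>"
    and p_density: "0 < s \<Longrightarrow> distr M borel (X s) = density lborel (p s)"
begin

text \<open>The term that is subtracted in Hunt's formula for the heat kernel of \<open>D\<close>.\<close>

definition exit_part :: "real \<Rightarrow> 'a \<Rightarrow> 'a \<Rightarrow> ennreal" where
  "exit_part t x y = (\<integral>\<^sup>+\<omega>. (if exit_limit x \<omega> < ennreal t then p (t - enn2real (exit_limit x \<omega>)) (y - (x + X (enn2real (exit_limit x \<omega>)) \<omega>)) else 0) \<partial>M)"

definition killed_density :: "real \<Rightarrow> 'a \<Rightarrow> 'a \<Rightarrow> ennreal" where
  "killed_density t x y = p t (y - x) - exit_part t x y"

definition green_density :: "'a \<Rightarrow> 'a \<Rightarrow> ennreal" where
  "green_density x y = (\<integral>\<^sup>+t\<in>{0<..}. killed_density t x y \<partial>lborel)"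

lemma p_section [measurable]: "p s \<in> borel_measurable borel"
  using measurable_Pair2[OF p_joint, of s] by simp

lemma p_compose:
  assumes "f \<in> borel_measurable N" "g \<in> borel_measurable N"
  shows "(\<lambda>x. p (f x) (g x)) \<in> borel_measurable N"
  using measurable_compose[OF measurable_Pair[OF assms] p_joint] by simp

lemma exit_limit_compose:
  assumes "f \<in> borel_measurable N" "g \<in> N \<rightarrow>\<^sub>M M"
  shows "(\<lambda>x. exit_limit (f x) (g x)) \<in> borel_measurable N"
  using measurable_compose[OF measurable_Pair[OF assms] exit_limit_joint] by simp

lemma exit_part_joint [measurable]:
  "(\<lambda>(t, x, y). exit_part t x y) \<in> borel_measurable (borel \<Otimes>\<^sub>M borel \<Otimes>\<^sub>M borel)"
proof -
  have [measurable]: "(\<lambda>z. exit_limit (fst (snd (fst z))) (snd z)) \<in> borel_measurable ((borel \<Otimes>\<^sub>M borel \<Otimes>\<^sub>M borel) \<Otimes>\<^sub>M M)"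
    by (rule exit_limit_compose) measurable
  have [measurable]: "(\<lambda>z. X (enn2real (exit_limit (fst (snd (fst z))) (snd z))) (snd z)) \<in> borel_measurable ((borel \<Otimes>\<^sub>M borel \<Otimes>\<^sub>M borel) \<Otimes>\<^sub>M M)"
    by (rule X_joint') auto
  have [measurable]: "(\<lambda>z. p (fst (fst z) - enn2real (exit_limit (fst (snd (fst z))) (snd z)))
      (snd (snd (fst z)) - (fst (snd (fst z)) + X (enn2real (exit_limit (fst (snd (fst z))) (snd z))) (snd z))))
      \<in> borel_measurable ((borel \<Otimes>\<^sub>M borel \<Otimes>\<^sub>M borel) \<Otimes>\<^sub>M M)"
    by (rule p_compose) measurable
  have "(\<lambda>w. \<integral>\<^sup>+\<omega>. (if exit_limit (fst (snd w)) \<omega> < ennreal (fst w) then p (fst w - enn2real (exit_limit (fst (snd w)) \<omega>))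
      (snd (snd w) - (fst (snd w) + X (enn2real (exit_limit (fst (snd w)) \<omega>)) \<omega>)) else 0) \<partial>M) \<in> borel_measurable (borel \<Otimes>\<^sub>M borel \<Otimes>\<^sub>M borel)"
    by measurable
  then show ?thesis by (simp add: exit_part_def case_prod_beta)
qed

lemma killed_density_joint [measurable]:
  "(\<lambda>(t, x, y). killed_density t x y) \<in> borel_measurable (borel \<Otimes>\<^sub>M borel \<Otimes>\<^sub>M borel)"
proof -
  have [measurable]: "(\<lambda>w. p (fst w) (snd (snd w) - fst (snd w))) \<in> borel_measurable (borel \<Otimes>\<^sub>M borel \<Otimes>\<^sub>M borel)"
    by (rule p_compose) measurable
  have "(\<lambda>w. p (fst w) (snd (snd w) - fst (snd w)) - (\<lambda>(t, x, y). exit_part t x y) w) \<in> borel_measurable (borel \<Otimes>\<^sub>M borel \<Otimes>\<^sub>M borel)"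
    by measurable
  then show ?thesis by (simp add: killed_density_def case_prod_beta)
qed

lemma killed_density_compose:
  assumes "f \<in> borel_measurable N" "g \<in> borel_measurable N" "h \<in> borel_measurable N"
  shows "(\<lambda>x. killed_density (f x) (g x) (h x)) \<in> borel_measurable N"
  using measurable_compose[OF measurable_Pair[OF assms(1) measurable_Pair[OF assms(2,3)]] killed_density_joint] by simp

lemma green_density_joint [measurable]: "(\<lambda>(x, y). green_density x y) \<in> borel_measurable (borel \<Otimes>\<^sub>M borel)"
proof -
  have [measurable]: "(\<lambda>z. killed_density (snd z) (fst (fst z)) (snd (fst z))) \<in> borel_measurable ((borel \<Otimes>\<^sub>M borel) \<Otimes>\<^sub>M lborel)"
    by (rule killed_density_compose) measurable
  have "(\<lambda>w. \<integral>\<^sup>+t. killed_density t (fst w) (snd w) * indicator {0<..} t \<partial>lborel) \<in> borel_measurable (borel \<Otimes>\<^sub>M borel)"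
    by measurable
  then show ?thesis by (simp add: green_density_def case_prod_beta)
qed

lemma D_borel [measurable]: "D \<in> sets borel"
  using open_D by simp

text \<open>By the strong Markov property \<open>exit_part\<close> is the density of the law of \<open>x + X t\<close> on the event that the
  exit occurs before \<open>t\<close>. The truncated difference of the two densities is supported where it is positive, so it is
  enough to compare the measures there.\<close>

lemma killed_density_le:
  assumes t: "0 < t" and B[measurable]: "B \<in> sets borel"
  shows "(\<integral>\<^sup>+y\<in>B. killed_density t x y \<partial>lborel) \<le> emeasure M {\<omega>\<in>space M. x + X t \<omega> \<in> B \<and> ennreal t \<le> exit_limit x \<omega>}"
proof -
  note [measurable] = optional_time_measurable[OF optional_exit_limit[of x]]
  have [measurable]: "X t \<in> borel_measurable M" using t by (intro X_meas) simp
  have Hm[measurable]: "(\<lambda>y. exit_part t x y) \<in> borel_measurable borel"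
    using measurable_compose[OF _ exit_part_joint, of "\<lambda>y. (t, x, y)" borel] by simp
  have [measurable]: "(\<lambda>y. p t (y - x)) \<in> borel_measurable borel" by measurable
  \<comment> \<open>The part of \<open>B\<close> on which the difference is not truncated.\<close>
  define C where "C = {y\<in>B. exit_part t x y < p t (y - x)}"
  have C[measurable]: "C \<in> sets borel"
  proof -
    have "{y\<in>space borel. y \<in> B \<and> exit_part t x y < p t (y - x)} \<in> sets borel" by measurable
    then show ?thesis by (simp add: C_def)
  qed
  define I where "I = (\<integral>\<^sup>+y\<in>C. killed_density t x y \<partial>lborel)"
  have "(\<integral>\<^sup>+y\<in>B. killed_density t x y \<partial>lborel) \<le> I"
    unfolding I_def by (rule nn_integral_mono) (use p_finite in \<open>auto simp: C_def killed_density_def indicator_def diff_eq_0_iff_ennreal not_less\<close>)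
  moreover have "I + emeasure M {\<omega>\<in>space M. exit_limit x \<omega> < ennreal t \<and> x + X t \<omega> \<in> C} = emeasure M {\<omega>\<in>space M. x + X t \<omega> \<in> C}"
  proof -
    have "emeasure M {\<omega>\<in>space M. exit_limit x \<omega> < ennreal t \<and> x + X t \<omega> \<in> C} = (\<integral>\<^sup>+y\<in>C. exit_part t x y \<partial>lborel)"
      unfolding exit_part_def by (rule strong_markov_density[OF optional_exit_limit t p_joint p_density C])
    moreover have "emeasure M {\<omega>\<in>space M. x + X t \<omega> \<in> C} = (\<integral>\<^sup>+y\<in>C. p t (y - x) \<partial>lborel)"
    proof -
      have "emeasure M {\<omega>\<in>space M. x + X t \<omega> \<in> C} = (\<integral>\<^sup>+\<omega>. indicator {\<omega>\<in>space M. x + X t \<omega> \<in> C} \<omega> \<partial>M)" by simp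
      also have "\<dots> = (\<integral>\<^sup>+\<omega>. indicator C (x + X t \<omega>) \<partial>M)" by (rule nn_integral_cong) (auto simp: indicator_def)
      also have "\<dots> = (\<integral>\<^sup>+z. indicator C (x + z) \<partial>distr M borel (X t))" by (rule nn_integral_distr[symmetric]) measurable
      also have "\<dots> = (\<integral>\<^sup>+z. p t z * indicator C (x + z) \<partial>lborel)"
        unfolding p_density[OF t] by (rule nn_integral_density) measurable
      also have "\<dots> = (\<integral>\<^sup>+z. (\<lambda>y. p t (y - x) * indicator C y) (z + x) \<partial>lborel)" by (simp add: add.commute)
      also have "\<dots> = (\<integral>\<^sup>+y\<in>C. p t (y - x) \<partial>lborel)" by (rule nn_integral_lborel_translate) measurable
      finally show ?thesis .
    qed
    moreover have "I + (\<integral>\<^sup>+y\<in>C. exit_part t x y \<partial>lborel) = (\<integral>\<^sup>+y. killed_density t x y * indicator C y + exit_part t x y * indicator C y \<partial>lborel)"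
      unfolding I_def
    proof (rule nn_integral_add[symmetric])
      have "(\<lambda>y. killed_density t x y) \<in> borel_measurable lborel"
        by (rule killed_density_compose) measurable
      then show "(\<lambda>y. killed_density t x y * indicator C y) \<in> borel_measurable lborel" by measurable
    qed measurable
    moreover have "(\<integral>\<^sup>+y. killed_density t x y * indicator C y + exit_part t x y * indicator C y \<partial>lborel) = (\<integral>\<^sup>+y\<in>C. p t (y - x) \<partial>lborel)"
    proof (rule nn_integral_cong)
      fix y
      show "killed_density t x y * indicator C y + exit_part t x y * indicator C y = p t (y - x) * indicator C y"
        by (cases "y \<in> C") (auto simp: C_def killed_density_def diff_add_cancel_ennreal less_imp_le)
    qed
    ultimately show ?thesis by simp
  qed
  moreover have "emeasure M {\<omega>\<in>space M. x + X t \<omega> \<in> C} = emeasure M {\<omega>\<in>space M. x + X t \<omega> \<in> C \<and> ennreal t \<le> exit_limit x \<omega>}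
      + emeasure M {\<omega>\<in>space M. exit_limit x \<omega> < ennreal t \<and> x + X t \<omega> \<in> C}"
    by (subst plus_emeasure) (auto intro!: arg_cong[of _ _ "emeasure M"] simp: not_less)
  ultimately have "I + emeasure M {\<omega>\<in>space M. exit_limit x \<omega> < ennreal t \<and> x + X t \<omega> \<in> C} = emeasure M {\<omega>\<in>space M. x + X t \<omega> \<in> C \<and> ennreal t \<le> exit_limit x \<omega>}
      + emeasure M {\<omega>\<in>space M. exit_limit x \<omega> < ennreal t \<and> x + X t \<omega> \<in> C}" by simp
  then have "I = emeasure M {\<omega>\<in>space M. x + X t \<omega> \<in> C \<and> ennreal t \<le> exit_limit x \<omega>}"
    by (simp add: emeasure_eq_measure)
  also have "\<dots> \<le> emeasure M {\<omega>\<in>space M. x + X t \<omega> \<in> B \<and> ennreal t \<le> exit_limit x \<omega>}"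
    by (rule emeasure_mono) (auto simp: C_def)
  finally show ?thesis
    using \<open>(\<integral>\<^sup>+y\<in>B. killed_density t x y \<partial>lborel) \<le> I\<close> by (rule order_trans[rotated])
qed

text \<open>Before \<open>exit_limit\<close>, which is at most the exit time on every path, the path is in \<open>D\<close>.\<close>

lemma alive_skeleton:
  assumes \<omega>: "\<omega> \<in> space M" and x: "x \<in> D" and t: "0 < t" and end_in: "x + X t \<omega> \<in> D" and alive: "ennreal t \<le> exit_limit x \<omega>"
    and N: "0 < N"
  shows "\<omega> \<in> skeleton D N (t / real N) x"
  unfolding skeleton_def
proof (intro CollectI conjI \<omega> allI impI)
  fix k assume k: "k \<le> N"
  consider "k = 0" | "k = N" | "0 < k" "k < N" using k by linarith
  then show "x + X (real k * (t / real N)) \<omega> \<in> D"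
  proof cases
    case 1
    then show ?thesis using x X_zero[OF \<omega>] by simp
  next
    case 2
    then show ?thesis using end_in N by simp
  next
    case 3
    let ?r = "real k * (t / real N)"
    have r: "0 < ?r" "?r < t" using 3 t by (auto simp: field_simps)
    show ?thesis
    proof (rule ccontr)
      assume "x + X ?r \<omega> \<notin> D"
      then have "exit_time D X x \<omega> \<le> ennreal ?r"
        unfolding exit_time_def using r by (intro Inf_lower) auto
      then have "ennreal t \<le> ennreal ?r" using exit_limit_le_exit_time[OF \<omega>, of x] alive by (meson order_trans)
      then show False using r t by (simp add: ennreal_le_iff2)
    qed
  qed
qed

lemma killed_density_skeleton:
  assumes t: "0 < t" and x: "x \<in> D" and N: "0 < N" and f[measurable]: "f \<in> borel_measurable borel"
  shows "(\<integral>\<^sup>+y\<in>D. killed_density t x y * f y \<partial>lborel) \<le> indicator D x * (killed_step D (t / real N) ^^ N) f x"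
proof -
  have [measurable]: "X t \<in> borel_measurable M" using t by (intro X_meas) simp
  have km[measurable]: "(\<lambda>y. killed_density t x y) \<in> borel_measurable borel"
    by (rule killed_density_compose) measurable
  have s: "0 \<le> t / real N" using t by simp
  have [measurable]: "skeleton D N (t / real N) x \<in> sets M" by (rule skeleton_sets[OF D_borel s])
  define \<mu>1 where "\<mu>1 = density lborel (\<lambda>y. indicator D y * killed_density t x y)"
  define \<mu>2 where "\<mu>2 = distr (density M (indicator (skeleton D N (t / real N) x))) borel (\<lambda>\<omega>. x + X t \<omega>)"
  have "\<mu>1 \<le> \<mu>2"
  proof (subst le_measure)
    show "sets \<mu>1 = sets \<mu>2" by (simp add: \<mu>1_def \<mu>2_def)
    show "\<forall>A\<in>sets \<mu>1. emeasure \<mu>1 A \<le> emeasure \<mu>2 A"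
    proof
      fix A assume "A \<in> sets \<mu>1"
      then have [measurable]: "A \<in> sets borel" by (simp add: \<mu>1_def)
      note [measurable] = optional_time_measurable[OF optional_exit_limit[of x]]
      have "emeasure \<mu>1 A = (\<integral>\<^sup>+y\<in>A \<inter> D. killed_density t x y \<partial>lborel)"
        unfolding \<mu>1_def by (subst emeasure_density) (auto intro!: nn_integral_cong simp: indicator_def)
      also have "\<dots> \<le> emeasure M {\<omega>\<in>space M. x + X t \<omega> \<in> A \<inter> D \<and> ennreal t \<le> exit_limit x \<omega>}"
        by (rule killed_density_le[OF t]) measurable
      also have "\<dots> \<le> emeasure M {\<omega>\<in>space M. \<omega> \<in> skeleton D N (t / real N) x \<and> x + X t \<omega> \<in> A}"
        by (rule emeasure_mono) (auto intro: alive_skeleton[OF _ x t _ _ N])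
      also have "\<dots> = emeasure \<mu>2 A"
      proof -
        have "emeasure \<mu>2 A = (\<integral>\<^sup>+\<omega>. indicator (skeleton D N (t / real N) x) \<omega> * indicator A (x + X t \<omega>) \<partial>M)"
          unfolding \<mu>2_def
          by (subst nn_integral_indicator[symmetric], simp, subst nn_integral_distr, simp, simp, subst nn_integral_density) auto
        also have "\<dots> = (\<integral>\<^sup>+\<omega>. indicator {\<omega>\<in>space M. \<omega> \<in> skeleton D N (t / real N) x \<and> x + X t \<omega> \<in> A} \<omega> \<partial>M)"
          by (rule nn_integral_cong) (auto simp: indicator_def)
        finally show ?thesis by simp
      qed
      finally show "emeasure \<mu>1 A \<le> emeasure \<mu>2 A" .
    qed
  qed
  then have "(\<integral>\<^sup>+y. f y \<partial>\<mu>1) \<le> (\<integral>\<^sup>+y. f y \<partial>\<mu>2)"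
    by (intro nn_integral_mono_measure) (simp_all add: \<mu>1_def \<mu>2_def)
  moreover have "(\<integral>\<^sup>+y. f y \<partial>\<mu>1) = (\<integral>\<^sup>+y\<in>D. killed_density t x y * f y \<partial>lborel)"
    unfolding \<mu>1_def by (subst nn_integral_density) (auto intro!: nn_integral_cong simp: mult_ac)
  moreover have "(\<integral>\<^sup>+y. f y \<partial>\<mu>2) = (\<integral>\<^sup>+\<omega>. indicator (skeleton D N (t / real N) x) \<omega> * f (x + X (real N * (t / real N)) \<omega>) \<partial>M)"
    unfolding \<mu>2_def using N by (subst nn_integral_distr, simp, simp, subst nn_integral_density) auto
  ultimately show ?thesis
    using skeleton_expectation[OF D_borel f s, of N x] by simp
qed

lemma green_integral:
  assumes f[measurable]: "f \<in> borel_measurable borel"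
  shows "(\<integral>\<^sup>+y\<in>D. green_density x y * f y \<partial>lborel) = (\<integral>\<^sup>+t\<in>{0<..}. (\<integral>\<^sup>+y\<in>D. killed_density t x y * f y \<partial>lborel) \<partial>lborel)"
proof -
  have km[measurable]: "(\<lambda>z. killed_density (fst z) x (snd z)) \<in> borel_measurable (lborel \<Otimes>\<^sub>M lborel)"
    by (rule killed_density_compose) measurable
  have km2[measurable]: "(\<lambda>t. killed_density t x y) \<in> borel_measurable lborel" for y
    by (rule killed_density_compose) measurable
  have km3[measurable]: "(\<lambda>y. killed_density t x y) \<in> borel_measurable lborel" for t
    by (rule killed_density_compose) measurable
  have "(\<integral>\<^sup>+y\<in>D. green_density x y * f y \<partial>lborel) = (\<integral>\<^sup>+y. (\<integral>\<^sup>+t. killed_density t x y * indicator {0<..} t * (f y * indicator D y) \<partial>lborel) \<partial>lborel)"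
    unfolding green_density_def by (intro nn_integral_cong) (subst nn_integral_multc, simp_all add: mult_ac)
  also have "\<dots> = (\<integral>\<^sup>+t. (\<integral>\<^sup>+y. killed_density t x y * indicator {0<..} t * (f y * indicator D y) \<partial>lborel) \<partial>lborel)"
    by (rule lborel_pair.Fubini') (simp add: case_prod_beta)
  also have "\<dots> = (\<integral>\<^sup>+t\<in>{0<..}. (\<integral>\<^sup>+y\<in>D. killed_density t x y * f y \<partial>lborel) \<partial>lborel)"
    by (intro nn_integral_cong) (subst nn_integral_multc[symmetric], simp, simp add: mult_ac)
  finally show ?thesis .
qed

text \<open>Bound the killed density by its skeletons for every \<open>t\<close>, and count the last steps.\<close>

lemma green_step_into:
  assumes x: "x \<in> D" and h: "0 < h"
  shows "(\<integral>\<^sup>+y\<in>D. green_density x y * step_into (- closure D) h y \<partial>lborel) \<le> ennreal h"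
proof -
  have m: "step_into (- closure D) h \<in> borel_measurable borel" by (rule step_into_measurable) (use h in auto)
  have "(\<integral>\<^sup>+y\<in>D. green_density x y * step_into (- closure D) h y \<partial>lborel)
    = (\<integral>\<^sup>+t\<in>{0<..}. (\<integral>\<^sup>+y\<in>D. killed_density t x y * step_into (- closure D) h y \<partial>lborel) \<partial>lborel)"
    by (rule green_integral[OF m])
  also have "\<dots> \<le> (\<integral>\<^sup>+t\<in>{0<..}. (INF n. indicator D x * (killed_step D (t / 2 ^ n) ^^ (2 ^ n)) (step_into (- closure D) h) x) \<partial>lborel)"
  proof (rule nn_integral_mono)
    fix t :: real
    show "(\<integral>\<^sup>+y\<in>D. killed_density t x y * step_into (- closure D) h y \<partial>lborel) * indicator {0<..} t
      \<le> (INF n. indicator D x * (killed_step D (t / 2 ^ n) ^^ (2 ^ n)) (step_into (- closure D) h) x) * indicator {0<..} t"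
    proof (cases "0 < t")
      case True
      have "(\<integral>\<^sup>+y\<in>D. killed_density t x y * step_into (- closure D) h y \<partial>lborel)
        \<le> (INF n. indicator D x * (killed_step D (t / 2 ^ n) ^^ (2 ^ n)) (step_into (- closure D) h) x)"
      proof (rule INF_greatest)
        fix n :: nat
        show "(\<integral>\<^sup>+y\<in>D. killed_density t x y * step_into (- closure D) h y \<partial>lborel) \<le> indicator D x * (killed_step D (t / 2 ^ n) ^^ (2 ^ n)) (step_into (- closure D) h) x"
          using killed_density_skeleton[OF True x, of "2 ^ n", OF _ m] by simp
      qed
      then show ?thesis using True by simp
    qed simp
  qed
  also have "\<dots> \<le> ennreal h" by (rule exit_once_bound[OF open_D h])
  finally show ?thesis .
qed

text \<open>As for \<open>green_step_into\<close>, after moving the skeleton to the other factor by duality, where it becomes the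
  skeleton of \<open>-X\<close> with \<open>step_into\<close> as terminal value. The interchange of the infimum over the skeletons
  with the integral against \<open>f\<close> needs an integrable \<open>f\<close>; otherwise the right-hand side is infinite.\<close>

lemma green_step_into_dual:
  assumes h: "0 < h" and f[measurable]: "f \<in> borel_measurable borel"
  shows "(\<integral>\<^sup>+x\<in>D. rc_levy.step_into M (\<lambda>t \<omega>. - X t \<omega>) (- closure D) h x * (\<integral>\<^sup>+y\<in>D. green_density x y * f y \<partial>lborel) \<partial>lborel)
    \<le> ennreal h * (\<integral>\<^sup>+y\<in>D. f y \<partial>lborel)"
proof (cases "(\<integral>\<^sup>+y\<in>D. f y \<partial>lborel) < \<infinity>")
  case False
  then show ?thesis using h by (simp add: not_less top_unique ennreal_mult_top)
next
  case fin: True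
  interpret R: rc_levy M "\<lambda>t \<omega>. - X t \<omega>" by (rule rc_levy_uminus)
  let ?q = "R.step_into (- closure D) h"
  let ?Z = "\<lambda>t n y. indicator D y * (R.killed_step D (t / 2 ^ n) ^^ (2 ^ n)) ?q y"
  have Zj: "(\<lambda>(t, y). indicator {0<..} t * ?Z t n y) \<in> borel_measurable (borel \<Otimes>\<^sub>M borel)" for n
    using R.skeleton_step_into_joint[OF D_borel, of "- closure D" h "1 / 2 ^ n" "2 ^ n"] h by simp
  have Zj'[measurable]: "(\<lambda>z. indicator {0<..} (fst z) * ?Z (fst z) n (snd z)) \<in> borel_measurable (lborel \<Otimes>\<^sub>M lborel)" for n
    using Zj[of n] by (simp add: case_prod_beta)
  have Zj2[measurable]: "(\<lambda>t. indicator {0<..} t * ?Z t n y) \<in> borel_measurable lborel" for n y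
    using measurable_compose[OF _ Zj[of n], of "\<lambda>t. (t, y)" lborel] by simp
  have qm[measurable]: "?q \<in> borel_measurable borel" by (rule R.step_into_measurable) (use h in auto)
  have km[measurable]: "(\<lambda>z. killed_density (fst z) (fst (snd z)) (snd (snd z))) \<in> borel_measurable (lborel \<Otimes>\<^sub>M lborel \<Otimes>\<^sub>M lborel)"
    by (rule killed_density_compose) measurable
  have kI[measurable]: "(\<lambda>z. \<integral>\<^sup>+y\<in>D. killed_density (fst z) (snd z) y * f y \<partial>lborel) \<in> borel_measurable (lborel \<Otimes>\<^sub>M lborel)"
  proof -
    have [measurable]: "(\<lambda>w. killed_density (fst (fst w)) (snd (fst w)) (snd w)) \<in> borel_measurable ((lborel \<Otimes>\<^sub>M lborel) \<Otimes>\<^sub>M lborel)"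
      by (rule killed_density_compose) measurable
    show ?thesis by measurable
  qed
  have kI2[measurable]: "(\<lambda>t. \<integral>\<^sup>+y\<in>D. killed_density t x y * f y \<partial>lborel) \<in> borel_measurable lborel" for x
    using measurable_compose[OF _ kI, of "\<lambda>t. (t, x)" lborel] by simp
  have "(\<integral>\<^sup>+x\<in>D. ?q x * (\<integral>\<^sup>+y\<in>D. green_density x y * f y \<partial>lborel) \<partial>lborel)
    = (\<integral>\<^sup>+x. (\<integral>\<^sup>+t. (?q x * indicator D x) * ((\<integral>\<^sup>+y\<in>D. killed_density t x y * f y \<partial>lborel) * indicator {0<..} t) \<partial>lborel) \<partial>lborel)"
    unfolding green_integral[OF f]
    using kI2
    by (intro nn_integral_cong) (subst nn_integral_cmult, simp_all add: mult_ac)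
  also have "\<dots> = (\<integral>\<^sup>+t. (\<integral>\<^sup>+x. (?q x * indicator D x) * ((\<integral>\<^sup>+y\<in>D. killed_density t x y * f y \<partial>lborel) * indicator {0<..} t) \<partial>lborel) \<partial>lborel)"
    by (rule lborel_pair.Fubini') (simp add: case_prod_beta)
  also have "\<dots> \<le> (\<integral>\<^sup>+t. (\<integral>\<^sup>+y. f y * (INF n. ?Z t n y) \<partial>lborel) * indicator {0<..} t \<partial>lborel)"
  proof (rule nn_integral_mono)
    fix t :: real
    show "(\<integral>\<^sup>+x. (?q x * indicator D x) * ((\<integral>\<^sup>+y\<in>D. killed_density t x y * f y \<partial>lborel) * indicator {0<..} t) \<partial>lborel)
      \<le> (\<integral>\<^sup>+y. f y * (INF n. ?Z t n y) \<partial>lborel) * indicator {0<..} t"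
    proof (cases "0 < t")
      case t: True
      have Zm[measurable]: "(\<lambda>y. (R.killed_step D (t / 2 ^ n) ^^ (2 ^ n)) ?q y) \<in> borel_measurable borel" for n
        by (rule R.killed_steps_measurable) (use t in auto)
      have each: "(\<integral>\<^sup>+x. (?q x * indicator D x) * (\<integral>\<^sup>+y\<in>D. killed_density t x y * f y \<partial>lborel) \<partial>lborel) \<le> (\<integral>\<^sup>+y. f y * ?Z t n y \<partial>lborel)" for n
      proof -
        have "(\<integral>\<^sup>+x. (?q x * indicator D x) * (\<integral>\<^sup>+y\<in>D. killed_density t x y * f y \<partial>lborel) \<partial>lborel)
          \<le> (\<integral>\<^sup>+x. indicator D x * ?q x * (killed_step D (t / 2 ^ n) ^^ (2 ^ n)) f x \<partial>lborel)"
        proof (rule nn_integral_mono)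
          fix x :: 'a
          show "(?q x * indicator D x) * (\<integral>\<^sup>+y\<in>D. killed_density t x y * f y \<partial>lborel) \<le> indicator D x * ?q x * (killed_step D (t / 2 ^ n) ^^ (2 ^ n)) f x"
          proof (cases "x \<in> D")
            case True
            have "(\<integral>\<^sup>+y\<in>D. killed_density t x y * f y \<partial>lborel) \<le> (killed_step D (t / 2 ^ n) ^^ (2 ^ n)) f x"
              using killed_density_skeleton[OF t True, of "2 ^ n", OF _ f] True by simp
            then show ?thesis using True by (simp add: mult_left_mono)
          qed simp
        qed
        also have "\<dots> = (\<integral>\<^sup>+x. indicator D x * f x * (R.killed_step D (t / 2 ^ n) ^^ (2 ^ n)) ?q x \<partial>lborel)"
          by (rule killed_steps_dual) (use t in auto)
        finally show ?thesis by (simp add: mult_ac)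
      qed
      have Z_dec: "?Z t n y \<le> ?Z t m y" if "m \<le> n" for m n y
      proof -
        have Ze: "?Z t k y = emeasure M {\<omega>\<in>R.skeleton D (2 ^ k) (t / 2 ^ k) y. y + - X (real (2 ^ k) * (t / 2 ^ k) + h) \<omega> \<in> - closure D}" for k
          by (rule R.skeleton_step_into) (use t h in auto)
        have "{\<omega>\<in>R.skeleton D (2 ^ m) (t / 2 ^ m) y. y + - X (t + h) \<omega> \<in> - closure D} \<in> sets M"
        proof -
          have [measurable]: "X (t + h) \<in> borel_measurable M" using t h by (intro X_meas) simp
          have [measurable]: "R.skeleton D (2 ^ m) (t / 2 ^ m) y \<in> sets M" by (rule R.skeleton_sets) (use t in auto)
          have "{\<omega>\<in>R.skeleton D (2 ^ m) (t / 2 ^ m) y. y + - X (t + h) \<omega> \<in> - closure D}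
            = R.skeleton D (2 ^ m) (t / 2 ^ m) y \<inter> {\<omega>\<in>space M. y + - X (t + h) \<omega> \<in> - closure D}"
            by (auto simp: R.skeleton_def)
          also have "\<dots> \<in> sets M" by (intro sets.Int) measurable
          finally show ?thesis .
        qed
        then show ?thesis
          unfolding Ze using R.skeleton_dyadic_decseq[of t m n D y] t that by (intro emeasure_mono) auto
      qed
      have "(\<integral>\<^sup>+x. (?q x * indicator D x) * (\<integral>\<^sup>+y\<in>D. killed_density t x y * f y \<partial>lborel) \<partial>lborel) \<le> (INF n. \<integral>\<^sup>+y. f y * ?Z t n y \<partial>lborel)"
        by (rule INF_greatest) (rule each)
      also have "\<dots> = (\<integral>\<^sup>+y. (INF n. f y * ?Z t n y) \<partial>lborel)"
      proof (rule nn_integral_monotone_convergence_INF_decseq[symmetric])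
        show "decseq (\<lambda>n y. f y * ?Z t n y)"
          by (intro antimonoI le_funI mult_left_mono Z_dec) auto
        show "(\<lambda>y. f y * ?Z t n y) \<in> borel_measurable lborel" for n by measurable
        have "(\<integral>\<^sup>+y. f y * ?Z t n y \<partial>lborel) \<le> (\<integral>\<^sup>+y\<in>D. f y \<partial>lborel)" for n
        proof (rule nn_integral_mono)
          fix y
          have "(R.killed_step D (t / 2 ^ n) ^^ (2 ^ n)) ?q y \<le> 1" by (rule R.killed_steps_le) (rule R.step_into_le_1)
          then show "f y * ?Z t n y \<le> f y * indicator D y" by (intro mult_left_mono) (auto simp: indicator_def)
        qed
        then show "(\<integral>\<^sup>+y. f y * ?Z t n y \<partial>lborel) < \<infinity>" for n using fin le_less_trans by blast
      qed
      also have "\<dots> = (\<integral>\<^sup>+y. f y * (INF n. ?Z t n y) \<partial>lborel)"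
      proof (rule nn_integral_cong_AE)
        have "AE y in lborel. f y * indicator D y \<noteq> \<infinity>"
          by (rule nn_integral_PInf_AE) (use fin in auto)
        then show "AE y in lborel. (INF n. f y * ?Z t n y) = f y * (INF n. ?Z t n y)"
        proof eventually_elim
          case (elim y)
          show ?case
          proof (cases "y \<in> D")
            case True
            then have "f y \<noteq> \<infinity>" using elim by simp
            then have "(\<lambda>n. f y * ?Z t n y) \<longlonglongrightarrow> f y * (INF n. ?Z t n y)"
              by (intro ennreal_tendsto_cmult LIMSEQ_INF) (auto simp: less_top intro!: antimonoI Z_dec)
            moreover have "(\<lambda>n. f y * ?Z t n y) \<longlonglongrightarrow> (INF n. f y * ?Z t n y)"
              by (intro LIMSEQ_INF antimonoI mult_left_mono Z_dec) auto
            ultimately show ?thesis by (rule LIMSEQ_unique[rotated])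
          qed simp
        qed
      qed
      finally show ?thesis using t by simp
    qed simp
  qed
  also have "\<dots> = (\<integral>\<^sup>+t. (\<integral>\<^sup>+y. f y * (INF n. indicator {0<..} t * ?Z t n y) \<partial>lborel) \<partial>lborel)"
  proof (rule nn_integral_cong)
    fix t :: real
    show "(\<integral>\<^sup>+y. f y * (INF n. ?Z t n y) \<partial>lborel) * indicator {0<..} t = (\<integral>\<^sup>+y. f y * (INF n. indicator {0<..} t * ?Z t n y) \<partial>lborel)"
      by (cases "0 < t") simp_all
  qed
  also have "\<dots> = (\<integral>\<^sup>+y. (\<integral>\<^sup>+t. f y * (INF n. indicator {0<..} t * ?Z t n y) \<partial>lborel) \<partial>lborel)"
    by (rule lborel_pair.Fubini'[symmetric]) measurable
  also have "\<dots> \<le> (\<integral>\<^sup>+y. ennreal h * (f y * indicator D y) \<partial>lborel)"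
  proof (rule nn_integral_mono)
    fix y
    have "(\<integral>\<^sup>+t. f y * (INF n. indicator {0<..} t * ?Z t n y) \<partial>lborel) = f y * (\<integral>\<^sup>+t. (INF n. indicator {0<..} t * ?Z t n y) \<partial>lborel)"
      by (rule nn_integral_cmult) measurable
    also have "(\<integral>\<^sup>+t. (INF n. indicator {0<..} t * ?Z t n y) \<partial>lborel) = (\<integral>\<^sup>+t\<in>{0<..}. (INF n. ?Z t n y) \<partial>lborel)"
      by (rule nn_integral_cong) (simp add: indicator_def)
    also have "f y * \<dots> \<le> f y * (ennreal h * indicator D y)"
    proof (cases "y \<in> D")
      case True
      have "(\<integral>\<^sup>+t\<in>{0<..}. (INF n. ?Z t n y) \<partial>lborel) \<le> ennreal h" by (rule R.exit_once_bound[OF open_D h])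
      then show ?thesis using True by (intro mult_left_mono) auto
    qed simp
    finally show "(\<integral>\<^sup>+t. f y * (INF n. indicator {0<..} t * ?Z t n y) \<partial>lborel) \<le> ennreal h * (f y * indicator D y)"
      by (simp add: mult_ac)
  qed
  also have "\<dots> = ennreal h * (\<integral>\<^sup>+y\<in>D. f y \<partial>lborel)" by (rule nn_integral_cmult) measurable
  finally show ?thesis .
qed

end

section \<open>Killing rate\<close>

lemma ennreal_mult_liminf_le:
  fixes c :: ennreal and a :: "nat \<Rightarrow> ennreal"
  shows "c * liminf a \<le> liminf (\<lambda>k. c * a k)"
proof -
  have "c * liminf a = (SUP n. c * (INF m\<in>{n..}. a m))"
    unfolding liminf_SUP_INF by (rule SUP_mult_left_ennreal)
  also have "\<dots> \<le> (SUP n. INF m\<in>{n..}. c * a m)"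
    by (intro SUP_mono' INF_greatest mult_left_mono INF_lower) auto
  finally show ?thesis unfolding liminf_SUP_INF .
qed

lemma ennreal_Suc_inverse: "ennreal (real (Suc k)) * ennreal (1 / real (Suc k)) = 1"
proof -
  have "ennreal (real (Suc k)) * ennreal (1 / real (Suc k)) = ennreal (real (Suc k) * (1 / real (Suc k)))"
    by (rule ennreal_mult[symmetric]) simp_all
  also have "real (Suc k) * (1 / real (Suc k)) = 1" by simp
  finally show ?thesis by simp
qed

definition killing_rate :: "('a::euclidean_space \<Rightarrow> real) \<Rightarrow> 'a set \<Rightarrow> 'a \<Rightarrow> ennreal" where
  "killing_rate n D y = (\<integral>\<^sup>+z\<in>- D. ennreal (n (z - y)) \<partial>lborel)"

text \<open>Lower half of the vague convergence of \<open>\<bbbP>(X\<^sub>h \<in> dz) / h\<close> to the Levy measure off the origin, which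
  is the half that passes through Fatou's lemma.\<close>

definition jump_intensity_bound :: "'w measure \<Rightarrow> (real \<Rightarrow> 'w \<Rightarrow> 'a::euclidean_space) \<Rightarrow> ('a \<Rightarrow> real) \<Rightarrow> bool" where
  "jump_intensity_bound M X n \<longleftrightarrow> (\<forall>V. open V \<longrightarrow> 0 \<notin> closure V \<longrightarrow> (\<integral>\<^sup>+z\<in>V. ennreal (n z) \<partial>lborel)
     \<le> liminf (\<lambda>k. ennreal (real (Suc k)) * emeasure M {\<omega>\<in>space M. X (1 / real (Suc k)) \<omega> \<in> V}))"

context rc_levy begin

text \<open>The complement of \<open>D\<close> may be replaced by the complement of the closure, because the boundary is a null
  set; translated by \<open>- y\<close> this is an open set at a positive distance from the origin.\<close>

lemma killing_rate_le:
  assumes J: "jump_intensity_bound M X n" and n[measurable]: "n \<in> borel_measurable borel"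
    and D: "open D" "emeasure lborel (frontier D) = 0" and y: "y \<in> D"
  shows "killing_rate n D y \<le> liminf (\<lambda>k. ennreal (real (Suc k)) * step_into (- closure D) (1 / real (Suc k)) y)"
proof -
  define V where "V = {v. y + v \<in> - closure D}"
  have V: "open V"
  proof -
    have "V = (\<lambda>v. y + v) -` (- closure D)" by (auto simp: V_def)
    then show ?thesis by (simp add: open_vimage continuous_intros)
  qed
  have "0 \<notin> closure V"
  proof -
    have "open ((\<lambda>v. y + v) -` D)" using D(1) by (intro open_vimage continuous_intros)
    moreover have "0 \<in> (\<lambda>v. y + v) -` D" using y by simp
    moreover have "(\<lambda>v. y + v) -` D \<inter> V = {}" using closure_subset[of D] by (auto simp: V_def)
    ultimately show ?thesis using open_Int_closure_eq_empty by blast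
  qed
  have [measurable]: "D \<in> sets borel" "V \<in> sets borel" using D V by auto
  have fr: "frontier D \<in> null_sets lborel" using D by (intro null_setsI) auto
  have "killing_rate n D y = (\<integral>\<^sup>+z\<in>- closure D. ennreal (n (z - y)) \<partial>lborel)"
    unfolding killing_rate_def
  proof (rule nn_integral_cong_AE)
    show "AE z in lborel. ennreal (n (z - y)) * indicator (- D) z = ennreal (n (z - y)) * indicator (- closure D) z"
      using AE_not_in[OF fr]
    proof eventually_elim
      case (elim z)
      then show ?case using D(1) closure_subset[of D] by (auto simp: frontier_def interior_open indicator_def)
    qed
  qed
  also have "\<dots> = (\<integral>\<^sup>+z. ennreal (n (z + y - y)) * indicator (- closure D) (z + y) \<partial>lborel)"
    by (rule nn_integral_lborel_translate[symmetric]) measurable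
  also have "\<dots> = (\<integral>\<^sup>+z\<in>V. ennreal (n z) \<partial>lborel)"
    by (rule nn_integral_cong) (auto simp: V_def indicator_def add.commute)
  also have "\<dots> \<le> liminf (\<lambda>k. ennreal (real (Suc k)) * emeasure M {\<omega>\<in>space M. X (1 / real (Suc k)) \<omega> \<in> V})"
    using J V \<open>0 \<notin> closure V\<close> unfolding jump_intensity_bound_def by blast
  also have "\<dots> = liminf (\<lambda>k. ennreal (real (Suc k)) * step_into (- closure D) (1 / real (Suc k)) y)"
    by (simp add: step_into_def V_def)
  finally show ?thesis .
qed

end

context killed_levy begin

text \<open>Divide \<open>green_step_into\<close> by \<open>h\<close> and use Fatou's lemma.\<close>

lemma green_killing_rate:
  assumes J: "jump_intensity_bound M X n" and n[measurable]: "n \<in> borel_measurable borel"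
    and D: "emeasure lborel (frontier D) = 0" and x: "x \<in> D"
  shows "(\<integral>\<^sup>+y\<in>D. green_density x y * killing_rate n D y \<partial>lborel) \<le> 1"
proof -
  let ?q = "\<lambda>k. step_into (- closure D) (1 / real (Suc k))"
  have [measurable]: "?q k \<in> borel_measurable borel" for k by (rule step_into_measurable) auto
  have gm[measurable]: "(\<lambda>y. green_density x y) \<in> borel_measurable borel"
    using measurable_compose[OF _ green_density_joint, of "\<lambda>y. (x, y)" borel] by simp
  have "(\<integral>\<^sup>+y\<in>D. green_density x y * killing_rate n D y \<partial>lborel)
    \<le> (\<integral>\<^sup>+y. liminf (\<lambda>k. green_density x y * indicator D y * (ennreal (real (Suc k)) * ?q k y)) \<partial>lborel)"
  proof (rule nn_integral_mono)
    fix y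
    show "green_density x y * killing_rate n D y * indicator D y \<le> liminf (\<lambda>k. green_density x y * indicator D y * (ennreal (real (Suc k)) * ?q k y))"
    proof (cases "y \<in> D")
      case True
      have "green_density x y * killing_rate n D y \<le> green_density x y * liminf (\<lambda>k. ennreal (real (Suc k)) * ?q k y)"
        by (rule mult_left_mono[OF killing_rate_le[OF J n open_D D True]]) simp
      also have "\<dots> \<le> liminf (\<lambda>k. green_density x y * (ennreal (real (Suc k)) * ?q k y))"
        by (rule ennreal_mult_liminf_le)
      finally show ?thesis using True by simp
    qed simp
  qed
  also have "\<dots> \<le> liminf (\<lambda>k. \<integral>\<^sup>+y. green_density x y * indicator D y * (ennreal (real (Suc k)) * ?q k y) \<partial>lborel)"
    by (rule nn_integral_liminf) measurable
  also have "\<dots> \<le> liminf (\<lambda>k::nat. 1)"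
  proof (intro Liminf_mono always_eventually allI)
    fix k
    have "(\<integral>\<^sup>+y. green_density x y * indicator D y * (ennreal (real (Suc k)) * ?q k y) \<partial>lborel)
      = ennreal (real (Suc k)) * (\<integral>\<^sup>+y\<in>D. green_density x y * ?q k y \<partial>lborel)"
      by (subst nn_integral_cmult[symmetric], measurable, rule nn_integral_cong, simp only: mult_ac)
    also have "\<dots> \<le> ennreal (real (Suc k)) * ennreal (1 / real (Suc k))"
      by (rule mult_left_mono[OF green_step_into[OF x]]) auto
    also have "\<dots> = 1" by (rule ennreal_Suc_inverse)
    finally show "(\<integral>\<^sup>+y. green_density x y * indicator D y * (ennreal (real (Suc k)) * ?q k y) \<partial>lborel) \<le> 1" .
  qed
  finally show ?thesis by (simp add: Liminf_const)
qed

lemma green_killing_rate_dual: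
  assumes J: "jump_intensity_bound M (\<lambda>t \<omega>. - X t \<omega>) n" and n[measurable]: "n \<in> borel_measurable borel"
    and D: "emeasure lborel (frontier D) = 0" and f[measurable]: "f \<in> borel_measurable borel"
  shows "(\<integral>\<^sup>+x\<in>D. killing_rate n D x * (\<integral>\<^sup>+y\<in>D. green_density x y * f y \<partial>lborel) \<partial>lborel) \<le> (\<integral>\<^sup>+y\<in>D. f y \<partial>lborel)"
proof -
  interpret R: rc_levy M "\<lambda>t \<omega>. - X t \<omega>" by (rule rc_levy_uminus)
  let ?q = "\<lambda>k. R.step_into (- closure D) (1 / real (Suc k))"
  have [measurable]: "?q k \<in> borel_measurable borel" for k by (rule R.step_into_measurable) auto
  let ?G = "\<lambda>x. \<integral>\<^sup>+y\<in>D. green_density x y * f y \<partial>lborel"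
  have [measurable]: "?G \<in> borel_measurable borel" by measurable
  have "(\<integral>\<^sup>+x\<in>D. killing_rate n D x * ?G x \<partial>lborel)
    \<le> (\<integral>\<^sup>+x. liminf (\<lambda>k. ?G x * indicator D x * (ennreal (real (Suc k)) * ?q k x)) \<partial>lborel)"
  proof (rule nn_integral_mono)
    fix x
    show "killing_rate n D x * ?G x * indicator D x \<le> liminf (\<lambda>k. ?G x * indicator D x * (ennreal (real (Suc k)) * ?q k x))"
    proof (cases "x \<in> D")
      case True
      have "?G x * killing_rate n D x \<le> ?G x * liminf (\<lambda>k. ennreal (real (Suc k)) * ?q k x)"
        by (rule mult_left_mono[OF R.killing_rate_le[OF J n open_D D True]]) simp
      also have "\<dots> \<le> liminf (\<lambda>k. ?G x * (ennreal (real (Suc k)) * ?q k x))"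
        by (rule ennreal_mult_liminf_le)
      finally show ?thesis using True by (simp add: mult.commute)
    qed simp
  qed
  also have "\<dots> \<le> liminf (\<lambda>k. \<integral>\<^sup>+x. ?G x * indicator D x * (ennreal (real (Suc k)) * ?q k x) \<partial>lborel)"
    by (rule nn_integral_liminf) measurable
  also have "\<dots> \<le> liminf (\<lambda>k::nat. \<integral>\<^sup>+y\<in>D. f y \<partial>lborel)"
  proof (intro Liminf_mono always_eventually allI)
    fix k
    have "(\<integral>\<^sup>+x. ?G x * indicator D x * (ennreal (real (Suc k)) * ?q k x) \<partial>lborel)
      = ennreal (real (Suc k)) * (\<integral>\<^sup>+x\<in>D. ?q k x * ?G x \<partial>lborel)"
      by (subst nn_integral_cmult[symmetric], measurable, rule nn_integral_cong, simp only: mult_ac)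
    also have "\<dots> \<le> ennreal (real (Suc k)) * (ennreal (1 / real (Suc k)) * (\<integral>\<^sup>+y\<in>D. f y \<partial>lborel))"
      by (rule mult_left_mono[OF green_step_into_dual[OF _ f]]) auto
    also have "\<dots> = (\<integral>\<^sup>+y\<in>D. f y \<partial>lborel)" by (simp only: mult.assoc[symmetric] ennreal_Suc_inverse mult_1_left)
    finally show "(\<integral>\<^sup>+x. ?G x * indicator D x * (ennreal (real (Suc k)) * ?q k x) \<partial>lborel) \<le> (\<integral>\<^sup>+y\<in>D. f y \<partial>lborel)" .
  qed
  finally show ?thesis by (simp add: Liminf_const)
qed

end

lemma ball_average_tendsto:
  fixes f :: "'a::euclidean_space \<Rightarrow> ennreal"
  assumes [measurable]: "f \<in> borel_measurable borel" and f: "continuous_on (- {0}) f" and z: "z \<noteq> 0"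
  shows "(\<lambda>k. (\<integral>\<^sup>+v\<in>ball z (1 / real (Suc k)). f v \<partial>lborel) / emeasure lborel (ball z (1 / real (Suc k)))) \<longlonglongrightarrow> f z"
proof -
  let ?B = "\<lambda>k. ball z (1 / real (Suc k))"
  have vol: "0 < emeasure lborel (?B k)" "emeasure lborel (?B k) < \<infinity>" for k
    by (simp_all add: emeasure_ball unit_ball_vol_pos)
  have "continuous (at z) f" by (rule continuous_on_interior[OF f]) (use z in \<open>simp add: interior_open open_Compl\<close>)
  then have isc: "(f \<longlongrightarrow> f z) (nhds z)" by (simp only: isCont_def tendsto_at_iff_tendsto_nhds)
  have near: "\<forall>\<^sub>F k in sequentially. \<forall>v\<in>?B k. P v" if "\<forall>\<^sub>F v in nhds z. P v" for P
  proof -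
    from that have "\<exists>d>0. \<forall>v. dist v z < d \<longrightarrow> P v" by (simp only: eventually_nhds_metric)
    then obtain d where d: "d > 0" "\<forall>v. dist v z < d \<longrightarrow> P v" by (elim exE conjE)
    have "\<forall>\<^sub>F k in sequentially. 1 / real (Suc k) < d"
      using LIMSEQ_inverse_real_of_nat d(1) by (intro order_tendstoD(2)) (auto simp: inverse_eq_divide)
    then show ?thesis
    proof eventually_elim
      case (elim k)
      show ?case
      proof
        fix v assume "v \<in> ?B k"
        then have "dist v z < 1 / real (Suc k)" by (simp only: mem_ball dist_commute)
        then show "P v" using elim d(2) by simp
      qed
    qed
  qed
  have cancel: "c * emeasure lborel (?B k) / emeasure lborel (?B k) = c" for c :: ennreal and k
    using vol[of k] by (simp add: ennreal_mult_divide_eq)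
  show ?thesis
  proof (rule order_tendstoI)
    fix a assume "a < f z"
    then obtain a' where a': "a < a'" "a' < f z" using dense by blast
    have "\<forall>\<^sub>F v in nhds z. a' < f v" using a'(2) by (rule order_tendstoD(1)[OF isc])
    then show "\<forall>\<^sub>F k in sequentially. a < (\<integral>\<^sup>+v\<in>?B k. f v \<partial>lborel) / emeasure lborel (?B k)"
    proof (rule eventually_mono[OF near])
      fix k assume k: "\<forall>v\<in>?B k. a' < f v"
      have "a' * emeasure lborel (?B k) = (\<integral>\<^sup>+v\<in>?B k. a' \<partial>lborel)" by (simp add: nn_integral_cmult_indicator)
      also have "\<dots> \<le> (\<integral>\<^sup>+v\<in>?B k. f v \<partial>lborel)" using k by (intro nn_integral_mono) (auto simp: indicator_def less_imp_le)
      finally have "a' * emeasure lborel (?B k) / emeasure lborel (?B k) \<le> (\<integral>\<^sup>+v\<in>?B k. f v \<partial>lborel) / emeasure lborel (?B k)"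
        by (rule divide_right_mono_ennreal)
      then show "a < (\<integral>\<^sup>+v\<in>?B k. f v \<partial>lborel) / emeasure lborel (?B k)" using a'(1) unfolding cancel by (rule less_le_trans[rotated])
    qed
  next
    fix b assume "f z < b"
    then obtain b' where b': "f z < b'" "b' < b" using dense by blast
    have "\<forall>\<^sub>F v in nhds z. f v < b'" using b'(1) by (rule order_tendstoD(2)[OF isc])
    then show "\<forall>\<^sub>F k in sequentially. (\<integral>\<^sup>+v\<in>?B k. f v \<partial>lborel) / emeasure lborel (?B k) < b"
    proof (rule eventually_mono[OF near])
      fix k assume k: "\<forall>v\<in>?B k. f v < b'"
      have "(\<integral>\<^sup>+v\<in>?B k. f v \<partial>lborel) \<le> (\<integral>\<^sup>+v\<in>?B k. b' \<partial>lborel)" using k by (intro nn_integral_mono) (auto simp: indicator_def less_imp_le)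
      also have "\<dots> = b' * emeasure lborel (?B k)" by (simp add: nn_integral_cmult_indicator)
      finally have "(\<integral>\<^sup>+v\<in>?B k. f v \<partial>lborel) / emeasure lborel (?B k) \<le> b' * emeasure lborel (?B k) / emeasure lborel (?B k)"
        by (rule divide_right_mono_ennreal)
      then show "(\<integral>\<^sup>+v\<in>?B k. f v \<partial>lborel) / emeasure lborel (?B k) < b" using b'(2) unfolding cancel by (rule le_less_trans)
    qed
  qed
qed

section \<open>The Green function of the jump process\<close>

lemma ennreal_enn2real_le: "ennreal (enn2real x) \<le> x"
  by (cases x) auto

text \<open>The profile is continuous off the origin; its value at \<open>0\<close> is allowed to be infinite.\<close>

lemma levy_profile_measurable:
  assumes "cond_A1 \<nu>"
  shows "(\<lambda>z::'a::euclidean_space. \<nu> (norm z)) \<in> borel_measurable borel"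
proof -
  obtain \<nu>' where \<nu>': "\<And>r. 0 < r \<Longrightarrow> ((\<lambda>s. enn2real (\<nu> s)) has_real_derivative \<nu>' r) (at r)"
    and fin: "\<And>r. 0 < r \<Longrightarrow> \<nu> r < \<infinity>"
    using assms unfolding cond_A1_def by blast
  have "continuous_on {0<..} (\<lambda>s. enn2real (\<nu> s))"
    by (rule continuous_at_imp_continuous_on) (auto intro: DERIV_isCont[OF \<nu>'])
  then have "continuous_on (- {0}) (\<lambda>z::'a. enn2real (\<nu> (norm z)))"
    by (rule continuous_on_compose2[where f=norm]) (auto intro: continuous_intros)
  then have [measurable]: "(\<lambda>z::'a. indicator (- {0}) z *\<^sub>R enn2real (\<nu> (norm z))) \<in> borel_measurable borel"
    by (intro borel_measurable_continuous_on_indicator) auto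
  have "(\<lambda>z::'a. if z = 0 then \<nu> 0 else ennreal (indicator (- {0}) z *\<^sub>R enn2real (\<nu> (norm z)))) \<in> borel_measurable borel"
    by measurable
  also have "(\<lambda>z::'a. if z = 0 then \<nu> 0 else ennreal (indicator (- {0}) z *\<^sub>R enn2real (\<nu> (norm z)))) = (\<lambda>z. \<nu> (norm z))"
    using fin by (auto simp: fun_eq_iff ennreal_enn2real)
  finally show ?thesis .
qed

lemma levy_profile_integrable:
  assumes "levy_density TYPE('a::euclidean_space) \<nu>" "cond_A1 \<nu>"
  shows "integrable lborel (\<lambda>z::'a. min ((norm z)\<^sup>2) 1 * enn2real (\<nu> (norm z)))"
proof (rule integrableI_nonneg)
  have [measurable]: "(\<lambda>z::'a. \<nu> (norm z)) \<in> borel_measurable borel" by (rule levy_profile_measurable) fact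
  show "(\<lambda>z::'a. min ((norm z)\<^sup>2) 1 * enn2real (\<nu> (norm z))) \<in> borel_measurable lborel" by measurable
  have "(\<integral>\<^sup>+z. ennreal (min ((norm z)\<^sup>2) 1 * enn2real (\<nu> (norm z))) \<partial>(lborel :: 'a measure))
    \<le> (\<integral>\<^sup>+z. ennreal (min ((norm z)\<^sup>2) 1) * \<nu> (norm z) \<partial>(lborel :: 'a measure))"
    by (intro nn_integral_mono) (simp add: ennreal_mult' mult_left_mono[OF ennreal_enn2real_le])
  also have "\<dots> < \<infinity>" using assms by (simp add: levy_density_def)
  finally show "(\<integral>\<^sup>+z. ennreal (min ((norm z)\<^sup>2) 1 * enn2real (\<nu> (norm z))) \<partial>(lborel :: 'a measure)) < \<infinity>" .
qed auto

lemma levy_process_rc: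
  assumes "levy_process M X"
  shows "rc_levy M (\<lambda>t \<omega>. X t \<omega> - X 0 \<omega>)"
proof -
  interpret prob_space M using assms by (simp add: levy_process_def)
  have Xm: "X t \<in> borel_measurable M" if "0 \<le> t" for t using assms that by (simp add: levy_process_def)
  have st: "distr M borel (\<lambda>\<omega>. X t \<omega> - X s \<omega>) = distr M borel (X (t - s))" if "0 \<le> s" "s \<le> t" for s t
    using assms that by (simp add: levy_process_def)
  show ?thesis
  proof
    show "(\<lambda>\<omega>. X t \<omega> - X 0 \<omega>) \<in> borel_measurable M" if "0 \<le> t" for t using Xm that by simp
    show "indep_vars (\<lambda>_. borel) (\<lambda>i \<omega>. X (ts (Suc i)) \<omega> - X 0 \<omega> - (X (ts i) \<omega> - X 0 \<omega>)) {..<n}"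
      if "0 \<le> ts 0" "\<And>i. i < n \<Longrightarrow> ts i \<le> ts (Suc i)" for ts :: "nat \<Rightarrow> real" and n
      using assms that by (simp add: levy_process_def)
    show "distr M borel (\<lambda>\<omega>. X t \<omega> - X 0 \<omega> - (X s \<omega> - X 0 \<omega>)) = distr M borel (\<lambda>\<omega>. X (t - s) \<omega> - X 0 \<omega>)"
      if "0 \<le> s" "s \<le> t" for s t
      using st[OF that] st[of 0 "t - s"] that by simp
    show "((\<lambda>s. X s \<omega> - X 0 \<omega>) \<longlongrightarrow> X t \<omega> - X 0 \<omega>) (at_right t)" if "\<omega> \<in> space M" "0 \<le> t" for \<omega> t
      using assms that by (intro tendsto_intros) (simp add: levy_process_def continuous_within)
  qed simp
qed

text \<open>Stated for any process with this exponent: it is applied to the given process and, since the exponent is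
  even, to its negative.\<close>

lemma jump_intensity_bound_levy:
  fixes X :: "real \<Rightarrow> 'w \<Rightarrow> 'a::euclidean_space"
  assumes lev: "levy_density TYPE('a) \<nu>" and A1: "cond_A1 \<nu>" and "rc_levy M X"
    and char: "\<And>t \<xi>. 0 < t \<Longrightarrow> (LINT z|distr M borel (X t). cis (\<xi> \<bullet> z)) = complex_of_real (exp (- t * levy_exponent \<nu> \<xi>))"
  shows "jump_intensity_bound M X (\<lambda>z. enn2real (\<nu> (norm z)))"
  unfolding jump_intensity_bound_def
proof (intro allI impI)
  interpret rc_levy M X by fact
  fix V :: "'a set" assume V: "open V" "0 \<notin> closure V"
  have [measurable]: "(\<lambda>z::'a. \<nu> (norm z)) \<in> borel_measurable borel" by (rule levy_profile_measurable[OF A1])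
  define Q where "Q k = distr M borel (X (1 / real (Suc k)))" for k
  have Xm[measurable]: "X (1 / real (Suc k)) \<in> borel_measurable M" for k by (rule X_meas) simp
  have "(\<integral>\<^sup>+z\<in>V. ennreal (enn2real (\<nu> (norm z))) \<partial>lborel) \<le> liminf (\<lambda>k. ennreal (1 / (1 / real (Suc k))) * emeasure (Q k) V)"
  proof (rule small_time_jump_bound)
    show "(\<lambda>z::'a. enn2real (\<nu> (norm z))) \<in> borel_measurable borel" by measurable
    show "integrable lborel (\<lambda>z::'a. min ((norm z)\<^sup>2) 1 * enn2real (\<nu> (norm z)))"
      by (rule levy_profile_integrable[OF lev A1])
    show "(\<lambda>k. 1 / real (Suc k)) \<longlonglongrightarrow> 0" using LIMSEQ_inverse_real_of_nat by (simp add: inverse_eq_divide)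
    show "prob_space (Q k)" for k unfolding Q_def by (rule prob_space_distr) (rule Xm)
    show "sets (Q k) = sets borel" for k by (simp add: Q_def)
    show "(LINT z|Q k. cis (\<xi> \<bullet> z)) = complex_of_real (exp (- (1 / real (Suc k)) * (LINT z|lborel. (1 - cos (\<xi> \<bullet> z)) * enn2real (\<nu> (norm z)))))" for k \<xi>
      unfolding Q_def using char[of "1 / real (Suc k)" \<xi>] by (simp only: levy_exponent_def) simp
  qed (use V in auto)
  also have "(\<lambda>k. ennreal (1 / (1 / real (Suc k))) * emeasure (Q k) V) = (\<lambda>k. ennreal (real (Suc k)) * emeasure M {\<omega>\<in>space M. X (1 / real (Suc k)) \<omega> \<in> V})"
  proof
    fix k
    have "emeasure (Q k) V = emeasure M (X (1 / real (Suc k)) -` V \<inter> space M)"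
      unfolding Q_def by (rule emeasure_distr[OF Xm]) (use V in simp)
    also have "X (1 / real (Suc k)) -` V \<inter> space M = {\<omega>\<in>space M. X (1 / real (Suc k)) \<omega> \<in> V}" by auto
    finally show "ennreal (1 / (1 / real (Suc k))) * emeasure (Q k) V = ennreal (real (Suc k)) * emeasure M {\<omega>\<in>space M. X (1 / real (Suc k)) \<omega> \<in> V}"
      by simp
  qed
  finally show "(\<integral>\<^sup>+z\<in>V. ennreal (enn2real (\<nu> (norm z))) \<partial>lborel) \<le> liminf (\<lambda>k. ennreal (real (Suc k)) * emeasure M {\<omega>\<in>space M. X (1 / real (Suc k)) \<omega> \<in> V})" .
qed

text \<open>A density that is continuous off the origin is there the limit of averages over balls, and these are
  probabilities, jointly measurable in time and space by right-continuity of the paths.\<close>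

definition (in rc_levy) density_version :: "real \<Rightarrow> 'a \<Rightarrow> ennreal" where
  "density_version s z =
     (let a = liminf (\<lambda>k. emeasure M {\<omega>\<in>space M. X (max 0 s) \<omega> \<in> ball z (1 / real (Suc k))} / emeasure lborel (ball (0::'a) (1 / real (Suc k))))
      in if z = 0 \<or> a = \<infinity> then 0 else a)"

context rc_levy begin

lemma density_version_joint: "(\<lambda>(s, z). density_version s z) \<in> borel_measurable (borel \<Otimes>\<^sub>M borel)"
proof -
  have X1[measurable]: "(\<lambda>w. X (max 0 (fst (fst w))) (snd w)) \<in> borel_measurable ((borel \<Otimes>\<^sub>M borel) \<Otimes>\<^sub>M M)"
    by (rule X_joint') auto
  have em[measurable]: "(\<lambda>w. emeasure M {\<omega>\<in>space M. X (max 0 (fst w)) \<omega> \<in> ball (snd w) r}) \<in> borel_measurable (borel \<Otimes>\<^sub>M borel)" for r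
  proof -
    define E where "E = {v \<in> space ((borel \<Otimes>\<^sub>M borel) \<Otimes>\<^sub>M M). dist (snd (fst v)) (X (max 0 (fst (fst v))) (snd v)) < r}"
    have [measurable]: "E \<in> sets ((borel \<Otimes>\<^sub>M borel) \<Otimes>\<^sub>M M)" unfolding E_def by measurable
    have "(\<lambda>w. emeasure M (Pair w -` E)) \<in> borel_measurable (borel \<Otimes>\<^sub>M borel)"
      by (rule measurable_emeasure_Pair) measurable
    also have "(\<lambda>w. emeasure M (Pair w -` E)) = (\<lambda>w. emeasure M {\<omega>\<in>space M. X (max 0 (fst w)) \<omega> \<in> ball (snd w) r})"
      by (intro ext arg_cong[of _ _ "emeasure M"]) (auto simp: E_def space_pair_measure)
    finally show ?thesis .
  qed
  have [measurable]: "(\<lambda>w. liminf (\<lambda>k. emeasure M {\<omega>\<in>space M. X (max 0 (fst w)) \<omega> \<in> ball (snd w) (1 / real (Suc k))} / emeasure lborel (ball (0::'a) (1 / real (Suc k)))))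
    \<in> borel_measurable (borel \<Otimes>\<^sub>M borel)"
    by (intro borel_measurable_liminf borel_measurable_divide_ennreal em borel_measurable_const)
  show ?thesis unfolding density_version_def case_prod_beta Let_def by measurable
qed

lemma density_version_finite: "density_version s z < \<infinity>"
  by (auto simp: density_version_def Let_def less_top)

lemma density_version_eq:
  assumes s: "0 < s" and f[measurable]: "f \<in> borel_measurable borel" and d: "distr M borel (X s) = density lborel f"
    and c: "continuous_on (- {0}) f" and z: "z \<noteq> 0" and fin: "f z < \<infinity>"
  shows "density_version s z = f z"
proof -
  have [measurable]: "X s \<in> borel_measurable M" using s by (intro X_meas) simp
  have e: "emeasure M {\<omega>\<in>space M. X s \<omega> \<in> ball z r} = (\<integral>\<^sup>+v\<in>ball z r. f v \<partial>lborel)" for r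
  proof -
    have "emeasure M {\<omega>\<in>space M. X s \<omega> \<in> ball z r} = emeasure (distr M borel (X s)) (ball z r)"
      by (subst emeasure_distr) (auto intro!: arg_cong[of _ _ "emeasure M"])
    also have "\<dots> = (\<integral>\<^sup>+v\<in>ball z r. f v \<partial>lborel)" unfolding d by (rule emeasure_density) auto
    finally show ?thesis .
  qed
  have "(\<lambda>k. emeasure M {\<omega>\<in>space M. X s \<omega> \<in> ball z (1 / real (Suc k))} / emeasure lborel (ball (0::'a) (1 / real (Suc k)))) \<longlonglongrightarrow> f z"
    using ball_average_tendsto[OF f c z] unfolding e by (simp add: emeasure_ball)
  then have "liminf (\<lambda>k. emeasure M {\<omega>\<in>space M. X s \<omega> \<in> ball z (1 / real (Suc k))} / emeasure lborel (ball (0::'a) (1 / real (Suc k)))) = f z"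
    by (rule lim_imp_Liminf[rotated]) simp
  then show ?thesis using s z fin by (simp add: density_version_def Let_def)
qed

end

text \<open>The process minus its initial value falls under \<open>killed_levy\<close>. The Green function agrees off the diagonal
  with the one built from \<open>exit_limit\<close> and \<open>density_version\<close>: almost surely the exit times
  coincide, and the exit position, being outside \<open>D\<close>, differs from the endpoint, so the
  density is never evaluated at the origin.\<close>

theorem green_function_inputs:
  fixes D :: "'a::euclidean_space set" and X :: "real \<Rightarrow> 'w \<Rightarrow> 'a"
  assumes lev: "levy_density TYPE('a) \<nu>" and jp: "jump_process \<nu> M X pt" and A1: "cond_A1 \<nu>"
    and D: "open D" "- D \<noteq> {}" and fr: "emeasure lborel (frontier D) = 0"
  defines "\<kappa> \<equiv> killing_rate (\<lambda>z. enn2real (\<nu> (norm z))) D"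
  obtains G where "(\<lambda>(x, y). G x y) \<in> borel_measurable (borel \<Otimes>\<^sub>M borel)"
    and "\<And>x y. x \<in> D \<Longrightarrow> y \<in> D \<Longrightarrow> x \<noteq> y \<Longrightarrow> green M X pt D x y = G x y"
    and "\<And>x. x \<in> D \<Longrightarrow> (\<integral>\<^sup>+y\<in>D. G x y * \<kappa> y \<partial>lborel) \<le> 1"
    and "\<And>f. f \<in> borel_measurable borel \<Longrightarrow> (\<integral>\<^sup>+x\<in>D. \<kappa> x * (\<integral>\<^sup>+y\<in>D. G x y * f y \<partial>lborel) \<partial>lborel) \<le> (\<integral>\<^sup>+y\<in>D. f y \<partial>lborel)"
proof -
  define Y where "Y t \<omega> = X t \<omega> - X 0 \<omega>" for t \<omega>
  have lp: "levy_process M X" and td: "transition_density \<nu> pt" and dens: "\<And>t. 0 < t \<Longrightarrow> distr M borel (X t) = density lborel (pt t)"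
    using jp by (auto simp: jump_process_def)
  interpret Y: rc_levy M Y unfolding Y_def by (rule levy_process_rc[OF lp])
  have ptm: "pt t \<in> borel_measurable borel" and ptc: "continuous_on (- {0}) (pt t)" and ptf: "\<And>x. x \<noteq> 0 \<Longrightarrow> pt t x < \<infinity>"
    and ptchar: "\<And>\<xi>. (LINT x|density lborel (pt t). cis (\<xi> \<bullet> x)) = complex_of_real (exp (- t * levy_exponent \<nu> \<xi>))" if "0 < t" for t
    using td that by (auto simp: transition_density_def)
  have Ydist: "distr M borel (Y t) = density lborel (pt t)" if "0 < t" for t
    using lp that dens[OF that] unfolding Y_def by (auto simp: levy_process_def)
  define p where "p = Y.density_version"
  have p_eq: "p t z = pt t z" if "0 < t" "z \<noteq> 0" for t z
    unfolding p_def by (rule Y.density_version_eq) (use that ptm ptc ptf Ydist in auto)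
  have AE_nz: "AE z in (lborel :: 'a measure). z \<noteq> 0" by (rule AE_lborel_singleton)
  interpret K: killed_levy M Y D p
  proof
    show "open D" "- D \<noteq> {}" by fact+
    show "(\<lambda>(s, z). p s z) \<in> borel_measurable (borel \<Otimes>\<^sub>M borel)" unfolding p_def by (rule Y.density_version_joint)
    then have pm: "p s \<in> borel_measurable borel" for s using measurable_Pair2[of "\<lambda>(s, z). p s z" borel borel borel s] by simp
    show "p s z < \<infinity>" for s z unfolding p_def by (rule Y.density_version_finite)
    show "distr M borel (Y s) = density lborel (p s)" if "0 < s" for s
      unfolding Ydist[OF that] by (rule density_cong) (use ptm[OF that] pm AE_nz p_eq[OF that] in auto)
  qed
  let ?n = "\<lambda>z::'a. enn2real (\<nu> (norm z))"
  have [measurable]: "(\<lambda>z::'a. \<nu> (norm z)) \<in> borel_measurable borel" by (rule levy_profile_measurable[OF A1])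
  have nm: "?n \<in> borel_measurable borel" by measurable
  have charY: "(LINT z|distr M borel (Y t). cis (\<xi> \<bullet> z)) = complex_of_real (exp (- t * levy_exponent \<nu> \<xi>))" if "0 < t" for t \<xi>
    using Ydist[OF that] ptchar[OF that] by simp
  have J: "jump_intensity_bound M Y ?n"
    by (rule jump_intensity_bound_levy[OF lev A1 Y.rc_levy_axioms charY])
  \<comment> \<open>The reversed process has the same exponent, because the exponent is even.\<close>
  have J': "jump_intensity_bound M (\<lambda>t \<omega>. - Y t \<omega>) ?n"
  proof (rule jump_intensity_bound_levy[OF lev A1 Y.rc_levy_uminus])
    fix t :: real and \<xi> :: 'a assume t: "0 < t"
    have [measurable]: "Y t \<in> borel_measurable M" using t by (intro Y.X_meas) simp
    have "(LINT z|distr M borel (\<lambda>\<omega>. - Y t \<omega>). cis (\<xi> \<bullet> z)) = (LINT z|distr M borel (Y t). cis ((- \<xi>) \<bullet> z))"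
      by (simp add: integral_distr)
    also have "\<dots> = complex_of_real (exp (- t * levy_exponent \<nu> (- \<xi>)))" by (rule charY[OF t])
    also have "levy_exponent \<nu> (- \<xi>) = levy_exponent \<nu> \<xi>" by (simp add: levy_exponent_def)
    finally show "(LINT z|distr M borel (\<lambda>\<omega>. - Y t \<omega>). cis (\<xi> \<bullet> z)) = complex_of_real (exp (- t * levy_exponent \<nu> \<xi>))" .
  qed
  have X0: "AE \<omega> in M. X 0 \<omega> = 0" using lp by (simp add: levy_process_def)
  have green_eq: "green M X pt D x y = K.green_density x y" if x: "x \<in> D" and y: "y \<in> D" and ne: "x \<noteq> y" for x y
    unfolding green_def K.green_density_def
  proof (rule nn_integral_cong)
    fix t :: real
    show "dirichlet_heat_kernel M X pt D t x y * indicator {0<..} t = K.killed_density t x y * indicator {0<..} t"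
    proof (cases "0 < t")
      case t: True
      have "(\<integral>\<^sup>+\<omega>. (if exit_time D X x \<omega> < ennreal t
            then let \<tau> = enn2real (exit_time D X x \<omega>) in pt (t - \<tau>) (y - (x + X \<tau> \<omega>)) else 0) \<partial>M) = K.exit_part t x y"
        unfolding K.exit_part_def
      proof (rule nn_integral_cong_AE)
        show "AE \<omega> in M. (if exit_time D X x \<omega> < ennreal t
            then let \<tau> = enn2real (exit_time D X x \<omega>) in pt (t - \<tau>) (y - (x + X \<tau> \<omega>)) else 0)
          = (if K.exit_limit x \<omega> < ennreal t then p (t - enn2real (K.exit_limit x \<omega>)) (y - (x + Y (enn2real (K.exit_limit x \<omega>)) \<omega>)) else 0)"
          using X0 K.exit_time_eq_exit_limit[OF x] K.exit_limit_position[OF x]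
        proof eventually_elim
          case (elim \<omega>)
          have XY: "X s \<omega> = Y s \<omega>" for s using elim(1) by (simp add: Y_def)
          have ee: "exit_time D X x \<omega> = K.exit_limit x \<omega>" using elim(2) by (simp add: exit_time_def XY)
          show ?case
          proof (cases "K.exit_limit x \<omega> < ennreal t")
            case True
            have "0 < t - enn2real (K.exit_limit x \<omega>)" using True by (cases "K.exit_limit x \<omega>") (auto simp: ennreal_less_iff)
            moreover have "y - (x + Y (enn2real (K.exit_limit x \<omega>)) \<omega>) \<noteq> 0"
              using elim(3) True y less_trans[OF True ennreal_less_top] by auto
            ultimately show ?thesis using True by (simp add: ee XY Let_def p_eq)
          qed (simp add: ee)
        qed
      qed
      moreover have "pt t (y - x) = p t (y - x)" using p_eq[OF t, of "y - x"] ne by simp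
      ultimately show ?thesis unfolding dirichlet_heat_kernel_def K.killed_density_def by simp
    qed simp
  qed
  show ?thesis
  proof (rule that[of K.green_density])
    show "(\<lambda>(x, y). K.green_density x y) \<in> borel_measurable (borel \<Otimes>\<^sub>M borel)" by (rule K.green_density_joint)
    show "(\<integral>\<^sup>+y\<in>D. K.green_density x y * \<kappa> y \<partial>lborel) \<le> 1" if "x \<in> D" for x
      unfolding \<kappa>_def by (rule K.green_killing_rate[OF J nm fr that])
    show "(\<integral>\<^sup>+x\<in>D. \<kappa> x * (\<integral>\<^sup>+y\<in>D. K.green_density x y * f y \<partial>lborel) \<partial>lborel) \<le> (\<integral>\<^sup>+y\<in>D. f y \<partial>lborel)"
      if "f \<in> borel_measurable borel" for f
      unfolding \<kappa>_def by (rule K.green_killing_rate_dual[OF J' nm fr that])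
  qed (rule green_eq)
qed

section \<open>Interaction kernels\<close>

text \<open>The tangent line inequality for the convex function \<open>a powr p\<close>, from Young's inequality for \<open>a / s\<close>
  and \<open>1\<close>.\<close>

lemma powr_tangent:
  fixes a s p :: real
  assumes a: "0 \<le> a" and s: "0 < s" and p: "1 < p"
  shows "s powr p + p * s powr (p - 1) * (a - s) \<le> a powr p"
proof -
  let ?r = "a / s" and ?q = "p / (p - 1)"
  have "?r * 1 \<le> ?r powr p / p + 1 powr ?q / ?q"
    by (rule Youngs_inequality) (use a s p in \<open>auto simp: field_simps\<close>)
  then have "?r \<le> ?r powr p / p + (p - 1) / p" using p by simp
  then have "p * ?r \<le> p * (?r powr p / p + (p - 1) / p)" using p by (intro mult_left_mono) auto
  also have "\<dots> = ?r powr p + (p - 1)" using p by (simp add: distrib_left)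
  finally have "p * ?r \<le> ?r powr p + (p - 1)" .
  then have "(1 + p * (?r - 1)) * s powr p \<le> ?r powr p * s powr p"
    by (intro mult_right_mono) (auto simp: algebra_simps)
  also have "\<dots> = a powr p" using a s by (simp add: powr_divide)
  also have "(1 + p * (?r - 1)) * s powr p = s powr p + p * s powr (p - 1) * (a - s)"
  proof -
    have "s powr p = s powr (p - 1) * s" using s by (simp add: powr_diff)
    then show ?thesis using s by (simp add: field_simps)
  qed
  finally show ?thesis .
qed

text \<open>The number \<open>m\<close> may exceed the total mass. Integrating the tangent line at \<open>s = (\<integral>f)/m\<close> gives
  \<open>s\<^sup>p (\<mu> + p (m - \<mu>))\<close> with \<open>\<mu>\<close> the total mass, and this is at least \<open>s\<^sup>p m\<close> as \<open>p \<ge> 1\<close>.\<close>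

lemma jensen_submarkov:
  fixes f :: "'b \<Rightarrow> real" and m p :: real
  assumes [measurable]: "f \<in> borel_measurable M" and f: "\<And>x. 0 \<le> f x" and p: "1 < p" and m: "0 < m"
    and mass: "emeasure M (space M) \<le> ennreal m" and R: "(\<integral>\<^sup>+x. ennreal (f x powr p) \<partial>M) < \<infinity>"
  shows "(\<integral>\<^sup>+x. ennreal (f x) \<partial>M) < \<infinity>"
    and "ennreal ((enn2real (\<integral>\<^sup>+x. ennreal (f x) \<partial>M) / m) powr p * m) \<le> (\<integral>\<^sup>+x. ennreal (f x powr p) \<partial>M)"
proof -
  interpret finite_measure M by standard (use mass in \<open>auto simp: top_unique\<close>)
  have \<mu>: "measure M (space M) \<le> m" using mass m by (simp add: emeasure_eq_measure)
  have ip: "integrable M (\<lambda>x. f x powr p)" using R by (intro integrableI_nonneg) auto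
  have le: "f x \<le> 1 + f x powr p" for x
  proof (cases "f x \<le> 1")
    case False
    then have "f x powr 1 \<le> f x powr p" using p by (intro powr_mono) auto
    then show ?thesis using False by simp
  qed (simp add: add_increasing2)
  have i: "integrable M f"
    by (rule Bochner_Integration.integrable_bound[of _ "\<lambda>x. 1 + f x powr p"]) (use ip le f in \<open>auto simp: abs_of_nonneg add_nonneg_nonneg\<close>)
  have e: "(\<integral>\<^sup>+x. ennreal (f x) \<partial>M) = ennreal (LINT x|M. f x)" by (rule nn_integral_eq_integral[OF i]) (use f in auto)
  show "(\<integral>\<^sup>+x. ennreal (f x) \<partial>M) < \<infinity>" by (simp add: e)
  have nn: "0 \<le> (LINT x|M. f x)" by (rule Bochner_Integration.integral_nonneg) (rule f)
  define s where "s = (LINT x|M. f x) / m"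
  have s0: "0 \<le> s" using nn m by (simp add: s_def)
  have "s powr p * m \<le> (LINT x|M. f x powr p)"
  proof (cases "s = 0")
    case True
    then show ?thesis by (simp add: Bochner_Integration.integral_nonneg)
  next
    case False
    then have s: "0 < s" using s0 by simp
    have "s powr p * m \<le> s powr p * measure M (space M) + p * s powr (p - 1) * ((LINT x|M. f x) - s * measure M (space M))"
    proof -
      have sp: "s powr (p - 1) * s = s powr p" using s by (simp add: powr_diff)
      have "(LINT x|M. f x) = s * m" using m by (simp add: s_def)
      then have "p * s powr (p - 1) * ((LINT x|M. f x) - s * measure M (space M)) = p * (s powr (p - 1) * s) * (m - measure M (space M))"
        by (simp add: algebra_simps)
      also have "\<dots> = p * (s powr p * (m - measure M (space M)))" by (simp add: sp)
      also have "\<dots> \<ge> 1 * (s powr p * (m - measure M (space M)))"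
        using p \<mu> by (intro mult_right_mono) auto
      finally show ?thesis by (simp add: algebra_simps)
    qed
    also have "\<dots> = (LINT x|M. s powr p + p * s powr (p - 1) * (f x - s))"
      using i by (simp add: algebra_simps)
    also have "\<dots> \<le> (LINT x|M. f x powr p)"
      by (rule integral_mono) (use i ip powr_tangent[OF f s p] in auto)
    finally show ?thesis .
  qed
  moreover have "(\<integral>\<^sup>+x. ennreal (f x powr p) \<partial>M) = ennreal (LINT x|M. f x powr p)"
    by (rule nn_integral_eq_integral[OF ip]) auto
  ultimately show "ennreal ((enn2real (\<integral>\<^sup>+x. ennreal (f x) \<partial>M) / m) powr p * m) \<le> (\<integral>\<^sup>+x. ennreal (f x powr p) \<partial>M)"
    using nn by (simp add: e s_def ennreal_leI)
qed

lemma powr_add_le: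
  fixes a b p :: real
  assumes "0 \<le> a" "0 \<le> b" "0 \<le> p"
  shows "(a + b) powr p \<le> 2 powr p * (a powr p + b powr p)"
proof -
  have "(a + b) powr p \<le> (2 * max a b) powr p" using assms by (intro powr_mono2) auto
  also have "\<dots> = 2 powr p * max a b powr p" using assms by (simp add: powr_mult)
  also have "max a b powr p \<le> a powr p + b powr p" by (auto simp: max_def)
  finally show ?thesis by (simp add: mult_left_mono)
qed

text \<open>Crude growth bound; it shows that the form is finite on the weighted Lebesgue space.\<close>

lemma bregman_le:
  assumes p: "2 \<le> p"
  shows "bregman p a b \<le> (1 + 2 * p) * (\<bar>a\<bar> powr p + \<bar>b\<bar> powr p)"
proof -
  have pp: "\<bar>a\<bar> powr (p - 1) * \<bar>a\<bar> = \<bar>a\<bar> powr p" by (cases "a = 0") (simp_all add: powr_diff)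
  have cross: "\<bar>a\<bar> powr (p - 1) * \<bar>b\<bar> \<le> \<bar>a\<bar> powr p + \<bar>b\<bar> powr p"
  proof (cases "\<bar>a\<bar> \<le> \<bar>b\<bar>")
    case True
    then have "\<bar>a\<bar> powr (p - 1) * \<bar>b\<bar> \<le> \<bar>b\<bar> powr (p - 1) * \<bar>b\<bar>" using p by (intro mult_right_mono powr_mono2) auto
    also have "\<dots> = \<bar>b\<bar> powr p" by (cases "b = 0") (simp_all add: powr_diff)
    finally show ?thesis by (simp add: add_increasing)
  next
    case False
    then have "\<bar>a\<bar> powr (p - 1) * \<bar>b\<bar> \<le> \<bar>a\<bar> powr (p - 1) * \<bar>a\<bar>" by (intro mult_left_mono) auto
    then show ?thesis unfolding pp by (simp add: add_increasing2)
  qed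
  have "\<bar>signed_powr a (p - 1) * (b - a)\<bar> \<le> \<bar>a\<bar> powr (p - 1) * (\<bar>b\<bar> + \<bar>a\<bar>)"
    unfolding signed_powr_def abs_mult by (intro mult_mono) (auto simp: sgn_if)
  also have "\<dots> \<le> 2 * (\<bar>a\<bar> powr p + \<bar>b\<bar> powr p)"
    using cross pp by (simp add: algebra_simps) (smt (verit) powr_ge_zero)
  finally have "p * \<bar>signed_powr a (p - 1) * (b - a)\<bar> \<le> p * (2 * (\<bar>a\<bar> powr p + \<bar>b\<bar> powr p))"
    using p by (intro mult_left_mono) auto
  moreover have "p * (- (signed_powr a (p - 1) * (b - a))) \<le> p * \<bar>signed_powr a (p - 1) * (b - a)\<bar>"
    using p by (intro mult_left_mono) auto
  ultimately have "- (p * signed_powr a (p - 1) * (b - a)) \<le> 2 * p * (\<bar>a\<bar> powr p + \<bar>b\<bar> powr p)"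
    by (simp add: mult.assoc distrib_left)
  moreover have "0 \<le> \<bar>a\<bar> powr p" by simp
  ultimately have "bregman p a b \<le> (\<bar>a\<bar> powr p + \<bar>b\<bar> powr p) + 2 * p * (\<bar>a\<bar> powr p + \<bar>b\<bar> powr p)"
    unfolding bregman_def by linarith
  then show ?thesis by (simp only: distrib_right mult_1_left)
qed

lemma ennreal_norm_integral_le:
  fixes f :: "'b \<Rightarrow> real"
  shows "ennreal \<bar>LINT x|M. f x\<bar> \<le> (\<integral>\<^sup>+x. ennreal \<bar>f x\<bar> \<partial>M)"
proof (cases "integrable M f")
  case True
  then show ?thesis using integral_norm_bound_ennreal[OF True] by simp
qed (simp add: not_integrable_integral_eq)

text \<open>The analytic part of the argument uses the process only through the two mass bounds for the Green
  function, so it is separated from the probability.\<close>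

locale exterior_kernel =
  fixes D :: "'a::euclidean_space set" and J G :: "'a \<Rightarrow> 'a \<Rightarrow> ennreal"
  assumes D_borel [measurable]: "D \<in> sets borel"
    and J_joint: "(\<lambda>(x, z). J x z) \<in> borel_measurable (borel \<Otimes>\<^sub>M borel)"
    and G_joint: "(\<lambda>(x, y). G x y) \<in> borel_measurable (borel \<Otimes>\<^sub>M borel)"
    and J_sym: "J x z = J z x" and J_pos: "0 < J x z"
    and green_row: "x \<in> D \<Longrightarrow> (\<integral>\<^sup>+y\<in>D. G x y * (\<integral>\<^sup>+z\<in>- D. J y z \<partial>lborel) \<partial>lborel) \<le> 1"
    and green_col: "f \<in> borel_measurable borel \<Longrightarrow>
      (\<integral>\<^sup>+x\<in>D. (\<integral>\<^sup>+z\<in>- D. J x z \<partial>lborel) * (\<integral>\<^sup>+y\<in>D. G x y * f y \<partial>lborel) \<partial>lborel) \<le> (\<integral>\<^sup>+y\<in>D. f y \<partial>lborel)"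
begin

definition weight :: "'a \<Rightarrow> ennreal" where
  "weight z = (\<integral>\<^sup>+x\<in>D. J x z \<partial>lborel)"

definition poisson :: "'a \<Rightarrow> 'a \<Rightarrow> ennreal" where
  "poisson x z = (\<integral>\<^sup>+y\<in>D. G x y * J y z \<partial>lborel)"

definition interaction :: "'a \<Rightarrow> 'a \<Rightarrow> ennreal" where
  "interaction w z = (\<integral>\<^sup>+x\<in>D. J w x * poisson x z \<partial>lborel)"

lemma J_compose: "f \<in> borel_measurable N \<Longrightarrow> g \<in> borel_measurable N \<Longrightarrow> (\<lambda>x. J (f x) (g x)) \<in> borel_measurable N"
  using measurable_compose[OF measurable_Pair J_joint, of f N g] by simp

lemma G_compose: "f \<in> borel_measurable N \<Longrightarrow> g \<in> borel_measurable N \<Longrightarrow> (\<lambda>x. G (f x) (g x)) \<in> borel_measurable N"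
  using measurable_compose[OF measurable_Pair G_joint, of f N g] by simp

lemma weight_measurable [measurable]: "weight \<in> borel_measurable borel"
proof -
  have [measurable]: "(\<lambda>w. J (snd w) (fst w)) \<in> borel_measurable (borel \<Otimes>\<^sub>M lborel)" by (rule J_compose) measurable
  show ?thesis unfolding weight_def by measurable
qed

lemma poisson_joint: "(\<lambda>w. poisson (fst w) (snd w)) \<in> borel_measurable (borel \<Otimes>\<^sub>M borel)"
proof -
  have [measurable]: "(\<lambda>w. G (fst (fst w)) (snd w)) \<in> borel_measurable ((borel \<Otimes>\<^sub>M borel) \<Otimes>\<^sub>M lborel)" by (rule G_compose) measurable
  have [measurable]: "(\<lambda>w. J (snd w) (snd (fst w))) \<in> borel_measurable ((borel \<Otimes>\<^sub>M borel) \<Otimes>\<^sub>M lborel)" by (rule J_compose) measurable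
  show ?thesis unfolding poisson_def by measurable
qed

lemma poisson_compose: "f \<in> borel_measurable N \<Longrightarrow> g \<in> borel_measurable N \<Longrightarrow> (\<lambda>x. poisson (f x) (g x)) \<in> borel_measurable N"
  using measurable_compose[OF measurable_Pair poisson_joint, of f N g] by simp

lemma interaction_joint: "(\<lambda>w. interaction (fst w) (snd w)) \<in> borel_measurable (borel \<Otimes>\<^sub>M borel)"
proof -
  have [measurable]: "(\<lambda>w. poisson (snd w) (snd (fst w))) \<in> borel_measurable ((borel \<Otimes>\<^sub>M borel) \<Otimes>\<^sub>M lborel)" by (rule poisson_compose) measurable
  have [measurable]: "(\<lambda>w. J (fst (fst w)) (snd w)) \<in> borel_measurable ((borel \<Otimes>\<^sub>M borel) \<Otimes>\<^sub>M lborel)" by (rule J_compose) measurable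
  show ?thesis unfolding interaction_def by measurable
qed

lemma interaction_compose: "f \<in> borel_measurable N \<Longrightarrow> g \<in> borel_measurable N \<Longrightarrow> (\<lambda>x. interaction (f x) (g x)) \<in> borel_measurable N"
  using measurable_compose[OF measurable_Pair interaction_joint, of f N g] by simp

lemma poisson_mass:
  assumes x: "x \<in> D"
  shows "(\<integral>\<^sup>+z\<in>- D. poisson x z \<partial>lborel) \<le> 1"
proof -
  have [measurable]: "(\<lambda>y. G x y) \<in> borel_measurable lborel" by (rule G_compose) measurable
  have [measurable]: "(\<lambda>z. J y z) \<in> borel_measurable lborel" "(\<lambda>y. J y z) \<in> borel_measurable lborel" for y z by (rule J_compose; measurable)+
  have [measurable]: "(\<lambda>w. J (fst w) (snd w)) \<in> borel_measurable (lborel \<Otimes>\<^sub>M lborel)" by (rule J_compose) measurable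
  have "(\<integral>\<^sup>+z\<in>- D. poisson x z \<partial>lborel) = (\<integral>\<^sup>+z. (\<integral>\<^sup>+y. G x y * indicator D y * (J y z * indicator (- D) z) \<partial>lborel) \<partial>lborel)"
    unfolding poisson_def by (intro nn_integral_cong) (subst nn_integral_multc[symmetric], measurable, simp only: mult_ac)
  also have "\<dots> = (\<integral>\<^sup>+y. (\<integral>\<^sup>+z. G x y * indicator D y * (J y z * indicator (- D) z) \<partial>lborel) \<partial>lborel)"
    by (rule lborel_pair.Fubini') measurable
  also have "\<dots> = (\<integral>\<^sup>+y\<in>D. G x y * (\<integral>\<^sup>+z\<in>- D. J y z \<partial>lborel) \<partial>lborel)"
    by (intro nn_integral_cong) (subst nn_integral_cmult, measurable, simp only: mult_ac)
  also have "\<dots> \<le> 1" by (rule green_row[OF x])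
  finally show ?thesis .
qed

text \<open>The outgoing half of the bound: every point of \<open>D\<close> distributes Poisson mass at most one.\<close>

lemma interaction_row: "(\<integral>\<^sup>+z\<in>- D. interaction w z \<partial>lborel) \<le> weight w"
proof -
  have [measurable]: "(\<lambda>x. J w x) \<in> borel_measurable lborel" by (rule J_compose) measurable
  have [measurable]: "(\<lambda>z. poisson x z) \<in> borel_measurable lborel" "(\<lambda>x. poisson x z) \<in> borel_measurable lborel" for x z by (rule poisson_compose; measurable)+
  have [measurable]: "(\<lambda>w. poisson (fst w) (snd w)) \<in> borel_measurable (lborel \<Otimes>\<^sub>M lborel)" by (rule poisson_compose) measurable
  have "(\<integral>\<^sup>+z\<in>- D. interaction w z \<partial>lborel) = (\<integral>\<^sup>+z. (\<integral>\<^sup>+x. J w x * indicator D x * (poisson x z * indicator (- D) z) \<partial>lborel) \<partial>lborel)"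
    unfolding interaction_def by (intro nn_integral_cong) (subst nn_integral_multc[symmetric], measurable, simp only: mult_ac)
  also have "\<dots> = (\<integral>\<^sup>+x. (\<integral>\<^sup>+z. J w x * indicator D x * (poisson x z * indicator (- D) z) \<partial>lborel) \<partial>lborel)"
    by (rule lborel_pair.Fubini') measurable
  also have "\<dots> = (\<integral>\<^sup>+x. J w x * indicator D x * (\<integral>\<^sup>+z\<in>- D. poisson x z \<partial>lborel) \<partial>lborel)"
    by (intro nn_integral_cong nn_integral_cmult) measurable
  also have "\<dots> \<le> (\<integral>\<^sup>+x. J x w * indicator D x \<partial>lborel)"
  proof (rule nn_integral_mono)
    fix x
    show "J w x * indicator D x * (\<integral>\<^sup>+z\<in>- D. poisson x z \<partial>lborel) \<le> J x w * indicator D x"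
    proof (cases "x \<in> D")
      case True
      then show ?thesis using mult_left_mono[OF poisson_mass[OF True], of "J w x"] by (simp add: J_sym[of w x])
    qed simp
  qed
  finally show ?thesis by (simp add: weight_def)
qed

text \<open>Integrating over the first argument produces the jump rate out of \<open>D\<close> in front of the Green function,
  which is the situation of \<open>green_col\<close> with \<open>f = J(\<cdot>, z)\<close>.\<close>

lemma interaction_col: "(\<integral>\<^sup>+w\<in>- D. interaction w z \<partial>lborel) \<le> weight z"
proof -
  have [measurable]: "(\<lambda>w. J w x) \<in> borel_measurable lborel" "(\<lambda>y. J x y) \<in> borel_measurable lborel" for x by (rule J_compose; measurable)+
  have [measurable]: "(\<lambda>w. J (snd w) (fst w)) \<in> borel_measurable (lborel \<Otimes>\<^sub>M lborel)" by (rule J_compose) measurable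
  have [measurable]: "(\<lambda>x. poisson x z) \<in> borel_measurable lborel" by (rule poisson_compose) measurable
  have "(\<integral>\<^sup>+w\<in>- D. interaction w z \<partial>lborel) = (\<integral>\<^sup>+w. (\<integral>\<^sup>+x. poisson x z * indicator D x * (J w x * indicator (- D) w) \<partial>lborel) \<partial>lborel)"
    unfolding interaction_def by (intro nn_integral_cong) (subst nn_integral_multc[symmetric], measurable, simp only: mult_ac)
  also have "\<dots> = (\<integral>\<^sup>+x. (\<integral>\<^sup>+w. poisson x z * indicator D x * (J w x * indicator (- D) w) \<partial>lborel) \<partial>lborel)"
    by (rule lborel_pair.Fubini') measurable
  also have "\<dots> = (\<integral>\<^sup>+x. poisson x z * indicator D x * (\<integral>\<^sup>+w\<in>- D. J w x \<partial>lborel) \<partial>lborel)"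
    by (intro nn_integral_cong nn_integral_cmult) measurable
  also have "\<dots> = (\<integral>\<^sup>+x\<in>D. (\<integral>\<^sup>+w\<in>- D. J x w \<partial>lborel) * (\<integral>\<^sup>+y\<in>D. G x y * J y z \<partial>lborel) \<partial>lborel)"
  proof (rule nn_integral_cong)
    fix x
    have e: "(\<integral>\<^sup>+w\<in>- D. J w x \<partial>lborel) = (\<integral>\<^sup>+w\<in>- D. J x w \<partial>lborel)"
      by (rule nn_integral_cong, rule arg_cong2[of _ _ _ _ "(*)", OF J_sym refl])
    show "poisson x z * indicator D x * (\<integral>\<^sup>+w\<in>- D. J w x \<partial>lborel) = (\<integral>\<^sup>+w\<in>- D. J x w \<partial>lborel) * (\<integral>\<^sup>+y\<in>D. G x y * J y z \<partial>lborel) * indicator D x"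
      unfolding e poisson_def by (simp only: mult_ac)
  qed
  also have "\<dots> \<le> (\<integral>\<^sup>+y\<in>D. J y z \<partial>lborel)"
    by (rule green_col) (rule J_compose, measurable)
  finally show ?thesis by (simp add: weight_def)
qed

lemma weighted_interaction_col:
  assumes [measurable]: "\<phi> \<in> borel_measurable borel"
  shows "(\<integral>\<^sup>+z\<in>- D. (\<integral>\<^sup>+w\<in>- D. \<phi> w * interaction z w \<partial>lborel) \<partial>lborel) \<le> (\<integral>\<^sup>+w\<in>- D. weight w * \<phi> w \<partial>lborel)"
proof -
  have [measurable]: "(\<lambda>w. interaction (snd w) (fst w)) \<in> borel_measurable (lborel \<Otimes>\<^sub>M lborel)" by (rule interaction_compose) measurable
  have [measurable]: "(\<lambda>w. interaction z w) \<in> borel_measurable lborel" "(\<lambda>z. interaction z w) \<in> borel_measurable lborel" for z w by (rule interaction_compose; measurable)+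
  have "(\<integral>\<^sup>+z\<in>- D. (\<integral>\<^sup>+w\<in>- D. \<phi> w * interaction z w \<partial>lborel) \<partial>lborel)
    = (\<integral>\<^sup>+z. (\<integral>\<^sup>+w. \<phi> w * indicator (- D) w * (interaction z w * indicator (- D) z) \<partial>lborel) \<partial>lborel)"
    by (intro nn_integral_cong) (subst nn_integral_multc[symmetric], measurable, simp only: mult_ac)
  also have "\<dots> = (\<integral>\<^sup>+w. (\<integral>\<^sup>+z. \<phi> w * indicator (- D) w * (interaction z w * indicator (- D) z) \<partial>lborel) \<partial>lborel)"
    by (rule lborel_pair.Fubini') measurable
  also have "\<dots> = (\<integral>\<^sup>+w. \<phi> w * indicator (- D) w * (\<integral>\<^sup>+z\<in>- D. interaction z w \<partial>lborel) \<partial>lborel)"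
    by (intro nn_integral_cong nn_integral_cmult) measurable
  also have "\<dots> \<le> (\<integral>\<^sup>+w. \<phi> w * indicator (- D) w * weight w \<partial>lborel)"
    by (intro nn_integral_mono mult_left_mono interaction_col) auto
  finally show ?thesis by (simp only: mult_ac)
qed

lemma weighted_interaction_row:
  assumes [measurable]: "\<phi> \<in> borel_measurable borel"
  shows "(\<integral>\<^sup>+z\<in>- D. (\<integral>\<^sup>+w\<in>- D. \<phi> z * interaction z w \<partial>lborel) \<partial>lborel) \<le> (\<integral>\<^sup>+w\<in>- D. weight w * \<phi> w \<partial>lborel)"
proof (rule nn_integral_mono)
  fix z
  have [measurable]: "(\<lambda>w. interaction z w) \<in> borel_measurable lborel" by (rule interaction_compose) measurable
  have "(\<integral>\<^sup>+w\<in>- D. \<phi> z * interaction z w \<partial>lborel) = (\<integral>\<^sup>+w. \<phi> z * (interaction z w * indicator (- D) w) \<partial>lborel)"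
    by (simp only: mult.assoc)
  also have "\<dots> = \<phi> z * (\<integral>\<^sup>+w\<in>- D. interaction z w \<partial>lborel)"
    by (rule nn_integral_cmult) measurable
  also have "\<dots> \<le> \<phi> z * weight z" by (rule mult_left_mono[OF interaction_row]) simp
  also have "\<dots> = weight z * \<phi> z" by (rule mult.commute)
  finally show "(\<integral>\<^sup>+w\<in>- D. \<phi> z * interaction z w \<partial>lborel) * indicator (- D) z \<le> weight z * \<phi> z * indicator (- D) z"
    by (rule mult_right_mono) simp
qed

text \<open>The Poisson integral of \<open>|g|\<close>. It decides where the Poisson integral of \<open>g\<close> converges and dominates it
  in any case, as a divergent Bochner integral is \<open>0\<close>.\<close>

definition potential :: "('a \<Rightarrow> real) \<Rightarrow> 'a \<Rightarrow> ennreal" where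
  "potential g x = (\<integral>\<^sup>+w\<in>- D. ennreal \<bar>g w\<bar> * poisson x w \<partial>lborel)"

definition extension :: "('a \<Rightarrow> real) \<Rightarrow> 'a \<Rightarrow> real" where
  "extension g x = (if x \<in> D then (LINT z:- D|lborel. g z * enn2real (poisson x z)) else g x)"

definition flux :: "('a \<Rightarrow> real) \<Rightarrow> 'a \<Rightarrow> real" where
  "flux g z = (LINT x:D|lborel. (extension g z - extension g x) * enn2real (J x z))"

lemma potential_measurable:
  assumes [measurable]: "g \<in> borel_measurable borel"
  shows "potential g \<in> borel_measurable borel"
proof -
  have [measurable]: "(\<lambda>w. poisson (fst w) (snd w)) \<in> borel_measurable (borel \<Otimes>\<^sub>M lborel)" by (rule poisson_compose) measurable
  show ?thesis unfolding potential_def by measurable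
qed

lemma extension_measurable:
  assumes [measurable]: "g \<in> borel_measurable borel"
  shows "extension g \<in> borel_measurable borel"
proof -
  have [measurable]: "(\<lambda>w. poisson (fst w) (snd w)) \<in> borel_measurable (borel \<Otimes>\<^sub>M lborel)" by (rule poisson_compose) measurable
  have [measurable]: "(\<lambda>x. LINT z:- D|lborel. g z * enn2real (poisson x z)) \<in> borel_measurable borel"
    unfolding set_lebesgue_integral_def by measurable
  show ?thesis unfolding extension_def by measurable
qed

lemma extension_le_potential:
  assumes "x \<in> D"
  shows "ennreal \<bar>extension g x\<bar> \<le> potential g x"
proof -
  have "ennreal \<bar>extension g x\<bar> \<le> (\<integral>\<^sup>+z. ennreal \<bar>indicator (- D) z *\<^sub>R (g z * enn2real (poisson x z))\<bar> \<partial>lborel)"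
    using assms ennreal_norm_integral_le[of lborel "\<lambda>z. indicator (- D) z *\<^sub>R (g z * enn2real (poisson x z))"]
    by (simp add: extension_def set_lebesgue_integral_def)
  also have "\<dots> \<le> potential g x"
    unfolding potential_def
  proof (rule nn_integral_mono)
    fix z
    have "ennreal \<bar>g z * enn2real (poisson x z)\<bar> \<le> ennreal \<bar>g z\<bar> * poisson x z"
      by (simp add: abs_mult ennreal_mult' mult_left_mono[OF ennreal_enn2real_le])
    then show "ennreal \<bar>indicator (- D) z *\<^sub>R (g z * enn2real (poisson x z))\<bar> \<le> ennreal \<bar>g z\<bar> * poisson x z * indicator (- D) z"
      by (cases "z \<in> D") simp_all
  qed
  finally show ?thesis .
qed

lemma potential_integrable:
  assumes [measurable]: "g \<in> borel_measurable borel" and "potential g x < \<infinity>"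
  shows "set_integrable lborel (- D) (\<lambda>z. g z * enn2real (poisson x z))"
  unfolding set_integrable_def
proof (rule integrableI_bounded)
  have [measurable]: "(\<lambda>z. poisson x z) \<in> borel_measurable lborel" by (rule poisson_compose) measurable
  show "(\<lambda>z. indicator (- D) z *\<^sub>R (g z * enn2real (poisson x z))) \<in> borel_measurable lborel" by measurable
  have "(\<integral>\<^sup>+z. ennreal (norm (indicator (- D) z *\<^sub>R (g z * enn2real (poisson x z)))) \<partial>lborel) \<le> potential g x"
    unfolding potential_def
  proof (rule nn_integral_mono)
    fix z
    have "ennreal \<bar>g z * enn2real (poisson x z)\<bar> \<le> ennreal \<bar>g z\<bar> * poisson x z"
      by (simp add: abs_mult ennreal_mult' mult_left_mono[OF ennreal_enn2real_le])
    then show "ennreal (norm (indicator (- D) z *\<^sub>R (g z * enn2real (poisson x z)))) \<le> ennreal \<bar>g z\<bar> * poisson x z * indicator (- D) z"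
      by (cases "z \<in> D") simp_all
  qed
  then show "(\<integral>\<^sup>+z. ennreal (norm (indicator (- D) z *\<^sub>R (g z * enn2real (poisson x z)))) \<partial>lborel) < \<infinity>"
    using assms(2) by (rule le_less_trans)
qed

lemma potential_interaction:
  assumes [measurable]: "g \<in> borel_measurable borel"
  shows "(\<integral>\<^sup>+x\<in>D. J z x * potential g x \<partial>lborel) = (\<integral>\<^sup>+w\<in>- D. ennreal \<bar>g w\<bar> * interaction z w \<partial>lborel)"
proof -
  have [measurable]: "(\<lambda>x. J z x) \<in> borel_measurable lborel" by (rule J_compose) measurable
  have [measurable]: "(\<lambda>w. poisson x w) \<in> borel_measurable lborel" "(\<lambda>x. poisson x w) \<in> borel_measurable lborel" for x w by (rule poisson_compose; measurable)+
  have [measurable]: "(\<lambda>w. poisson (fst w) (snd w)) \<in> borel_measurable (lborel \<Otimes>\<^sub>M lborel)" by (rule poisson_compose) measurable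
  have "(\<integral>\<^sup>+x\<in>D. J z x * potential g x \<partial>lborel) = (\<integral>\<^sup>+x. (\<integral>\<^sup>+w. J z x * indicator D x * (ennreal \<bar>g w\<bar> * poisson x w * indicator (- D) w) \<partial>lborel) \<partial>lborel)"
    unfolding potential_def by (intro nn_integral_cong) (subst nn_integral_cmult, measurable, simp only: mult_ac)
  also have "\<dots> = (\<integral>\<^sup>+w. (\<integral>\<^sup>+x. J z x * indicator D x * (ennreal \<bar>g w\<bar> * poisson x w * indicator (- D) w) \<partial>lborel) \<partial>lborel)"
    by (rule lborel_pair.Fubini'[symmetric]) measurable
  also have "\<dots> = (\<integral>\<^sup>+w. (\<integral>\<^sup>+x. (ennreal \<bar>g w\<bar> * indicator (- D) w) * (J z x * poisson x w * indicator D x) \<partial>lborel) \<partial>lborel)"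
    by (simp only: mult_ac)
  also have "\<dots> = (\<integral>\<^sup>+w. (ennreal \<bar>g w\<bar> * indicator (- D) w) * interaction z w \<partial>lborel)"
    unfolding interaction_def by (intro nn_integral_cong nn_integral_cmult) measurable
  finally show ?thesis by (simp only: mult_ac)
qed

text \<open>Bound the two terms of the difference separately; the second gives the interaction kernel by Fubini.\<close>

lemma flux_bound:
  assumes g[measurable]: "g \<in> borel_measurable borel" and z: "z \<notin> D" and fin: "weight z < \<infinity>"
    and S: "(\<integral>\<^sup>+w\<in>- D. ennreal \<bar>g w\<bar> * interaction z w \<partial>lborel) < \<infinity>"
  shows "set_integrable lborel D (\<lambda>x. (extension g z - extension g x) * enn2real (J x z))"
    and "ennreal \<bar>flux g z\<bar> \<le> ennreal \<bar>g z\<bar> * weight z + (\<integral>\<^sup>+w\<in>- D. ennreal \<bar>g w\<bar> * interaction z w \<partial>lborel)"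
proof -
  have [measurable]: "(\<lambda>x. J x z) \<in> borel_measurable lborel" "(\<lambda>x. J z x) \<in> borel_measurable lborel" by (rule J_compose; measurable)+
  note [measurable] = extension_measurable[OF g] potential_measurable[OF g]
  let ?F = "\<lambda>x. indicator D x *\<^sub>R ((extension g z - extension g x) * enn2real (J x z))"
  have "(\<integral>\<^sup>+x. ennreal \<bar>?F x\<bar> \<partial>lborel) \<le> (\<integral>\<^sup>+x. ennreal \<bar>g z\<bar> * (J x z * indicator D x) + J z x * potential g x * indicator D x \<partial>lborel)"
  proof (rule nn_integral_mono)
    fix x
    show "ennreal \<bar>?F x\<bar> \<le> ennreal \<bar>g z\<bar> * (J x z * indicator D x) + J z x * potential g x * indicator D x"
    proof (cases "x \<in> D")
      case True
      have "ennreal \<bar>?F x\<bar> = ennreal \<bar>g z - extension g x\<bar> * ennreal (enn2real (J x z))"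
        using True z by (simp add: abs_mult ennreal_mult' extension_def)
      also have "\<dots> \<le> (ennreal \<bar>g z\<bar> + ennreal \<bar>extension g x\<bar>) * J x z"
        by (intro mult_mono ennreal_enn2real_le) (simp_all add: ennreal_plus[symmetric] ennreal_leI del: ennreal_plus)
      also have "\<dots> \<le> (ennreal \<bar>g z\<bar> + potential g x) * J x z"
        by (intro mult_right_mono add_left_mono extension_le_potential True) simp
      finally show ?thesis using True by (simp add: distrib_right J_sym[of z x] mult.commute[of "potential g x"])
    qed simp
  qed
  also have "\<dots> = ennreal \<bar>g z\<bar> * weight z + (\<integral>\<^sup>+w\<in>- D. ennreal \<bar>g w\<bar> * interaction z w \<partial>lborel)"
    unfolding potential_interaction[OF g, symmetric] weight_def
    by (subst nn_integral_add, measurable, subst nn_integral_cmult, measurable)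
  finally have le: "(\<integral>\<^sup>+x. ennreal \<bar>?F x\<bar> \<partial>lborel) \<le> ennreal \<bar>g z\<bar> * weight z + (\<integral>\<^sup>+w\<in>- D. ennreal \<bar>g w\<bar> * interaction z w \<partial>lborel)" .
  also have "\<dots> < \<infinity>" using fin S by (simp add: ennreal_mult_less_top)
  finally have fin': "(\<integral>\<^sup>+x. ennreal \<bar>?F x\<bar> \<partial>lborel) < \<infinity>" .
  show "set_integrable lborel D (\<lambda>x. (extension g z - extension g x) * enn2real (J x z))"
    unfolding set_integrable_def by (rule integrableI_bounded) (measurable, use fin' in simp)
  have "ennreal \<bar>flux g z\<bar> \<le> (\<integral>\<^sup>+x. ennreal \<bar>?F x\<bar> \<partial>lborel)"
    unfolding flux_def set_lebesgue_integral_def by (rule ennreal_norm_integral_le)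
  then show "ennreal \<bar>flux g z\<bar> \<le> ennreal \<bar>g z\<bar> * weight z + (\<integral>\<^sup>+w\<in>- D. ennreal \<bar>g w\<bar> * interaction z w \<partial>lborel)"
    using le by (rule order_trans)
qed

text \<open>Jensen's inequality for the measure \<open>interaction z w dw\<close> on the complement, whose mass is at most
  \<open>weight z\<close>.\<close>

lemma interaction_jensen:
  assumes g[measurable]: "g \<in> borel_measurable borel" and p: "1 < p" and w: "0 < weight z" "weight z < \<infinity>"
    and R: "(\<integral>\<^sup>+w\<in>- D. ennreal (\<bar>g w\<bar> powr p) * interaction z w \<partial>lborel) < \<infinity>"
  defines "S \<equiv> (\<integral>\<^sup>+w\<in>- D. ennreal \<bar>g w\<bar> * interaction z w \<partial>lborel)"
  shows "S < \<infinity>"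
    and "weight z * ennreal ((enn2real S / enn2real (weight z)) powr p) \<le> (\<integral>\<^sup>+w\<in>- D. ennreal (\<bar>g w\<bar> powr p) * interaction z w \<partial>lborel)"
proof -
  have im[measurable]: "(\<lambda>w. interaction z w) \<in> borel_measurable lborel" by (rule interaction_compose) measurable
  define N where "N = density lborel (\<lambda>w. indicator (- D) w * interaction z w)"
  define m where "m = enn2real (weight z)"
  have m: "0 < m" "weight z = ennreal m" using w by (auto simp: m_def enn2real_positive_iff)
  have sets_N[measurable_cong]: "sets N = sets borel" by (simp add: N_def)
  have int: "(\<integral>\<^sup>+w. f w \<partial>N) = (\<integral>\<^sup>+w\<in>- D. f w * interaction z w \<partial>lborel)" if [measurable]: "f \<in> borel_measurable borel" for f
    unfolding N_def by (subst nn_integral_density) (auto intro!: nn_integral_cong simp: mult_ac)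
  have mass: "emeasure N (space N) \<le> ennreal m"
  proof -
    have "emeasure N (space N) = (\<integral>\<^sup>+w. 1 \<partial>N)" by simp
    also have "\<dots> = (\<integral>\<^sup>+w\<in>- D. 1 * interaction z w \<partial>lborel)" by (rule int) simp
    also have "\<dots> \<le> weight z" using interaction_row[of z] by simp
    finally show ?thesis by (simp add: m(2))
  qed
  have S: "S = (\<integral>\<^sup>+w. ennreal \<bar>g w\<bar> \<partial>N)" unfolding S_def by (rule int[symmetric]) measurable
  have R': "(\<integral>\<^sup>+w\<in>- D. ennreal (\<bar>g w\<bar> powr p) * interaction z w \<partial>lborel) = (\<integral>\<^sup>+w. ennreal (\<bar>g w\<bar> powr p) \<partial>N)"
    by (rule int[symmetric]) measurable
  have "(\<lambda>w. \<bar>g w\<bar>) \<in> borel_measurable N" by measurable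
  note J = jensen_submarkov[OF this abs_ge_zero p m(1) mass R[unfolded R']]
  show "S < \<infinity>" unfolding S by (rule J(1))
  have "weight z * ennreal ((enn2real S / enn2real (weight z)) powr p) = ennreal ((enn2real S / m) powr p * m)"
    using m by (simp add: ennreal_mult' mult.commute)
  also have "\<dots> \<le> (\<integral>\<^sup>+w. ennreal (\<bar>g w\<bar> powr p) \<partial>N)" unfolding S by (rule J(2))
  finally show "weight z * ennreal ((enn2real S / enn2real (weight z)) powr p) \<le> (\<integral>\<^sup>+w\<in>- D. ennreal (\<bar>g w\<bar> powr p) * interaction z w \<partial>lborel)"
    unfolding R' .
qed

lemma normalized_flux_bound:
  assumes g[measurable]: "g \<in> borel_measurable borel" and p: "1 < p" and z: "z \<notin> D" and w: "0 < weight z" "weight z < \<infinity>"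
    and R: "(\<integral>\<^sup>+w\<in>- D. ennreal (\<bar>g w\<bar> powr p) * interaction z w \<partial>lborel) < \<infinity>"
  shows "weight z * ennreal (\<bar>flux g z / enn2real (weight z)\<bar> powr p)
    \<le> ennreal (2 powr p) * (weight z * ennreal (\<bar>g z\<bar> powr p) + (\<integral>\<^sup>+w\<in>- D. ennreal (\<bar>g w\<bar> powr p) * interaction z w \<partial>lborel))"
proof -
  define S where "S = (\<integral>\<^sup>+w\<in>- D. ennreal \<bar>g w\<bar> * interaction z w \<partial>lborel)"
  define s where "s = enn2real S"
  define m where "m = enn2real (weight z)"
  have S: "S < \<infinity>" unfolding S_def by (rule interaction_jensen(1)[OF g p w R])
  have s: "S = ennreal s" "0 \<le> s" using S by (auto simp: s_def)
  have m: "0 < m" "weight z = ennreal m" using w by (auto simp: m_def enn2real_positive_iff)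
  have "ennreal \<bar>flux g z\<bar> \<le> ennreal \<bar>g z\<bar> * ennreal m + ennreal s"
    using flux_bound(2)[OF g z w(2)] S unfolding S_def[symmetric] s(1)[symmetric] m(2)[symmetric] by simp
  also have "\<dots> = ennreal (\<bar>g z\<bar> * m + s)" using m s by (simp add: ennreal_mult')
  finally have "ennreal \<bar>flux g z\<bar> \<le> ennreal (\<bar>g z\<bar> * m + s)" .
  then have "\<bar>flux g z\<bar> \<le> \<bar>g z\<bar> * m + s" by (rule iffD1[OF ennreal_le_iff, rotated]) (use m s in simp)
  then have "\<bar>flux g z / m\<bar> \<le> \<bar>g z\<bar> + s / m" using m by (simp add: abs_divide pos_divide_le_eq distrib_right)
  then have "\<bar>flux g z / m\<bar> powr p \<le> (\<bar>g z\<bar> + s / m) powr p" using p by (intro powr_mono2) auto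
  also have "\<dots> \<le> 2 powr p * (\<bar>g z\<bar> powr p + (s / m) powr p)" by (rule powr_add_le) (use s m p in auto)
  finally have "weight z * ennreal (\<bar>flux g z / m\<bar> powr p) \<le> weight z * ennreal (2 powr p * (\<bar>g z\<bar> powr p + (s / m) powr p))"
    by (intro mult_left_mono ennreal_leI) auto
  also have "\<dots> = ennreal (2 powr p) * (weight z * ennreal (\<bar>g z\<bar> powr p) + weight z * ennreal ((s / m) powr p))"
    by (simp add: ennreal_mult' distrib_left mult_ac)
  also have "\<dots> \<le> ennreal (2 powr p) * (weight z * ennreal (\<bar>g z\<bar> powr p) + (\<integral>\<^sup>+w\<in>- D. ennreal (\<bar>g w\<bar> powr p) * interaction z w \<partial>lborel))"
    unfolding s_def m_def S_def by (intro mult_left_mono add_left_mono interaction_jensen(2)[OF g p w R]) auto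
  finally show ?thesis by (simp add: m_def)
qed

end

lemma (in exterior_kernel) flux_measurable:
  assumes g[measurable]: "g \<in> borel_measurable borel"
  shows "flux g \<in> borel_measurable borel"
proof -
  have [measurable]: "(\<lambda>w. J (snd w) (fst w)) \<in> borel_measurable (borel \<Otimes>\<^sub>M lborel)" by (rule J_compose) measurable
  note [measurable] = extension_measurable[OF g]
  show ?thesis unfolding flux_def set_lebesgue_integral_def by measurable
qed

text \<open>One of the two summands is a row sum and the other a column sum.\<close>

lemma (in exterior_kernel) energy_bound:
  assumes [measurable]: "\<phi> \<in> borel_measurable borel"
  shows "(\<integral>\<^sup>+z\<in>- D. (\<integral>\<^sup>+w\<in>- D. (\<phi> w + \<phi> z) * interaction w z \<partial>lborel) \<partial>lborel) \<le> 2 * (\<integral>\<^sup>+w\<in>- D. weight w * \<phi> w \<partial>lborel)"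
proof -
  have [measurable]: "(\<lambda>w. interaction (snd w) (fst w)) \<in> borel_measurable (lborel \<Otimes>\<^sub>M lborel)" "(\<lambda>w. interaction (fst w) (snd w)) \<in> borel_measurable (lborel \<Otimes>\<^sub>M lborel)"
    by (rule interaction_compose; measurable)+
  have [measurable]: "(\<lambda>w. interaction z w) \<in> borel_measurable lborel" "(\<lambda>z. interaction z w) \<in> borel_measurable lborel" for z w by (rule interaction_compose; measurable)+
  have m1[measurable]: "(\<lambda>w. \<integral>\<^sup>+z\<in>- D. \<phi> w * interaction w z \<partial>lborel) \<in> borel_measurable lborel" by measurable
  have m2[measurable]: "(\<lambda>w. \<integral>\<^sup>+z\<in>- D. \<phi> z * interaction w z \<partial>lborel) \<in> borel_measurable lborel" by measurable
  have "(\<integral>\<^sup>+z\<in>- D. (\<integral>\<^sup>+w\<in>- D. (\<phi> w + \<phi> z) * interaction w z \<partial>lborel) \<partial>lborel)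
    = (\<integral>\<^sup>+z. (\<integral>\<^sup>+w. (\<phi> w + \<phi> z) * interaction w z * indicator (- D) w * indicator (- D) z \<partial>lborel) \<partial>lborel)"
    by (intro nn_integral_cong nn_integral_multc[symmetric]) measurable
  also have "\<dots> = (\<integral>\<^sup>+w. (\<integral>\<^sup>+z. (\<phi> w + \<phi> z) * interaction w z * indicator (- D) w * indicator (- D) z \<partial>lborel) \<partial>lborel)"
    by (rule lborel_pair.Fubini') measurable
  also have "\<dots> = (\<integral>\<^sup>+w. (\<integral>\<^sup>+z\<in>- D. \<phi> w * interaction w z \<partial>lborel) * indicator (- D) w + (\<integral>\<^sup>+z\<in>- D. \<phi> z * interaction w z \<partial>lborel) * indicator (- D) w \<partial>lborel)"
  proof (rule nn_integral_cong)
    fix w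
    have "(\<integral>\<^sup>+z. (\<phi> w + \<phi> z) * interaction w z * indicator (- D) w * indicator (- D) z \<partial>lborel)
      = (\<integral>\<^sup>+z. (\<phi> w * interaction w z * indicator (- D) z + \<phi> z * interaction w z * indicator (- D) z) * indicator (- D) w \<partial>lborel)"
      by (rule nn_integral_cong) (simp only: distrib_right distrib_left mult_ac)
    also have "\<dots> = (\<integral>\<^sup>+z. \<phi> w * interaction w z * indicator (- D) z + \<phi> z * interaction w z * indicator (- D) z \<partial>lborel) * indicator (- D) w"
      by (rule nn_integral_multc) measurable
    also have "(\<integral>\<^sup>+z. \<phi> w * interaction w z * indicator (- D) z + \<phi> z * interaction w z * indicator (- D) z \<partial>lborel)
      = (\<integral>\<^sup>+z\<in>- D. \<phi> w * interaction w z \<partial>lborel) + (\<integral>\<^sup>+z\<in>- D. \<phi> z * interaction w z \<partial>lborel)"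
      by (rule nn_integral_add) measurable
    finally show "(\<integral>\<^sup>+z. (\<phi> w + \<phi> z) * interaction w z * indicator (- D) w * indicator (- D) z \<partial>lborel)
      = (\<integral>\<^sup>+z\<in>- D. \<phi> w * interaction w z \<partial>lborel) * indicator (- D) w + (\<integral>\<^sup>+z\<in>- D. \<phi> z * interaction w z \<partial>lborel) * indicator (- D) w"
      by (simp only: distrib_right)
  qed
  also have "\<dots> = (\<integral>\<^sup>+w\<in>- D. (\<integral>\<^sup>+z\<in>- D. \<phi> w * interaction w z \<partial>lborel) \<partial>lborel) + (\<integral>\<^sup>+w\<in>- D. (\<integral>\<^sup>+z\<in>- D. \<phi> z * interaction w z \<partial>lborel) \<partial>lborel)"
    by (rule nn_integral_add) measurable
  also have "\<dots> \<le> (\<integral>\<^sup>+w\<in>- D. weight w * \<phi> w \<partial>lborel) + (\<integral>\<^sup>+w\<in>- D. weight w * \<phi> w \<partial>lborel)"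
    by (intro add_mono weighted_interaction_row weighted_interaction_col) measurable
  finally show ?thesis by (simp only: mult_2)
qed

section \<open>Boundedness of the normalized Dirichlet-to-Neumann operator\<close>

lemma emeasure_open_pos:
  fixes D :: "'a::euclidean_space set"
  assumes "open D" "D \<noteq> {}"
  shows "0 < emeasure lborel D"
proof -
  obtain c r where "0 < r" "ball c r \<subseteq> D" using assms by (meson open_contains_ball all_not_in_conv)
  then have "emeasure lborel (ball c r) \<le> emeasure lborel D" using assms by (intro emeasure_mono) auto
  moreover have "0 < emeasure lborel (ball c r)" using \<open>0 < r\<close> by (simp add: emeasure_ball unit_ball_vol_pos)
  ultimately show ?thesis by (rule less_le_trans[rotated])
qed

theorem corollary6p3:
  fixes \<nu> :: "real \<Rightarrow> ennreal"
    and D :: "'a::euclidean_space set"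
    and M :: "'w measure"
    and X :: "real \<Rightarrow> 'w \<Rightarrow> 'a"
    and pt :: "real \<Rightarrow> 'a \<Rightarrow> ennreal"
    and p :: real
  assumes "levy_density TYPE('a) \<nu>"
    and "jump_process \<nu> M X pt"
    and "2 \<le> p"
    and "cond_A1 \<nu>"
    and "cond_A2 TYPE('a) \<nu>"
    and "D \<noteq> {}" and "open D" and "bounded D"
    and "complement_VDC D"
    and "emeasure lborel (frontier D) = 0"
  shows "Lp_space p (weighted_exterior \<nu> D) \<subseteq> DN_domain \<nu> M X pt D p \<and>
         (\<exists>C. \<forall>g \<in> Lp_space p (weighted_exterior \<nu> D).
            normalized_DN \<nu> M X pt D g \<in> Lp_space p (weighted_exterior \<nu> D) \<and>
            Lp_norm p (weighted_exterior \<nu> D) (normalized_DN \<nu> M X pt D g)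
              \<le> C * Lp_norm p (weighted_exterior \<nu> D) g)"
proof -
  note lev = assms(1) and A1 = assms(4) and D_ne = assms(6) and D_open = assms(7) and D_bd = assms(8) and fr = assms(10)
  have p: "1 < p" "0 < p" using assms(3) by auto
  have D_b[measurable]: "D \<in> sets borel" using D_open by simp
  have cD: "- D \<noteq> {}" using D_bd not_bounded_UNIV by (metis Compl_empty_eq double_complement)
  define \<kappa> where "\<kappa> = killing_rate (\<lambda>z. enn2real (\<nu> (norm z))) D"
  obtain G where G: "(\<lambda>(x, y). G x y) \<in> borel_measurable (borel \<Otimes>\<^sub>M borel)"
    and G_green: "\<And>x y. x \<in> D \<Longrightarrow> y \<in> D \<Longrightarrow> x \<noteq> y \<Longrightarrow> green M X pt D x y = G x y"
    and G_row: "\<And>x. x \<in> D \<Longrightarrow> (\<integral>\<^sup>+y\<in>D. G x y * \<kappa> y \<partial>lborel) \<le> 1"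
    and G_col: "\<And>f. f \<in> borel_measurable borel \<Longrightarrow> (\<integral>\<^sup>+x\<in>D. \<kappa> x * (\<integral>\<^sup>+y\<in>D. G x y * f y \<partial>lborel) \<partial>lborel) \<le> (\<integral>\<^sup>+y\<in>D. f y \<partial>lborel)"
    using green_function_inputs[OF lev assms(2) A1 D_open cD fr] unfolding \<kappa>_def by blast
  have \<nu>m[measurable]: "(\<lambda>z::'a. \<nu> (norm z)) \<in> borel_measurable borel" by (rule levy_profile_measurable[OF A1])
  have \<nu>fin: "\<nu> r < \<infinity>" if "0 < r" for r using A1 that by (simp add: cond_A1_def)
  have \<kappa>: "(\<integral>\<^sup>+z\<in>- D. jump \<nu> x z \<partial>lborel) = \<kappa> x" if "x \<in> D" for x
    unfolding \<kappa>_def killing_rate_def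
  proof (rule nn_integral_cong)
    fix z
    show "jump \<nu> x z * indicator (- D) z = ennreal (enn2real (\<nu> (norm (z - x)))) * indicator (- D) z"
    proof (cases "z \<in> D")
      case False
      then have "0 < norm (z - x)" using that by auto
      then show ?thesis using \<nu>fin[of "norm (z - x)"] by (simp add: jump_def ennreal_enn2real)
    qed simp
  qed
  interpret E: exterior_kernel D "jump \<nu>" G
  proof
    have "(\<lambda>w. \<nu> (norm (snd w - fst w :: 'a))) \<in> borel_measurable (borel \<Otimes>\<^sub>M borel)"
      by (rule measurable_compose[OF _ \<nu>m]) measurable
    then show "(\<lambda>(x, z). jump \<nu> x (z::'a)) \<in> borel_measurable (borel \<Otimes>\<^sub>M borel)"
      by (simp add: jump_def case_prod_beta)
    show "jump \<nu> x z = jump \<nu> z x" for x z :: 'a by (simp add: jump_def norm_minus_commute)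
    show "0 < jump \<nu> x z" for x z :: 'a using lev by (simp add: jump_def levy_density_def)
    show "(\<integral>\<^sup>+y\<in>D. G x y * (\<integral>\<^sup>+z\<in>- D. jump \<nu> y z \<partial>lborel) \<partial>lborel) \<le> 1" if "x \<in> D" for x
    proof -
      have "(\<integral>\<^sup>+y\<in>D. G x y * (\<integral>\<^sup>+z\<in>- D. jump \<nu> y z \<partial>lborel) \<partial>lborel) = (\<integral>\<^sup>+y\<in>D. G x y * \<kappa> y \<partial>lborel)"
      proof (rule nn_integral_cong)
        fix y
        show "G x y * (\<integral>\<^sup>+z\<in>- D. jump \<nu> y z \<partial>lborel) * indicator D y = G x y * \<kappa> y * indicator D y"
          by (cases "y \<in> D") (simp_all only: \<kappa> indicator_simps mult_zero_right not_False_eq_True)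
      qed
      then show ?thesis using G_row[OF that] by simp
    qed
    show "(\<integral>\<^sup>+x\<in>D. (\<integral>\<^sup>+z\<in>- D. jump \<nu> x z \<partial>lborel) * (\<integral>\<^sup>+y\<in>D. G x y * f y \<partial>lborel) \<partial>lborel) \<le> (\<integral>\<^sup>+y\<in>D. f y \<partial>lborel)"
      if "f \<in> borel_measurable borel" for f
    proof -
      have "(\<integral>\<^sup>+x\<in>D. (\<integral>\<^sup>+z\<in>- D. jump \<nu> x z \<partial>lborel) * (\<integral>\<^sup>+y\<in>D. G x y * f y \<partial>lborel) \<partial>lborel)
        = (\<integral>\<^sup>+x\<in>D. \<kappa> x * (\<integral>\<^sup>+y\<in>D. G x y * f y \<partial>lborel) \<partial>lborel)"
      proof (rule nn_integral_cong)
        fix x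
        show "(\<integral>\<^sup>+z\<in>- D. jump \<nu> x z \<partial>lborel) * (\<integral>\<^sup>+y\<in>D. G x y * f y \<partial>lborel) * indicator D x = \<kappa> x * (\<integral>\<^sup>+y\<in>D. G x y * f y \<partial>lborel) * indicator D x"
          by (cases "x \<in> D") (simp_all only: \<kappa> indicator_simps mult_zero_right not_False_eq_True)
      qed
      then show ?thesis using G_col[OF that] by simp
    qed
  qed (rule D_b, rule G)
  have weight_eq: "dn_weight \<nu> D = E.weight" by (simp add: fun_eq_iff dn_weight_def E.weight_def)
  have AE_ne: "AE y in lborel. y \<noteq> x" for x :: 'a by (rule AE_lborel_singleton)
  have poisson_eq: "poisson_kernel \<nu> M X pt D x z = E.poisson x z" if "x \<in> D" for x z
    unfolding poisson_kernel_def E.poisson_def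
  proof (rule nn_integral_cong_AE)
    show "AE y in lborel. green M X pt D x y * jump \<nu> y z * indicator D y = G x y * jump \<nu> y z * indicator D y"
      using AE_ne[of x] by eventually_elim (use G_green[OF that] in \<open>auto simp: indicator_def\<close>)
  qed
  have interaction_eq: "interaction_kernel \<nu> M X pt D w z = E.interaction w z" for w z
    unfolding interaction_kernel_def E.interaction_def
  proof (rule nn_integral_cong)
    fix x
    have [measurable]: "(\<lambda>y. G x y) \<in> borel_measurable lborel" by (rule E.G_compose) measurable
    have [measurable]: "(\<lambda>y. jump \<nu> y z) \<in> borel_measurable lborel" by (rule E.J_compose) measurable
    show "(\<integral>\<^sup>+y\<in>D. jump \<nu> w x * green M X pt D x y * jump \<nu> y z \<partial>lborel) * indicator D x = jump \<nu> w x * E.poisson x z * indicator D x"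
    proof (cases "x \<in> D")
      case True
      have "(\<integral>\<^sup>+y\<in>D. jump \<nu> w x * green M X pt D x y * jump \<nu> y z \<partial>lborel) = (\<integral>\<^sup>+y. jump \<nu> w x * (G x y * jump \<nu> y z * indicator D y) \<partial>lborel)"
      proof (rule nn_integral_cong_AE)
        show "AE y in lborel. jump \<nu> w x * green M X pt D x y * jump \<nu> y z * indicator D y = jump \<nu> w x * (G x y * jump \<nu> y z * indicator D y)"
          using AE_ne[of x] by eventually_elim (use G_green[OF True] in \<open>auto simp: indicator_def mult.assoc\<close>)
      qed
      also have "\<dots> = jump \<nu> w x * E.poisson x z"
        unfolding E.poisson_def by (rule nn_integral_cmult) measurable
      finally show ?thesis by simp
    qed simp
  qed
  have D_pos: "0 < emeasure lborel D" by (rule emeasure_open_pos[OF D_open D_ne])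
  have D_fin: "emeasure lborel D < \<infinity>" by (rule emeasure_bounded_finite[OF D_bd])
  have weight_pos: "0 < E.weight z" for z
  proof (rule ccontr)
    have [measurable]: "(\<lambda>y. jump \<nu> y z) \<in> borel_measurable lborel" by (rule E.J_compose) measurable
    assume "\<not> 0 < E.weight z"
    then have "(\<integral>\<^sup>+x. jump \<nu> x z * indicator D x \<partial>lborel) = 0" by (simp add: E.weight_def)
    then have "AE x in lborel. jump \<nu> x z * indicator D x = 0" by (subst (asm) nn_integral_0_iff_AE) measurable
    then have "AE x in lborel. x \<notin> D"
    proof eventually_elim
      case (elim x)
      then show ?case using E.J_pos[of x z] by auto
    qed
    then have "emeasure lborel D = 0" by (subst (asm) AE_iff_measurable[of D]) auto
    then show False using D_pos by simp
  qed
  have weight_fin: "E.weight z < \<infinity>" if zc: "z \<notin> closure D" for z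
  proof -
    obtain d where d: "0 < d" "\<And>x. x \<in> D \<Longrightarrow> d \<le> dist x z"
      using zc unfolding closure_approachable by (metis not_less)
    have "E.weight z \<le> (\<integral>\<^sup>+x. \<nu> d * indicator D x \<partial>lborel)"
      unfolding E.weight_def
    proof (rule nn_integral_mono)
      fix x
      show "jump \<nu> x z * indicator D x \<le> \<nu> d * indicator D x"
      proof (cases "x \<in> D")
        case True
        have "antimono_on {0..} \<nu>" using lev by (simp add: levy_density_def)
        then have "\<nu> (norm (z - x)) \<le> \<nu> d"
          using d(1) d(2)[OF True] by (intro monotone_onD[of "{0..}" "(\<le>)" "(\<ge>)" \<nu>]) (auto simp: dist_norm norm_minus_commute)
        then show ?thesis using True by (simp add: jump_def)
      qed simp
    qed
    also have "\<dots> = \<nu> d * emeasure lborel D" by (simp add: nn_integral_cmult_indicator)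
    also have "\<dots> < \<infinity>" using \<nu>fin[OF d(1)] D_fin by (simp add: ennreal_mult_less_top)
    finally show ?thesis .
  qed
  have frn: "frontier D \<in> null_sets lborel" using fr by (intro null_setsI) auto
  have AE_weight: "AE z in lborel. z \<notin> D \<longrightarrow> E.weight z < \<infinity>"
    using AE_not_in[OF frn] by eventually_elim (use D_open in \<open>auto intro!: weight_fin[unfolded infinity_ennreal_def] simp: frontier_def interior_open\<close>)
  let ?N = "weighted_exterior \<nu> D"
  have sets_N: "sets ?N = sets (restrict_space borel (- D))"
    unfolding weighted_exterior_def by (simp add: sets_restrict_space)
  have meas_N: "f \<in> borel_measurable ?N \<longleftrightarrow> f \<in> borel_measurable (restrict_space borel (- D))" for f :: "'a \<Rightarrow> real"
    by (rule arg_cong2[of _ _ _ _ "\<lambda>A B. f \<in> A \<longleftrightarrow> f \<in> B", OF measurable_cong_sets[OF sets_N refl] refl, THEN iffD2]) simp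
  have space_N: "space ?N = - D" unfolding weighted_exterior_def by (simp add: space_restrict_space)
  have nn_N: "(\<integral>\<^sup>+z. f z \<partial>?N) = (\<integral>\<^sup>+z\<in>- D. E.weight z * f z \<partial>lborel)" if [measurable]: "f \<in> borel_measurable borel" for f
  proof -
    have "(\<integral>\<^sup>+z. f z \<partial>?N) = (\<integral>\<^sup>+z. E.weight z * f z \<partial>restrict_space lborel (- D))"
      unfolding weighted_exterior_def weight_eq
      by (rule nn_integral_density) (rule measurable_restrict_space1, measurable)+
    also have "\<dots> = (\<integral>\<^sup>+z\<in>- D. E.weight z * f z \<partial>lborel)" by (rule nn_integral_restrict_space) simp
    finally show ?thesis .
  qed
  have main: "g \<in> DN_domain \<nu> M X pt D p \<and> normalized_DN \<nu> M X pt D g \<in> Lp_space p ?N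
      \<and> Lp_norm p ?N (normalized_DN \<nu> M X pt D g) \<le> (2 powr p * 2) powr (1 / p) * Lp_norm p ?N g"
    if g: "g \<in> Lp_space p ?N" for g
  proof -
    have gN: "g \<in> borel_measurable (restrict_space borel (- D))" and gi: "integrable ?N (\<lambda>x. \<bar>g x\<bar> powr p)"
      using g by (auto simp: Lp_space_def meas_N)
    \<comment> \<open>A Borel function on the whole space that agrees with \<open>g\<close> where its values count.\<close>
    define f where "f z = indicator (- D) z *\<^sub>R g z" for z
    have fm[measurable]: "f \<in> borel_measurable borel"
      using gN unfolding f_def by (subst (asm) borel_measurable_restrict_space_iff) auto
    have fg: "f z = g z" if "z \<notin> D" for z using that by (simp add: f_def)
    define a where "a z = ennreal (\<bar>f z\<bar> powr p)" for z
    have [measurable]: "a \<in> borel_measurable borel" unfolding a_def by measurable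
    define \<Psi> where "\<Psi> = (\<integral>\<^sup>+z\<in>- D. E.weight z * a z \<partial>lborel)"
    have \<Psi>N: "(\<integral>\<^sup>+z. ennreal (\<bar>g z\<bar> powr p) \<partial>?N) = \<Psi>"
    proof -
      have "(\<integral>\<^sup>+z. ennreal (\<bar>g z\<bar> powr p) \<partial>?N) = (\<integral>\<^sup>+z. a z \<partial>?N)"
        by (rule nn_integral_cong) (simp add: space_N a_def fg)
      also have "\<dots> = \<Psi>" unfolding \<Psi>_def by (rule nn_N) measurable
      finally show ?thesis .
    qed
    have \<Psi>fin: "\<Psi> < \<infinity>" using gi unfolding \<Psi>N[symmetric] by (simp add: integrable_iff_bounded)
    define R where "R z = (\<integral>\<^sup>+w\<in>- D. a w * E.interaction z w \<partial>lborel)" for z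
    have [measurable]: "(\<lambda>w. E.interaction (fst w) (snd w)) \<in> borel_measurable (lborel \<Otimes>\<^sub>M lborel)" by (rule E.interaction_compose) measurable
    have Rm[measurable]: "R \<in> borel_measurable lborel" unfolding R_def by measurable
    have R_int: "(\<integral>\<^sup>+z\<in>- D. R z \<partial>lborel) \<le> \<Psi>"
      unfolding R_def \<Psi>_def by (rule E.weighted_interaction_col) measurable
    have "AE z in lborel. R z * indicator (- D) z \<noteq> \<infinity>"
      by (rule nn_integral_PInf_AE) (use R_int \<Psi>fin in \<open>auto simp: top_unique\<close>)
    then have good: "AE z in lborel. z \<notin> D \<longrightarrow> E.weight z < \<infinity> \<and> R z < \<infinity>"
      using AE_weight by eventually_elim (auto simp: less_top)
    have ext_eq: "poisson_ext \<nu> M X pt D g = E.extension f"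
    proof
      fix x
      show "poisson_ext \<nu> M X pt D g x = E.extension f x"
      proof (cases "x \<in> D")
        case True
        then show ?thesis unfolding poisson_ext_def E.extension_def set_lebesgue_integral_def
          by (auto intro!: Bochner_Integration.integral_cong simp: poisson_eq fg indicator_def)
      qed (simp add: poisson_ext_def E.extension_def fg)
    qed
    have DN_eq: "DN \<nu> M X pt D g z = E.flux f z" for z
      by (simp add: DN_def normal_derivative_def ext_eq E.flux_def)
    have nDN_eq: "normalized_DN \<nu> M X pt D g z = E.flux f z / enn2real (E.weight z)" for z
      by (simp add: normalized_DN_def DN_eq weight_eq)
    have S_fin: "(\<integral>\<^sup>+w\<in>- D. ennreal \<bar>f w\<bar> * E.interaction z w \<partial>lborel) < \<infinity>"
      if "E.weight z < \<infinity>" "R z < \<infinity>" for z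
      by (rule E.interaction_jensen(1)[OF fm p(1) weight_pos that(1)]) (use that(2) in \<open>simp add: R_def a_def\<close>)
    have form: "exterior_form \<nu> M X pt D p g < \<infinity>"
    proof -
      have "(\<integral>\<^sup>+z\<in>- D. (\<integral>\<^sup>+w\<in>- D. ennreal (bregman p (g w) (g z)) * interaction_kernel \<nu> M X pt D w z \<partial>lborel) \<partial>lborel)
        \<le> (\<integral>\<^sup>+z. ennreal (1 + 2 * p) * ((\<integral>\<^sup>+w\<in>- D. (a w + a z) * E.interaction w z \<partial>lborel) * indicator (- D) z) \<partial>lborel)"
      proof (rule nn_integral_mono)
        fix z
        have [measurable]: "(\<lambda>w. E.interaction w z) \<in> borel_measurable lborel" by (rule E.interaction_compose) measurable
        have "(\<integral>\<^sup>+w\<in>- D. ennreal (bregman p (g w) (g z)) * interaction_kernel \<nu> M X pt D w z \<partial>lborel)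
          \<le> ennreal (1 + 2 * p) * (\<integral>\<^sup>+w\<in>- D. (a w + a z) * E.interaction w z \<partial>lborel)" if z: "z \<notin> D"
        proof -
          have "(\<integral>\<^sup>+w\<in>- D. ennreal (bregman p (g w) (g z)) * interaction_kernel \<nu> M X pt D w z \<partial>lborel)
            \<le> (\<integral>\<^sup>+w. ennreal (1 + 2 * p) * ((a w + a z) * E.interaction w z * indicator (- D) w) \<partial>lborel)"
          proof (rule nn_integral_mono)
            fix w
            show "ennreal (bregman p (g w) (g z)) * interaction_kernel \<nu> M X pt D w z * indicator (- D) w
              \<le> ennreal (1 + 2 * p) * ((a w + a z) * E.interaction w z * indicator (- D) w)"
            proof (cases "w \<in> D")
              case False
              have "ennreal (bregman p (g w) (g z)) \<le> ennreal ((1 + 2 * p) * (\<bar>f w\<bar> powr p + \<bar>f z\<bar> powr p))"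
                using bregman_le[OF assms(3), of "g w" "g z"] z False by (intro ennreal_leI) (simp add: fg)
              also have "\<dots> = ennreal (1 + 2 * p) * (a w + a z)" using p by (simp add: a_def ennreal_mult')
              finally have "ennreal (bregman p (g w) (g z)) * E.interaction w z \<le> ennreal (1 + 2 * p) * (a w + a z) * E.interaction w z"
                by (rule mult_right_mono) simp
              then show ?thesis using False by (simp add: interaction_eq mult.assoc)
            qed simp
          qed
          also have "\<dots> = ennreal (1 + 2 * p) * (\<integral>\<^sup>+w\<in>- D. (a w + a z) * E.interaction w z \<partial>lborel)"
            by (rule nn_integral_cmult) measurable
          finally show ?thesis .
        qed
        then show "(\<integral>\<^sup>+w\<in>- D. ennreal (bregman p (g w) (g z)) * interaction_kernel \<nu> M X pt D w z \<partial>lborel) * indicator (- D) z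
          \<le> ennreal (1 + 2 * p) * ((\<integral>\<^sup>+w\<in>- D. (a w + a z) * E.interaction w z \<partial>lborel) * indicator (- D) z)"
          by (cases "z \<in> D") simp_all
      qed
      also have "\<dots> = ennreal (1 + 2 * p) * (\<integral>\<^sup>+z\<in>- D. (\<integral>\<^sup>+w\<in>- D. (a w + a z) * E.interaction w z \<partial>lborel) \<partial>lborel)"
      proof (rule nn_integral_cmult)
        have [measurable]: "(\<lambda>w. E.interaction (snd w) (fst w)) \<in> borel_measurable (lborel \<Otimes>\<^sub>M lborel)" by (rule E.interaction_compose) measurable
        show "(\<lambda>z. (\<integral>\<^sup>+w\<in>- D. (a w + a z) * E.interaction w z \<partial>lborel) * indicator (- D) z) \<in> borel_measurable lborel" by measurable
      qed
      also have "\<dots> \<le> ennreal (1 + 2 * p) * (2 * \<Psi>)"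
        unfolding \<Psi>_def by (intro mult_left_mono E.energy_bound) auto
      also have "\<dots> < \<infinity>" using \<Psi>fin by (simp add: ennreal_mult_less_top)
      finally show ?thesis unfolding exterior_form_def by (simp add: ennreal_mult_less_top)
    qed
    have ae1: "AE x in lborel. x \<in> D \<longrightarrow> set_integrable lborel (- D) (\<lambda>z. g z * enn2real (poisson_kernel \<nu> M X pt D x z))"
    proof -
      \<comment> \<open>One exterior point with finite data controls the potential almost everywhere in \<open>D\<close>, as the jump
        kernel is positive; such a point exists because the complement of a bounded set has positive measure.\<close>
      obtain z where z: "z \<notin> D" "E.weight z < \<infinity>" "R z < \<infinity>"
      proof (rule ccontr)
        note found = that
        assume "\<not> thesis"
        then have *: "\<not> (E.weight z < \<infinity> \<and> R z < \<infinity>)" if zD: "z \<notin> D" for z using found[OF zD] by blast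
        have "AE z in lborel. z \<in> D" using good by eventually_elim (use * in blast)
        then have "emeasure lborel (- D) = 0" by (subst (asm) AE_iff_measurable[of "- D"]) auto
        then have "emeasure lborel (D \<union> - D) \<le> emeasure lborel D + 0" using emeasure_subadditive[of D lborel "- D"] by simp
        then show False using D_fin by (simp add: top_unique)
      qed
      have [measurable]: "(\<lambda>x. jump \<nu> z x) \<in> borel_measurable lborel" by (rule E.J_compose) measurable
      note [measurable] = E.potential_measurable[OF fm]
      have "(\<integral>\<^sup>+x\<in>D. jump \<nu> z x * E.potential f x \<partial>lborel) < \<infinity>"
        unfolding E.potential_interaction[OF fm] by (rule S_fin[OF z(2,3)])
      then have "AE x in lborel. jump \<nu> z x * E.potential f x * indicator D x \<noteq> \<infinity>"
        by (intro nn_integral_PInf_AE) auto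
      then show ?thesis
      proof eventually_elim
        case (elim x)
        show ?case
        proof
          assume x: "x \<in> D"
          have "E.potential f x < \<infinity>"
          proof (rule ccontr)
            assume "\<not> E.potential f x < \<infinity>"
            then have "E.potential f x = \<infinity>" by (cases "E.potential f x") auto
            then show False using elim x E.J_pos[of z x] by (auto simp: ennreal_mult_top split: if_splits)
          qed
          then have "set_integrable lborel (- D) (\<lambda>z. f z * enn2real (E.poisson x z))"
            by (rule E.potential_integrable[OF fm])
          then show "set_integrable lborel (- D) (\<lambda>z. g z * enn2real (poisson_kernel \<nu> M X pt D x z))"
            by (rule set_integrable_cong[OF refl refl, THEN iffD1, rotated]) (simp add: fg poisson_eq[OF x])
        qed
      qed
    qed
    have ae2: "AE z in lborel. z \<notin> D \<longrightarrow> set_integrable lborel D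
             (\<lambda>x. (poisson_ext \<nu> M X pt D g z - poisson_ext \<nu> M X pt D g x) * enn2real (jump \<nu> x z))"
      using good unfolding ext_eq by eventually_elim (auto intro!: E.flux_bound(1)[OF fm] S_fin)
    have dom: "g \<in> DN_domain \<nu> M X pt D p"
      unfolding DN_domain_def exterior_space_def using gN form ae1 ae2 by simp
    define H where "H z = E.flux f z / enn2real (E.weight z)" for z
    note [measurable] = E.flux_measurable[OF fm]
    have Hm[measurable]: "H \<in> borel_measurable borel" unfolding H_def by measurable
    \<comment> \<open>The factor \<open>2 powr p\<close> splits the sum of the two terms of the flux; each of them contributes \<open>\<Psi>\<close>.\<close>
    have H_nn: "(\<integral>\<^sup>+z. ennreal (\<bar>H z\<bar> powr p) \<partial>?N) \<le> ennreal (2 powr p * 2) * \<Psi>"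
    proof -
      have "(\<integral>\<^sup>+z. ennreal (\<bar>H z\<bar> powr p) \<partial>?N) = (\<integral>\<^sup>+z\<in>- D. E.weight z * ennreal (\<bar>H z\<bar> powr p) \<partial>lborel)"
        by (rule nn_N) measurable
      also have "\<dots> \<le> (\<integral>\<^sup>+z. ennreal (2 powr p) * (E.weight z * a z * indicator (- D) z + R z * indicator (- D) z) \<partial>lborel)"
      proof (rule nn_integral_mono_AE)
        show "AE z in lborel. E.weight z * ennreal (\<bar>H z\<bar> powr p) * indicator (- D) z
          \<le> ennreal (2 powr p) * (E.weight z * a z * indicator (- D) z + R z * indicator (- D) z)"
          using good
        proof eventually_elim
          case (elim z)
          show ?case
          proof (cases "z \<in> D")
            case False
            then have "E.weight z * ennreal (\<bar>H z\<bar> powr p) \<le> ennreal (2 powr p) * (E.weight z * a z + R z)"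
              unfolding H_def R_def a_def
              by (intro E.normalized_flux_bound[OF fm p(1) False weight_pos]) (use elim in \<open>auto simp: R_def a_def\<close>)
            then show ?thesis using False by simp
          qed simp
        qed
      qed
      also have "\<dots> = ennreal (2 powr p) * (\<integral>\<^sup>+z. E.weight z * a z * indicator (- D) z + R z * indicator (- D) z \<partial>lborel)"
        by (rule nn_integral_cmult) measurable
      also have "(\<integral>\<^sup>+z. E.weight z * a z * indicator (- D) z + R z * indicator (- D) z \<partial>lborel) = \<Psi> + (\<integral>\<^sup>+z\<in>- D. R z \<partial>lborel)"
        unfolding \<Psi>_def by (rule nn_integral_add) measurable
      also have "ennreal (2 powr p) * \<dots> \<le> ennreal (2 powr p) * (\<Psi> + \<Psi>)"
        by (intro mult_left_mono add_left_mono R_int) simp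
      also have "\<dots> = ennreal (2 powr p * 2) * \<Psi>" by (simp add: ennreal_mult' mult_2[symmetric] mult.assoc)
      finally show ?thesis .
    qed
    have HN: "H \<in> borel_measurable ?N" unfolding meas_N by (rule measurable_restrict_space1) measurable
    have nDN_H: "normalized_DN \<nu> M X pt D g = H" by (simp add: fun_eq_iff nDN_eq H_def)
    have Hi: "integrable ?N (\<lambda>z. \<bar>H z\<bar> powr p)"
    proof (rule integrableI_nonneg)
      show "(\<lambda>z. \<bar>H z\<bar> powr p) \<in> borel_measurable ?N" using HN by measurable
      show "(\<integral>\<^sup>+z. ennreal (\<bar>H z\<bar> powr p) \<partial>?N) < \<infinity>"
        using H_nn \<Psi>fin by (auto simp: ennreal_mult_less_top intro: le_less_trans)
    qed auto
    have norm: "Lp_norm p ?N H \<le> (2 powr p * 2) powr (1 / p) * Lp_norm p ?N g"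
    proof -
      have e1: "ennreal (LINT z|?N. \<bar>H z\<bar> powr p) = (\<integral>\<^sup>+z. ennreal (\<bar>H z\<bar> powr p) \<partial>?N)"
        by (rule nn_integral_eq_integral[symmetric, OF Hi]) auto
      have e2: "ennreal (LINT z|?N. \<bar>g z\<bar> powr p) = \<Psi>"
        unfolding \<Psi>N[symmetric] by (rule nn_integral_eq_integral[symmetric, OF gi]) auto
      have nn: "0 \<le> (LINT z|?N. \<bar>g z\<bar> powr p)" "0 \<le> (LINT z|?N. \<bar>H z\<bar> powr p)" by simp_all
      have "ennreal (LINT z|?N. \<bar>H z\<bar> powr p) \<le> ennreal (2 powr p * 2 * (LINT z|?N. \<bar>g z\<bar> powr p))"
        using H_nn unfolding e1[symmetric] e2[symmetric] by (simp add: ennreal_mult' nn)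
      then have "(LINT z|?N. \<bar>H z\<bar> powr p) \<le> 2 powr p * 2 * (LINT z|?N. \<bar>g z\<bar> powr p)"
        using nn by (simp add: ennreal_le_iff)
      then have "(LINT z|?N. \<bar>H z\<bar> powr p) powr (1 / p) \<le> (2 powr p * 2 * (LINT z|?N. \<bar>g z\<bar> powr p)) powr (1 / p)"
        using nn p by (intro powr_mono2) auto
      also have "\<dots> = (2 powr p * 2) powr (1 / p) * (LINT z|?N. \<bar>g z\<bar> powr p) powr (1 / p)"
        by (rule powr_mult)
      finally show ?thesis by (simp add: Lp_norm_def)
    qed
    show ?thesis
      using dom HN Hi norm unfolding nDN_H by (simp add: Lp_space_def)
  qed
  show ?thesis using main by blast
qed

end
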